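(* Let $\alpha\in(0,1)$ be an irrational number of bounded type, $Tx=x+\alpha$ on $\mathbb T$, and let $\beta$ be a real number. 1) For every rational number $\frac rs\in(0,1)$, the $\mathbb R^2$-valued cocycle $x\mapsto\bigl(1_{[0,\frac rs)}(x)-\frac rs,\;1_{[0,\frac rs)}(x+\beta)-\frac rs\bigr)$ is regular over $T$. 2) If $\frac{r_1}{s_1},\dots,\frac{r_d}{s_d}$ are rational numbers such that $0<\frac{r_i}{s_i}\beta<1$ for all $i$, then for all real numbers $t_1,\dots,t_d$ the real-valued cocycle $\varphi=\sum_{i=1}^d t_i\,1_{[0,\frac{r_i}{s_i}\beta)}-\beta\sum_{i=1}^d t_i\frac{r_i}{s_i}$ is regular over $T$.
   Context: $\mathbb T=[0,1)$ is the additive circle (addition mod $1$, arguments of functions taken mod $1$) with Lebesgue measure $\mu$. An irrational $\alpha=[0;a_1,a_2,\dots]$ is of bounded type if its sequence of partial quotients $(a_n)$ is bounded. A measurable function $\Phi:\mathbb T\to\mathbb R^m$ is called a cocycle over $T$. Two cocycles $\Phi,\Psi:\mathbb T\to\mathbb R^m$ are cohomologous if $\Phi-\Psi=f-f\circ T$ a.e. for some measurable $f:\mathbb T\to\mathbb R^m$. A cocycle $\Phi:\mathbb T\to\mathbb R^m$ is regular if it is cohomologous to a cocycle $\Psi$ taking values in a closed subgroup $H\subset\mathbb R^m$ such that $T_\Psi(x,h)=(Tx,h+\Psi(x))$ is ergodic on $\mathbb T\times H$ for the product of $\mu$ and Haar measure on $H$. *)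

theory Defs
  imports "HOL-Analysis.Analysis"
begin

text \<open>
  The circle is represented by its fundamental domain \<open>{0..<1}\<close>; functions on it are functions on
  \<open>real\<close> of which only the values on \<open>{0..<1}\<close> matter. Measurability is Borel measurability;
  every Lebesgue measurable function agrees almost everywhere with a Borel one.
\<close>

definition circle :: "real measure" where
  "circle = restrict_space lborel {0..<1}"

definition rotation :: "real \<Rightarrow> real \<Rightarrow> real" where
  "rotation \<alpha> x = frac (x + \<alpha>)"


text \<open>
  Continued fractions via the Gauss map: if \<open>\<alpha> = [a\<^sub>0; a\<^sub>1, a\<^sub>2, \<dots>]\<close> is irrational, then
  \<open>gauss_orbit \<alpha> n = [0; a\<^bsub>n+1\<^esub>, a\<^bsub>n+2\<^esub>, \<dots>]\<close>.
\<close>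

primrec gauss_orbit :: "real \<Rightarrow> nat \<Rightarrow> real" where
  "gauss_orbit \<alpha> 0 = frac \<alpha>"
| "gauss_orbit \<alpha> (Suc n) = frac (1 / gauss_orbit \<alpha> n)"

primrec partial_quotient :: "real \<Rightarrow> nat \<Rightarrow> int" where
  "partial_quotient \<alpha> 0 = \<lfloor>\<alpha>\<rfloor>"
| "partial_quotient \<alpha> (Suc n) = \<lfloor>1 / gauss_orbit \<alpha> n\<rfloor>"

definition bounded_type :: "real \<Rightarrow> bool" where
  "bounded_type \<alpha> \<longleftrightarrow> \<alpha> \<notin> \<rat> \<and> (\<exists>K. \<forall>n\<ge>1. partial_quotient \<alpha> n \<le> K)"


definition measure_preserving :: "'a measure \<Rightarrow> ('a \<Rightarrow> 'a) \<Rightarrow> bool" where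
  "measure_preserving M S \<longleftrightarrow> S \<in> measurable M M \<and> distr M M S = M"

text \<open>The measure may be infinite, so both alternatives are stated through null sets.\<close>

definition ergodic :: "'a measure \<Rightarrow> ('a \<Rightarrow> 'a) \<Rightarrow> bool" where
  "ergodic M S \<longleftrightarrow> measure_preserving M S \<and>
     (\<forall>A\<in>sets M. S -` A \<inter> space M = A \<longrightarrow> emeasure M A = 0 \<or> emeasure M (space M - A) = 0)"


definition closed_subgroup :: "'a::euclidean_space set \<Rightarrow> bool" where
  "closed_subgroup H \<longleftrightarrow> closed H \<and> 0 \<in> H \<and> (\<forall>x\<in>H. \<forall>y\<in>H. x - y \<in> H)"

text \<open>
  A Haar measure on \<open>H\<close>, unique up to a positive factor. Since \<open>H\<close> is locally compact and second
  countable, regularity is automatic for Borel measures that are finite on compact sets.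
\<close>

definition haar_measure_on :: "'a::euclidean_space set \<Rightarrow> 'a measure \<Rightarrow> bool" where
  "haar_measure_on H \<nu> \<longleftrightarrow>
     sets \<nu> = sets (restrict_space borel H) \<and>
     (\<forall>h\<in>H. distr \<nu> \<nu> (\<lambda>x. h + x) = \<nu>) \<and>
     (\<forall>K\<subseteq>H. compact K \<longrightarrow> emeasure \<nu> K < \<infinity>) \<and>
     emeasure \<nu> H \<noteq> 0"


definition cocycle :: "(real \<Rightarrow> 'a::euclidean_space) \<Rightarrow> bool" where
  "cocycle \<Phi> \<longleftrightarrow> \<Phi> \<in> borel_measurable circle"

definition cohomologous ::
    "(real \<Rightarrow> real) \<Rightarrow> (real \<Rightarrow> 'a::euclidean_space) \<Rightarrow> (real \<Rightarrow> 'a) \<Rightarrow> bool" where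
  "cohomologous T \<Phi> \<Psi> \<longleftrightarrow> cocycle \<Phi> \<and> cocycle \<Psi> \<and>
     (\<exists>f\<in>borel_measurable circle. AE x in circle. \<Phi> x - \<Psi> x = f x - f (T x))"

definition skew_product ::
    "(real \<Rightarrow> real) \<Rightarrow> (real \<Rightarrow> 'a::euclidean_space) \<Rightarrow> real \<times> 'a \<Rightarrow> real \<times> 'a" where
  "skew_product T \<Psi> = (\<lambda>(x, h). (T x, h + \<Psi> x))"

text \<open>
  Ergodicity of the skew product does not depend on the normalisation of the Haar measure \<open>\<nu>\<close>.
\<close>

definition regular_cocycle :: "(real \<Rightarrow> real) \<Rightarrow> (real \<Rightarrow> 'a::euclidean_space) \<Rightarrow> bool" where
  "regular_cocycle T \<Phi> \<longleftrightarrow>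
     (\<exists>\<Psi> H \<nu>. cohomologous T \<Phi> \<Psi> \<and> closed_subgroup H \<and> (\<forall>x\<in>{0..<1}. \<Psi> x \<in> H) \<and>
        haar_measure_on H \<nu> \<and> ergodic (circle \<Otimes>\<^sub>M \<nu>) (skew_product T \<Psi>))"

end

theory Submission imports Defs begin

text \<open>
  Write the cocycle as a combination of translates of the sawtooth \<open>frac x - 1/2\<close> whose vector weights sum
  to zero. Discontinuities that agree modulo \<open>\<int>\<alpha> + \<int>\<close> are merged at the cost of a coboundary. As \<open>\<alpha>\<close> is badly
  approximable and the discontinuities lie in \<open>(\<int>\<beta> + \<int>)/M\<close>, there are arbitrarily large \<open>N\<close> for which those of the
  \<open>q\<close>-th Birkhoff sum, \<open>q \<le> N\<close>, are \<open>\<delta>/N\<close>-separated. With a denominator \<open>q\<close> comparable to \<open>N\<close>, the Birkhoff sum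
  is bounded (Denjoy--Koksma), \<open>q\<alpha>\<close> is nearly an integer, and the sum jumps by a prescribed merged weight \<open>w\<close>
  across a set of points of measure bounded below. Hence every invariant set of the skew product has the
  almost-everywhere period \<open>(0, w)\<close>. Modulo the group \<open>J\<close> generated by the merged weights the cocycle is a
  constant \<open>\<kappa>\<close>, so that \<open>(1, 0)\<close>, \<open>(\<alpha>, \<kappa>)\<close> and \<open>0 \<times> J\<close> are periods of every invariant set, and the periods form a
  closed group. Either this group is everything and the skew product is ergodic, or \<open>J\<close> is discrete and
  \<open>l\<kappa> \<in> J\<alpha> + J\<close> for some \<open>l > 0\<close>; then subtracting a linear coboundary makes the cocycle take values in a discrete
  group over which it is ergodic.
\<close>

section \<open>Almost periods of measurable sets\<close>

text \<open>Invariant sets are lifted to the product of \<real> and the fibre, with period 1 in the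
  first coordinate; rotation and cocycle then act by shears preserving \<open>lborel\<close>, and
  ergodicity becomes a question about translations. The weights sum to zero because a centred
  indicator of [0,a) is \<open>saw (x - a) - saw x\<close>, so the linear parts cancel. The obstacle
  is separation: \<beta> may be approximated extremely well by \<int>\<alpha> + \<int> at some
  scales, so no \<delta> need serve for every N. Not all large scales can be bad, however, and at a
  good N a Dirichlet denominator q \<le> N exceeds c N by bad approximability, so it lives on the
  same scale as the separation. The closing alternative is special to a one-dimensional fibre; in
  \<real>^2 the periods could form an intermediate group. For the translated pair the discrete case
  is therefore verified directly: the merged weights lie in \<int>^2, and s times the drift lies in
  J\<alpha> + J, either because \<beta> belongs to \<int>\<alpha> + \<int>/s or because \<beta>
  cancels from the drift.\<close>

definition almost_period :: "'b::euclidean_space set \<Rightarrow> 'b \<Rightarrow> bool" where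
  "almost_period A v \<longleftrightarrow> (AE z in lborel. z + v \<in> A \<longleftrightarrow> z \<in> A)"

lemma emeasure_lborel_vimage_plus:
  fixes A :: "'b::euclidean_space set"
  assumes "A \<in> sets borel"
  shows "emeasure lborel ((\<lambda>z. z + v) -` A) = emeasure lborel A"
proof -
  have "emeasure lborel A = emeasure (distr lborel borel ((+) v)) A"
    by (simp add: lborel_distr_plus)
  also have "\<dots> = emeasure lborel ((\<lambda>z. z + v) -` A)"
    using assms by (subst emeasure_distr) (auto simp: vimage_def add.commute)
  finally show ?thesis ..
qed

lemma AE_lborel_translate:
  fixes P :: "'b::euclidean_space \<Rightarrow> bool"
  assumes "AE z in lborel. P z"
  shows "AE z in lborel. P (z + v)"
proof -
  obtain N where N: "{z\<in>space lborel. \<not> P z} \<subseteq> N" "emeasure lborel N = 0" "N \<in> sets lborel"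
    by (rule AE_E[OF assms])
  have "{z. \<not> P (z + v)} \<subseteq> (\<lambda>z. z + v) -` N"
    using N(1) by auto
  moreover have "emeasure lborel ((\<lambda>z. z + v) -` N) = 0"
    using N emeasure_lborel_vimage_plus[of N v] by simp
  moreover have "(\<lambda>z. z + v) -` N \<in> sets lborel"
    using measurable_sets[of "\<lambda>z. z + v" borel borel N] N(3) by simp
  ultimately show ?thesis
    by (intro AE_I[of _ _ "(\<lambda>z. z + v) -` N"]) auto
qed

lemma almost_period_0 [simp]: "almost_period A 0"
  by (simp add: almost_period_def)

lemma almost_period_add:
  assumes "almost_period A v" "almost_period A w"
  shows "almost_period A (v + w)"
  using assms(2) AE_lborel_translate[OF assms(1)[unfolded almost_period_def], of w]
  unfolding almost_period_def by eventually_elim (simp add: ac_simps)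

lemma almost_period_minus:
  assumes "almost_period A v"
  shows "almost_period A (- v)"
  using AE_lborel_translate[OF assms[unfolded almost_period_def], of "- v"]
  unfolding almost_period_def by eventually_elim simp

lemma almost_period_diff:
  assumes "almost_period A v" "almost_period A w"
  shows "almost_period A (v - w)"
  using almost_period_add[OF assms(1) almost_period_minus[OF assms(2)]] by simp

lemma almost_period_of_int:
  assumes "almost_period A v"
  shows "almost_period A (of_int k *\<^sub>R v)"
proof -
  have nat: "almost_period A (of_nat n *\<^sub>R v)" for n :: nat
    by (induction n) (auto simp: scaleR_add_left intro: almost_period_add assms)
  show ?thesis
    using nat[of "nat k"] almost_period_minus[OF nat[of "nat (- k)"]] by (cases "k \<ge> 0") auto
qed

text \<open>A is squeezed between a closed C and an open U that differ by a set X of measure below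
  e/2. A short translation cannot carry the bounded part of C out of U, so membership in A can
  change only if one of the two points lies in X. Covering by a Borel set spares any measurability
  discussion of Q.\<close>

lemma translation_continuous_in_measure:
  fixes A Q :: "'b::euclidean_space set"
  assumes A: "A \<in> sets borel" and Q: "bounded Q" and "0 < e"
  shows "\<exists>d>0. \<forall>v. norm v < d \<longrightarrow>
    (\<exists>X\<in>sets borel. {z\<in>Q. (z + v \<in> A) \<noteq> (z \<in> A)} \<subseteq> X \<and> emeasure lborel X < ennreal e)"
proof -
  have AL: "A \<in> sets lebesgue"
    using A by simp
  have e4: "0 < e/4"
    using \<open>0 < e\<close> by simp
  obtain U where U: "open U" "A \<subseteq> U" "U - A \<in> lmeasurable" "emeasure lebesgue (U - A) < ennreal (e/4)"
    by (rule sets_lebesgue_outer_open[OF AL e4])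
  obtain C where C: "closed C" "C \<subseteq> A" "A - C \<in> lmeasurable" "emeasure lebesgue (A - C) < ennreal (e/4)"
    by (rule sets_lebesgue_inner_closed[OF AL e4])
  define X where "X = U - C"
  have [measurable]: "U \<in> sets borel" "C \<in> sets borel" "A \<in> sets borel" "X \<in> sets borel"
    using U C A by (auto simp: X_def)
  have "emeasure lborel X = emeasure lborel ((U - A) \<union> (A - C))"
    using U C by (intro arg_cong[where f="emeasure lborel"]) (auto simp: X_def)
  also have "\<dots> \<le> emeasure lborel (U - A) + emeasure lborel (A - C)"
    by (rule emeasure_subadditive) auto
  also have "\<dots> < ennreal (e/4) + ennreal (e/4)"
    using U(4) C(4) by (intro add_strict_mono) auto
  also have "\<dots> = ennreal (e/2)"
    using \<open>0 < e\<close> by (simp flip: ennreal_plus)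
  finally have X: "emeasure lborel X < ennreal (e/2)" .
  obtain r where r: "\<And>z. z \<in> Q \<Longrightarrow> norm z \<le> r"
    using Q by (auto simp: bounded_iff)
  have "compact (C \<inter> cball 0 (r + 1))"
    using C by (intro closed_Int_compact) auto
  moreover have "closed (- U)" "C \<inter> cball 0 (r + 1) \<inter> - U = {}"
    using U C by auto
  ultimately obtain d where d: "d > 0" "\<And>x y. x \<in> C \<inter> cball 0 (r + 1) \<Longrightarrow> y \<in> - U \<Longrightarrow> d \<le> dist x y"
    using separate_compact_closed by metis
  show ?thesis
  proof (intro exI[of _ "min d 1"] conjI allI impI)
    fix v :: 'b assume v: "norm v < min d 1"
    let ?Y = "X \<union> (\<lambda>z. z + v) -` X"
    have vX: "(\<lambda>z. z + v) -` X \<in> sets borel"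
      using measurable_sets[of "\<lambda>z. z + v" borel borel X] by simp
    have "{z\<in>Q. (z + v \<in> A) \<noteq> (z \<in> A)} \<subseteq> ?Y"
    proof (rule subsetI, rule ccontr)
      fix z assume "z \<in> {z\<in>Q. (z + v \<in> A) \<noteq> (z \<in> A)}" "z \<notin> ?Y"
      then have z: "z \<in> Q" "(z + v \<in> A) \<noteq> (z \<in> A)" "z + v \<notin> X" "z \<notin> X"
        by auto
      have nz: "norm z \<le> r" using r z(1) by auto
      have nzv: "norm (z + v) \<le> r + 1"
        using norm_triangle_ineq[of z v] nz v by linarith
      have 1: "z + v \<in> U" if "z \<in> C"
        using d(2)[of z "z + v"] that nz v by (force simp: dist_norm)
      have 2: "z \<in> U" if "z + v \<in> C"
      proof (rule ccontr)
        assume "z \<notin> U"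
        moreover have "z + v \<in> C \<inter> cball 0 (r + 1)"
          using that nzv by (simp only: mem_cball_0 Int_iff simp_thms)
        ultimately have "d \<le> dist (z + v) z"
          using d(2) by blast
        then show False
          using v by (simp add: dist_norm)
      qed
      show False
        using z 1 2 U(2) C(2) unfolding X_def by auto
    qed
    moreover have "emeasure lborel ?Y \<le> emeasure lborel X + emeasure lborel ((\<lambda>z. z + v) -` X)"
      using vX by (intro emeasure_subadditive) auto
    moreover have "\<dots> < ennreal (e/2) + ennreal (e/2)"
      using X by (intro add_strict_mono) (auto simp: emeasure_lborel_vimage_plus)
    moreover have "\<dots> = ennreal e"
      using \<open>0 < e\<close> by (simp flip: ennreal_plus)
    ultimately show "\<exists>X\<in>sets borel. {z\<in>Q. (z + v \<in> A) \<noteq> (z \<in> A)} \<subseteq> X \<and> emeasure lborel X < ennreal e"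
      using vX by (intro bexI[of _ ?Y]) (auto intro: le_less_trans)
  qed (use d in auto)
qed

text \<open>If the failures of v had positive measure e inside some ball, choose a period w close to
  v. Translating by w changes nothing almost everywhere, and the remaining translation by v - w
  changes membership only on a set of measure below that same e.\<close>

lemma almost_period_limit:
  fixes A :: "'b::euclidean_space set"
  assumes A: "A \<in> sets borel" and lim: "\<And>e. 0 < e \<Longrightarrow> \<exists>w. norm (w - v) < e \<and> almost_period A w"
  shows "almost_period A v"
proof -
  define B where "B = {z. (z + v \<in> A) \<noteq> (z \<in> A)}"
  have [measurable]: "A \<in> sets borel" by fact
  have B[measurable]: "B \<in> sets borel"
    unfolding B_def by measurable
  have null: "emeasure lborel (B \<inter> ball 0 (real n)) = 0" for n
  proof (rule ccontr)
    let ?E = "emeasure lborel (B \<inter> ball 0 (real n))"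
    assume "?E \<noteq> 0"
    moreover have "?E < \<infinity>"
      by (rule le_less_trans[OF emeasure_mono emeasure_lborel_ball_finite[of 0 "real n"]]) auto
    ultimately obtain e where e: "?E = ennreal e" "e > 0"
      by (cases "?E") (auto simp: ennreal_eq_0_iff)
    obtain d where d: "d > 0"
      "\<And>u. norm u < d \<Longrightarrow> \<exists>X\<in>sets borel. {z\<in>ball 0 (real n + norm v + 1). (z + u \<in> A) \<noteq> (z \<in> A)} \<subseteq> X
           \<and> emeasure lborel X < ennreal e"
      using translation_continuous_in_measure[OF A bounded_ball e(2)] by blast
    obtain w where w: "norm (w - v) < min d 1" "almost_period A w"
      using lim[of "min d 1"] d by auto
    have "norm (v - w) < d"
      using w by (simp add: norm_minus_commute)
    then obtain X where X: "X \<in> sets borel" "emeasure lborel X < ennreal e"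
      "{z\<in>ball 0 (real n + norm v + 1). (z + (v - w) \<in> A) \<noteq> (z \<in> A)} \<subseteq> X"
      using d(2) by blast
    have vX: "(\<lambda>z. z + w) -` X \<in> sets borel"
      using measurable_sets[of "\<lambda>z. z + w" borel borel X] X by simp
    have "AE z in lborel. z \<in> B \<inter> ball 0 (real n) \<longrightarrow> z \<in> (\<lambda>z. z + w) -` X"
      using w(2)[unfolded almost_period_def]
    proof eventually_elim
      case (elim z)
      show ?case
      proof
        assume z: "z \<in> B \<inter> ball 0 (real n)"
        have "norm (z + w) \<le> norm z + norm v + norm (w - v)"
          using norm_triangle_ineq[of z w] norm_triangle_ineq[of v "w - v"] by simp
        then have "z + w \<in> ball 0 (real n + norm v + 1)"
          using z w(1) by auto
        moreover have "(z + w + (v - w) \<in> A) \<noteq> (z + w \<in> A)"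
          using z elim by (simp add: B_def)
        ultimately show "z \<in> (\<lambda>z. z + w) -` X"
          using X(3) by blast
      qed
    qed
    then have "?E \<le> emeasure lborel ((\<lambda>z. z + w) -` X)"
      using vX by (intro emeasure_mono_AE) auto
    then show False
      using X e by (simp add: emeasure_lborel_vimage_plus)
  qed
  have "AE z in lborel. \<forall>n. z \<notin> B \<inter> ball 0 (real n)"
    unfolding AE_all_countable using null by (intro allI AE_not_in) (simp add: null_sets_def)
  then show ?thesis
    unfolding almost_period_def
  proof eventually_elim
    case (elim z)
    obtain n where "norm z < real n"
      using reals_Archimedean2 by blast
    then show ?case
      using elim by (auto simp: B_def)
  qed
qed

text \<open>The integer multiples of a small s leave gaps of length |s| on the line, so every t is a
  limit of periods.\<close>

lemma almost_period_scaleR: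
  fixes A :: "'b::euclidean_space set"
  assumes A: "A \<in> sets borel"
    and small: "\<And>e. 0 < e \<Longrightarrow> \<exists>s. 0 < \<bar>s\<bar> \<and> \<bar>s\<bar> < e \<and> almost_period A (s *\<^sub>R u)"
  shows "almost_period A (t *\<^sub>R u)"
proof (rule almost_period_limit[OF A])
  fix e :: real assume "0 < e"
  define e' where "e' = e / (norm u + 1)"
  have "e' > 0"
    using \<open>0 < e\<close> by (auto simp: e'_def intro!: divide_pos_pos add_nonneg_pos)
  then obtain s where s: "0 < \<bar>s\<bar>" "\<bar>s\<bar> < e'" "almost_period A (s *\<^sub>R u)"
    using small by blast
  define k where "k = \<lfloor>t / s\<rfloor>"
  have "\<bar>of_int k - t / s\<bar> \<le> 1"
    unfolding k_def by linarith
  then have "\<bar>of_int k * s - t\<bar> \<le> \<bar>s\<bar>"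
    using s(1) mult_right_mono[of "\<bar>of_int k - t / s\<bar>" 1 "\<bar>s\<bar>"]
    by (simp add: abs_mult[symmetric] algebra_simps)
  then have "norm ((of_int k * s) *\<^sub>R u - t *\<^sub>R u) \<le> \<bar>s\<bar> * norm u"
    by (simp add: mult_right_mono flip: scaleR_diff_left)
  also have "\<dots> \<le> e' * norm u"
    using s by (intro mult_right_mono) auto
  also have "\<dots> < e' * (norm u + 1)"
    using \<open>e' > 0\<close> by (simp add: algebra_simps)
  also have "\<dots> = e"
    by (simp add: e'_def add_nonneg_eq_0_iff)
  finally have "norm ((of_int k * s) *\<^sub>R u - t *\<^sub>R u) < e" .
  moreover have "almost_period A ((of_int k * s) *\<^sub>R u)"
    using almost_period_of_int[OF s(3), of k] by simp
  ultimately show "\<exists>w. norm (w - t *\<^sub>R u) < e \<and> almost_period A w"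
    by blast
qed

text \<open>Each v has its own exceptional set of z. Fubini exchanges the quantifiers and yields a
  single z whose translates by almost all v agree with it about membership in A.\<close>

lemma all_almost_periods_imp_trivial:
  fixes A :: "'b::euclidean_space set"
  assumes A[measurable]: "A \<in> sets borel" and per: "\<And>v. almost_period A v"
  shows "emeasure lborel A = 0 \<or> emeasure lborel (- A) = 0"
proof -
  define Q :: "('b \<times> 'b) set" where "Q = {p. (snd p + fst p \<in> A) = (snd p \<in> A)}"
  have Q: "Q \<in> sets (borel \<Otimes>\<^sub>M borel)"
  proof -
    have "{p \<in> space (borel \<Otimes>\<^sub>M borel). (snd p + fst p \<in> A) = (snd p \<in> A)} \<in> sets (borel \<Otimes>\<^sub>M borel)"
      by measurable
    then show ?thesis
      by (simp add: Q_def space_pair_measure)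
  qed
  have "AE v in lborel. AE z in lborel. (v, z) \<in> Q"
    using per unfolding almost_period_def Q_def by simp
  moreover have "{p \<in> space (lborel \<Otimes>\<^sub>M lborel). (case p of (v, z) \<Rightarrow> (v, z) \<in> Q)} \<in> sets (lborel \<Otimes>\<^sub>M lborel)"
    using Q by (simp add: space_pair_measure cong: sets_pair_measure_cong)
  ultimately have "AE z in lborel. AE v in lborel. (v, z) \<in> Q"
    using lborel_pair.AE_commute[of "\<lambda>v z. (v, z) \<in> Q"] by (simp add: case_prod_unfold)
  then obtain z where z: "AE v in lborel. (v, z) \<in> Q"
    using eventually_happens'[of "ae_filter (lborel :: 'b measure)"]
    by (auto simp: ae_filter_eq_bot_iff emeasure_lborel_UNIV)
  have 1: "AE v in lborel. (v \<in> A) = (z \<in> A)"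
    using AE_lborel_translate[OF z, of "- z"] by eventually_elim (simp add: Q_def)
  show ?thesis
  proof (cases "z \<in> A")
    case True
    then have "AE v in lborel. v \<notin> - A" using 1 by simp
    then show ?thesis using AE_iff_null_sets[of "- A" lborel] by (auto simp: null_sets_def)
  next
    case False
    then have "AE v in lborel. v \<notin> A" using 1 by simp
    then show ?thesis using AE_iff_null_sets[of A lborel] by (auto simp: null_sets_def)
  qed
qed

section \<open>Badly approximable numbers\<close>

text \<open>Bounded partial quotients keep every Gauss iterate above c = 1/(K + 1). The estimate is
  a Euclidean descent on an arbitrary pair (p, q); the parameter s transforms like a ratio of
  consecutive convergent denominators, which replaces the theory of convergents. The application has
  n = 0 and s = 0, and the half pays for the factor 1 + s g \<le> 2 where the descent stops.\<close>

lemma bounded_type_imp_badly_approximable: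
  fixes \<alpha> :: real
  assumes "0 < \<alpha>" "\<alpha> < 1" and bt: "bounded_type \<alpha>"
  obtains c :: real where "0 < c" "\<And>q p :: int. q > 0 \<Longrightarrow> c / of_int q \<le> \<bar>of_int q * \<alpha> - of_int p\<bar>"
proof -
  obtain K :: int where irr: "\<alpha> \<notin> \<rat>" and K: "\<And>n. n \<ge> 1 \<Longrightarrow> partial_quotient \<alpha> n \<le> K"
    using bt by (auto simp: bounded_type_def)
  let ?g = "gauss_orbit \<alpha>"
  have g: "?g n \<notin> \<rat> \<and> 0 < ?g n \<and> ?g n < 1" for n
  proof (induction n)
    case 0
    then show ?case
      using assms irr by (simp add: frac_eq)
  next
    case (Suc n)
    have "1 / ?g n \<notin> \<rat>"
    proof
      assume "1 / ?g n \<in> \<rat>"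
      then have "inverse (1 / ?g n) \<in> \<rat>" by (rule Rats_inverse)
      then show False using Suc by simp
    qed
    then have "frac (1 / ?g n) \<notin> \<rat>"
      unfolding frac_def using Rats_add[of "1 / ?g n - of_int \<lfloor>1 / ?g n\<rfloor>" "of_int \<lfloor>1 / ?g n\<rfloor>"] by auto
    moreover from this have "frac (1 / ?g n) \<noteq> 0" by (metis Rats_0)
    ultimately show ?case
      using frac_ge_0[of "1 / ?g n"] frac_lt_1[of "1 / ?g n"] by (auto simp: less_le)
  qed
  define a where "a n = \<lfloor>1 / ?g n\<rfloor>" for n
  have a: "1 \<le> a n" "a n \<le> K" for n
  proof -
    have "1 \<le> 1 / ?g n" using g[of n] by (simp add: field_simps)
    then show "1 \<le> a n" unfolding a_def by linarith
    show "a n \<le> K" using K[of "Suc n"] by (simp add: a_def)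
  qed
  have g_inv: "?g n * (a n + ?g (Suc n)) = 1" for n
    using g[of n] by (simp add: a_def frac_def)
  have K1: "1 \<le> K" using a[of 0] by linarith
  define c :: real where "c = 1 / (K + 1)"
  have c: "0 < c" using K1 by (simp add: c_def)
  have g_low: "c < ?g n" for n
  proof -
    have "1 < ?g n * (K + 1)"
      using g_inv[of n] g[of n] g[of "Suc n"] a(2)[of n] mult_strict_left_mono[of "a n + ?g (Suc n)" "K + 1" "?g n"]
      by linarith
    then show ?thesis using K1 by (simp add: c_def field_simps)
  qed
  (* The quantity |q g - p| (q + s p) / (1 + s g) is invariant under (p, q, g, s) -> (q - p a, p, 1/g - a, 1/(a + s)),
     one step of the Euclidean algorithm on (p, q). *)
  have main: "c / 2 * (1 + s * ?g n) \<le> \<bar>q * ?g n - p\<bar> * (q + s * p)"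
    if "0 \<le> s" "s \<le> 1" "0 \<le> p" "0 < q" for n :: nat and s :: real and p q :: int
    using that
  proof (induction "nat (p + q)" arbitrary: p q s n rule: less_induct)
    case less
    have sg: "1 + s * ?g n \<le> 2"
      using less.prems g[of n] mult_mono[of s 1 "?g n" 1] by simp
    have q1: "1 \<le> real_of_int q" using less.prems by simp
    have "c / 2 * (1 + s * ?g n) \<le> c / 2 * 2"
      using sg c by (intro mult_left_mono) auto
    then have upper: "c / 2 * (1 + s * ?g n) \<le> c" by simp
    have qsp: "1 \<le> q + s * p"
      using less.prems q1 by (simp add: add_increasing2)
    \<comment> \<open>The descent stops in the first two cases: for p = 0 the left factor is q g,
      and for q < p a the inequality a g \<le> 1 gives p - q g \<ge> g. In the third case q - p a is
      nonnegative and the next Euclidean step is possible.\<close>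
    consider "p = 0" | "1 \<le> p" "q < p * a n" | "1 \<le> p" "p * a n \<le> q"
      using less.prems by linarith
    then show ?case
    proof cases
      case 1
      have "?g n * 1 \<le> ?g n * (q * q)"
        using q1 g[of n] mult_mono[of 1 "real_of_int q" 1 "real_of_int q"] by (intro mult_left_mono) auto
      moreover have "\<bar>q * ?g n\<bar> = q * ?g n" using q1 g[of n] by simp
      ultimately show ?thesis using 1 upper g_low[of n] by (simp add: mult_ac)
    next
      case 2
      have "?g n * a n \<le> ?g n * (a n + ?g (Suc n))"
        using g[of n] g[of "Suc n"] by (intro mult_left_mono) auto
      then have "?g n * a n \<le> 1"
        by (simp only: g_inv)
      then have "p * (?g n * a n) \<le> real_of_int p * 1"
        using less.prems by (intro mult_left_mono) auto
      moreover have "q * ?g n \<le> (p * a n - 1) * ?g n"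
        using 2 g[of n] by (intro mult_right_mono) (auto simp flip: of_int_mult)
      ultimately have "?g n \<le> p - q * ?g n" by (simp add: algebra_simps)
      then have "c * 1 \<le> \<bar>q * ?g n - p\<bar> * (q + s * p)"
        using qsp g_low[of n] c by (intro mult_mono) auto
      then show ?thesis using upper by simp
    next
      case 3
      define s' where "s' = 1 / (a n + s)"
      have as: "1 \<le> a n + s" using a[of n] less.prems by (smt (verit) of_int_1_le_iff)
      have s': "0 \<le> s'" "s' \<le> 1" using as by (auto simp: s'_def)
      have "1 \<le> p * a n" using 3 a[of n] by (smt (verit) mult_le_cancel_left1)
      then have "nat (q - p * a n + p) < nat (p + q)" using 3 by linarith
      from less.hyps[OF this s', of "Suc n"] 3
      have IH: "c / 2 * (1 + s' * ?g (Suc n)) \<le> \<bar>p * ?g (Suc n) - (q - p * a n)\<bar> * (p + s' * (q - p * a n))"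
        by simp
      have e1: "?g n * (a n + s) * (1 + s' * ?g (Suc n)) = 1 + s * ?g n"
      proof -
        have "(a n + s) * (1 + s' * ?g (Suc n)) = a n + s + ?g (Suc n)"
          using as by (simp add: s'_def field_simps)
        then have "?g n * (a n + s) * (1 + s' * ?g (Suc n)) = ?g n * (a n + ?g (Suc n)) + s * ?g n"
          by (simp only: mult.assoc) (simp only: algebra_simps)
        then show ?thesis by (simp only: g_inv)
      qed
      have e2: "(a n + s) * (p + s' * (q - p * a n)) = q + s * p"
        using as by (simp add: s'_def field_simps)
      have e3: "?g n * \<bar>p * ?g (Suc n) - (q - p * a n)\<bar> = \<bar>q * ?g n - p\<bar>"
      proof -
        have "?g n * (p * ?g (Suc n) - (q - p * a n)) = p * (?g n * (a n + ?g (Suc n))) - q * ?g n"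
          by (simp add: algebra_simps)
        then have "?g n * (p * ?g (Suc n) - (q - p * a n)) = p - q * ?g n" using g_inv[of n] by simp
        then show ?thesis using g[of n] by (metis abs_minus_commute abs_mult abs_of_pos)
      qed
      have "?g n * (a n + s) * (c / 2 * (1 + s' * ?g (Suc n)))
          \<le> ?g n * (a n + s) * (\<bar>p * ?g (Suc n) - (q - p * a n)\<bar> * (p + s' * (q - p * a n)))"
        using IH as g[of n] by (intro mult_left_mono) auto
      also have "\<dots> = (?g n * \<bar>p * ?g (Suc n) - (q - p * a n)\<bar>) * ((a n + s) * (p + s' * (q - p * a n)))"
        by (simp only: mult_ac)
      also have "\<dots> = \<bar>q * ?g n - p\<bar> * (q + s * p)" by (simp only: e2 e3)
      also have "?g n * (a n + s) * (c / 2 * (1 + s' * ?g (Suc n))) = c / 2 * (?g n * (a n + s) * (1 + s' * ?g (Suc n)))"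
        by (simp only: mult_ac)
      finally show ?thesis by (simp only: e1)
    qed
  qed
  show thesis
  proof (rule that[of "c / 2"])
    fix q p :: int assume q: "0 < q"
    have g0: "?g 0 = \<alpha>" using assms by (simp add: frac_eq)
    show "c / 2 / of_int q \<le> \<bar>of_int q * \<alpha> - of_int p\<bar>"
    proof (cases "0 \<le> p")
      case True
      then show ?thesis using main[of 0 p q 0] q g0 by (simp add: field_simps)
    next
      case False
      have "c / 2 / q \<le> c / 1" using c q by (intro frac_le) auto
      also have "\<dots> \<le> \<alpha>" using g_low[of 0] g0 by simp
      also have "\<dots> \<le> q * \<alpha>" using q assms by simp
      also have "\<dots> \<le> q * \<alpha> - p" using False by simp
      finally show ?thesis by simp
    qed
  qed (use c in simp)
qed

text \<open>The Denjoy--Koksma inequality for the sawtooth, by comparing the orbit with the points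
  j/q. Each term is off by at most 2/q above and 1/q below, except that wrapping around an integer
  costs 1 more, upwards only for j = 0 and downwards only for j = q - 1. Summing gives 5/2, rounded
  up to 4.\<close>

lemma sum_frac_bounded:
  fixes \<alpha> x :: real and p :: int and q :: nat
  assumes q: "0 < q" and cop: "coprime p (int q)" and app: "\<bar>q * \<alpha> - p\<bar> \<le> 1 / q"
  shows "\<bar>\<Sum>k<q. frac (x + k * \<alpha>) - 1 / 2\<bar> \<le> 4"
proof -
  \<comment> \<open>q (x + k \<alpha>) lies in the interval [m k - 1, m k + 2), and coprimality
    makes the residues \<open>j k\<close> run once through 0, ..., q - 1.\<close>
  define m where "m k = int k * p + \<lfloor>q * x\<rfloor>" for k :: nat
  define j where "j k = nat (m k mod int q)" for k
  have bij: "bij_betw j {..<q} {..<q}"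
  proof -
    have "inj_on j {..<q}"
    proof (rule inj_onI)
      fix k l assume kl: "k \<in> {..<q}" "l \<in> {..<q}" "j k = j l"
      then have "m k mod int q = m l mod int q"
        using q by (simp add: j_def eq_nat_nat_iff)
      then have "int q dvd m k - m l"
        by (simp add: mod_eq_dvd_iff)
      then have "int q dvd (int k - int l) * p"
        by (simp add: m_def algebra_simps)
      then have "int q dvd int k - int l"
        using cop by (simp add: coprime_dvd_mult_left_iff coprime_commute)
      moreover have "\<bar>int k - int l\<bar> < int q"
        using kl by auto
      ultimately show "k = l"
        using zdvd_not_zless[of "\<bar>int k - int l\<bar>" "int q"] by (cases "int k = int l") auto
    qed
    moreover have "j ` {..<q} \<subseteq> {..<q}"
      using q by (auto simp: j_def nat_less_iff)
    ultimately show ?thesis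
      by (simp add: bij_betw_def endo_inj_surj)
  qed
  have bounds: "frac (x + k * \<alpha>) \<le> (j k + 2) / q + of_bool (j k = 0)"
    "(real (j k) - 1) / q - of_bool (j k = q - 1) \<le> frac (x + k * \<alpha>)" if k: "k < q" for k
  proof -
    define y where "y = x + k * \<alpha> - of_int (m k div int q)"
    have fy: "frac (x + k * \<alpha>) = frac y"
      by (simp add: y_def frac_def)
    have "m k = int q * (m k div int q) + int (j k)"
      using q by (simp add: j_def)
    then have mk: "real_of_int (m k) = q * real_of_int (m k div int q) + j k"
      by (metis of_int_add of_int_mult of_int_of_nat_eq)
    have "q * (x + k * \<alpha>) = q * x + k * p + k * (q * \<alpha> - p)"
      by (simp add: algebra_simps)
    moreover have "\<bar>k * (q * \<alpha> - p)\<bar> \<le> 1"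
    proof -
      have "\<bar>k * (q * \<alpha> - p)\<bar> \<le> q * (1 / q)"
        using app k unfolding abs_mult by (intro mult_mono) auto
      then show ?thesis using q by simp
    qed
    moreover have "real_of_int (m k) = k * p + \<lfloor>q * x\<rfloor>"
      by (simp add: m_def)
    ultimately have "m k - 1 \<le> q * (x + k * \<alpha>)" "q * (x + k * \<alpha>) < m k + 2"
      by linarith+
    then have qy: "real (j k) - 1 \<le> q * y" "q * y < j k + 2"
      using mk by (simp_all add: y_def right_diff_distrib)
    have y: "(real (j k) - 1) / q \<le> y" "y < (j k + 2) / q"
      using qy q by (auto simp: field_simps)
    have jq: "j k < q" using bij k by (auto simp: bij_betw_def)
    show "frac (x + k * \<alpha>) \<le> (j k + 2) / q + of_bool (j k = 0)"
    proof (cases "0 \<le> y")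
      case True
      then have "frac y \<le> y" by (simp add: frac_def)
      moreover have "0 \<le> (of_bool (j k = 0) :: real)" by simp
      ultimately show ?thesis using y fy by linarith
    next
      case False
      then have "q * y < 0" using q by (simp add: mult_pos_neg)
      then have "j k = 0" using qy by linarith
      then show ?thesis using frac_lt_1[of y] fy by (simp add: add_increasing less_imp_le)
    qed
    show "(real (j k) - 1) / q - of_bool (j k = q - 1) \<le> frac (x + k * \<alpha>)"
    proof (cases "y < 1")
      case True
      then have "\<lfloor>y\<rfloor> \<le> 0" by linarith
      then have "y \<le> frac y" by (simp add: frac_def)
      moreover have "0 \<le> (of_bool (j k = q - 1) :: real)" by simp
      ultimately show ?thesis using y fy by linarith
    next
      case False
      then have "real q * 1 \<le> q * y" by (intro mult_left_mono) auto
      then have "q < j k + 2" using qy by simp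
      then have "of_bool (j k = q - 1) = (1::real)" using jq by simp
      moreover have "(real (j k) - 1) / q \<le> 1" using jq by (simp add: field_simps)
      ultimately show ?thesis using frac_ge_0[of y] fy by linarith
    qed
  qed
  have sum_id: "(\<Sum>i<q. real i) = q * (real q - 1) / 2"
    by (induction q) (auto simp: field_simps)
  have "(\<Sum>k<q. frac (x + k * \<alpha>)) \<le> (\<Sum>k<q. (j k + 2) / q + of_bool (j k = 0))"
    using bounds by (intro sum_mono) auto
  also have "\<dots> = (\<Sum>i<q. (i + 2) / q + of_bool (i = 0))"
    by (rule sum.reindex_bij_betw[OF bij])
  also have "\<dots> = ((\<Sum>i<q. real i) + 2 * q) / q + (\<Sum>i<q. of_bool (i = 0))"
    by (simp add: sum.distrib sum_divide_distrib add_divide_distrib)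
  also have "(\<Sum>i<q. of_bool (i = 0)) = (1::real)"
    using q by (simp add: of_bool_def)
  finally have up: "(\<Sum>k<q. frac (x + k * \<alpha>)) \<le> (real q - 1) / 2 + 3"
    unfolding sum_id using q by (simp add: add_divide_distrib)
  have "(\<Sum>k<q. frac (x + k * \<alpha>)) \<ge> (\<Sum>k<q. (real (j k) - 1) / q - of_bool (j k = q - 1))"
    using bounds by (intro sum_mono) auto
  also have "(\<Sum>k<q. (real (j k) - 1) / q - of_bool (j k = q - 1)) = (\<Sum>i<q. (real i - 1) / q - of_bool (i = q - 1))"
    by (rule sum.reindex_bij_betw[OF bij])
  also have "\<dots> = ((\<Sum>i<q. real i) - q) / q - (\<Sum>i<q. of_bool (i = q - 1))"
    by (simp add: sum_subtractf diff_divide_distrib flip: sum_divide_distrib)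
  also have "(\<Sum>i<q. of_bool (i = q - 1)) = (1::real)"
    using q by (simp add: of_bool_def)
  finally have lo: "(\<Sum>k<q. frac (x + k * \<alpha>)) \<ge> (real q - 1) / 2 - 2"
    unfolding sum_id using q by (simp add: diff_divide_distrib)
  have "(\<Sum>k<q. frac (x + k * \<alpha>) - 1 / 2) = (\<Sum>k<q. frac (x + k * \<alpha>)) - q / 2"
    by (simp add: sum_subtractf)
  then show ?thesis
    using up lo by (simp add: abs_le_iff diff_divide_distrib)
qed

section \<open>Separation of discontinuities\<close>

definition saw :: "real \<Rightarrow> real" where
  "saw x = frac x - 1 / 2"

definition birkhoff_sum :: "real \<Rightarrow> (real \<Rightarrow> 'a::real_vector) \<Rightarrow> nat \<Rightarrow> real \<Rightarrow> 'a" where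
  "birkhoff_sum \<alpha> \<Phi> q x = (\<Sum>k<q. \<Phi> (x + real k * \<alpha>))"

definition orbit_group :: "real \<Rightarrow> real set" where
  "orbit_group \<alpha> = {of_int k * \<alpha> + of_int p | k p. True}"

section \<open>Distances from finite pieces of the orbit group\<close>

lemma uniform_positive_constant:
  fixes P :: "'d \<Rightarrow> real \<Rightarrow> bool"
  assumes "finite D" "\<And>d. d \<in> D \<Longrightarrow> \<exists>\<delta>>0. P d \<delta>"
    and mono: "\<And>d \<delta> \<delta>'. P d \<delta> \<Longrightarrow> \<delta>' \<le> \<delta> \<Longrightarrow> P d \<delta>'"
  shows "\<exists>\<delta>>0. \<forall>d\<in>D. P d \<delta>"
  using assms(1,2)
proof (induction D)
  case empty
  show ?case by (auto intro: exI[of _ 1])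
next
  case (insert d D)
  obtain \<delta>1 \<delta>2 where "\<delta>1 > 0" "P d \<delta>1" "\<delta>2 > 0" "\<forall>d\<in>D. P d \<delta>2"
    using insert by (metis insertCI)
  then show ?case
    by (intro exI[of _ "min \<delta>1 \<delta>2"]) (auto intro: mono)
qed

text \<open>The range |k| \<le> N covers all differences of two times below a denominator q \<le> N.
  At N = 0 the quotient is 0 and the condition is void, so the uses take N at least 1.\<close>

definition separated :: "real \<Rightarrow> real \<Rightarrow> nat \<Rightarrow> real \<Rightarrow> bool" where
  "separated \<alpha> \<delta> N d \<longleftrightarrow> (\<forall>(k::int) (p::int). \<bar>k\<bar> \<le> int N \<longrightarrow> \<delta> / N \<le> \<bar>d - real_of_int k * \<alpha> - real_of_int p\<bar>)"

lemma separated_mono: "separated \<alpha> \<delta> N d \<Longrightarrow> \<delta>' \<le> \<delta> \<Longrightarrow> separated \<alpha> \<delta>' N d"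
  unfolding separated_def by (meson divide_right_mono of_nat_0_le_iff order_trans)

text \<open>This is all the arithmetic of \<alpha> on which the rest relies; in particular it
  contains irrationality.\<close>

locale badly_approximable =
  fixes \<alpha> c :: real
  assumes c_pos: "0 < c"
    and approx: "\<And>(q::int) (p::int). q > 0 \<Longrightarrow> c / q \<le> \<bar>q * \<alpha> - p\<bar>"
begin

lemma approx_nonzero:
  fixes q p :: int
  assumes "q \<noteq> 0"
  shows "c / \<bar>q\<bar> \<le> \<bar>q * \<alpha> - p\<bar>"
proof (cases "q > 0")
  case True
  then show ?thesis using approx[of q p] by simp
next
  case False
  then have "c / real_of_int (- q) \<le> \<bar>real_of_int (- q) * \<alpha> - real_of_int (- p)\<bar>"
    using assms by (intro approx) auto
  moreover have "\<bar>real_of_int (- q) * \<alpha> - real_of_int (- p)\<bar> = \<bar>q * \<alpha> - p\<bar>" by simp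
  ultimately show ?thesis using False by simp
qed

lemma approx_le:
  fixes q p :: int
  assumes "q \<noteq> 0" "real_of_int \<bar>q\<bar> \<le> B"
  shows "c / B \<le> \<bar>q * \<alpha> - p\<bar>"
proof -
  have "c / B \<le> c / \<bar>q\<bar>"
    using assms c_pos by (intro divide_left_mono mult_pos_pos) auto
  then show ?thesis using approx_nonzero[OF assms(1), of p] by simp
qed

text \<open>Multiplication by M turns d - k \<alpha> - p into (u - M k) \<alpha> - (M p - v). If the
  coefficient of \<alpha> vanishes, a nonzero integer remains, because d is outside the orbit group;
  otherwise bad approximability applies with a denominator of at most (|u| + M) N. The two cases
  give the two terms of \<delta>.\<close>

lemma separated_rational:
  fixes M u v :: int
  assumes M: "M > 0" and d: "d = (u * \<alpha> + v) / M" and nin: "d \<notin> orbit_group \<alpha>"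
  shows "\<exists>\<delta>>0. \<forall>N\<ge>1. separated \<alpha> \<delta> N d"
proof -
  define \<delta> where "\<delta> = min (1 / M) (c / (M * (\<bar>u\<bar> + M)))"
  have \<delta>: "0 < \<delta>" using M c_pos by (auto simp: \<delta>_def intro!: divide_pos_pos mult_pos_pos add_nonneg_pos)
  have "\<delta> / N \<le> \<bar>d - k * \<alpha> - p\<bar>" if N: "N \<ge> 1" and k: "\<bar>k\<bar> \<le> int N" for N :: nat and k p :: int
  proof -
    have eq: "M * (d - k * \<alpha> - p) = (u - M * k) * \<alpha> - (M * p - v)"
      using M by (simp add: d field_simps)
    have N1: "1 \<le> real N" using N by simp
    show ?thesis
    proof (cases "u - M * k = 0")
      case True
      have "M * p - v \<noteq> 0"
      proof
        assume "M * p - v = 0"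
        then have "real_of_int M * (d - k * \<alpha> - p) = 0" using True eq by simp
        then have "d = k * \<alpha> + p" using M by simp
        then show False using nin by (auto simp: orbit_group_def)
      qed
      then have "1 \<le> \<bar>real_of_int (M * p - v)\<bar>" by linarith
      also have "\<dots> = \<bar>M * (d - k * \<alpha> - p)\<bar>" using True unfolding eq by simp
      also have "\<dots> = M * \<bar>d - k * \<alpha> - p\<bar>" using M by (simp add: abs_mult)
      finally have "1 / M \<le> \<bar>d - k * \<alpha> - p\<bar>" using M by (simp add: field_simps)
      moreover have "\<delta> / N \<le> \<delta> / 1" using N1 \<delta> by (intro divide_left_mono) auto
      ultimately show ?thesis by (simp add: \<delta>_def)
    next
      case False
      have "\<bar>u - M * k\<bar> \<le> \<bar>u\<bar> + M * \<bar>k\<bar>" using M abs_triangle_ineq4[of u "M * k"] by (simp add: abs_mult)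
      also have "\<dots> \<le> \<bar>u\<bar> * int N + M * int N"
        using M k N by (intro add_mono mult_left_mono) (auto simp: mult_le_cancel_left1)
      finally have "\<bar>u - M * k\<bar> \<le> (\<bar>u\<bar> + M) * int N" by (simp add: distrib_right)
      then have "real_of_int \<bar>u - M * k\<bar> \<le> real_of_int ((\<bar>u\<bar> + M) * int N)"
        by (simp only: of_int_le_iff)
      then have "c / ((\<bar>u\<bar> + M) * int N) \<le> \<bar>(u - M * k) * \<alpha> - (M * p - v)\<bar>"
        using approx_le[OF False, of _ "M * p - v"] by (simp only: of_int_diff)
      also have "\<dots> = \<bar>M * (d - k * \<alpha> - p)\<bar>" by (simp add: eq)
      also have "\<dots> = M * \<bar>d - k * \<alpha> - p\<bar>" using M by (simp add: abs_mult)
      finally have "c / ((\<bar>u\<bar> + M) * int N) / M \<le> \<bar>d - k * \<alpha> - p\<bar>"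
        using M by (subst pos_divide_le_eq) (simp_all only: mult.commute of_int_0_less_iff)
      then have "c / (M * (\<bar>u\<bar> + M)) / N \<le> \<bar>d - k * \<alpha> - p\<bar>"
        by (simp add: mult_ac)
      moreover have "\<delta> / N \<le> c / (M * (\<bar>u\<bar> + M)) / N" by (intro divide_right_mono) (auto simp: \<delta>_def)
      ultimately show ?thesis by simp
    qed
  qed
  then show ?thesis using \<delta> by (auto simp: separated_def)
qed

(* If N and N + 1 both fail, the two integers k witnessing this are equal, as otherwise their difference would be
   too good a denominator for \<alpha>; failure at all large N then makes \<beta> rationally dependent on \<alpha> and 1. *)
lemma separated_irrational:
  fixes \<beta> :: real and M :: int
  assumes M: "M > 0" and fin: "finite D"
    and D: "\<And>d. d \<in> D \<Longrightarrow> \<exists>(m::int) (n::int). m \<noteq> 0 \<and> d = (m * \<beta> + n) / M"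
    and indep: "\<And>(e::int) (a::int) (b::int). of_int e * \<beta> = of_int a * \<alpha> + of_int b \<Longrightarrow> e = 0"
  shows "\<exists>\<delta>>0. \<forall>N0. \<exists>N\<ge>N0. \<forall>d\<in>D. separated \<alpha> \<delta> N d"
proof -
  have "\<forall>d\<in>D. \<exists>z :: int \<times> int. fst z \<noteq> 0 \<and> d = (of_int (fst z) * \<beta> + of_int (snd z)) / of_int M"
  proof
    fix d assume "d \<in> D"
    from D[OF this] obtain m n :: int where "m \<noteq> 0 \<and> d = (m * \<beta> + n) / M"
      by (elim exE) auto
    then show "\<exists>z :: int \<times> int. fst z \<noteq> 0 \<and> d = (of_int (fst z) * \<beta> + of_int (snd z)) / of_int M"
      by (intro exI[of _ "(m, n)"]) simp
  qed
  then obtain z :: "real \<Rightarrow> int \<times> int" where "\<forall>d\<in>D. fst (z d) \<noteq> 0 \<and> d = (fst (z d) * \<beta> + snd (z d)) / M"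
    by (rule bchoice[THEN exE])
  moreover define m n where "m d = fst (z d)" and "n d = snd (z d)" for d
  ultimately have mn: "m d \<noteq> 0 \<and> d = (m d * \<beta> + n d) / M" if "d \<in> D" for d
    using that by simp
  \<comment> \<open>A common multiple of the coefficients of \<beta>: multiplying d by
    \<open>l d * M\<close> yields L \<beta> plus an integer, so a failure at any d becomes a good
    approximation of the single number L \<beta>.\<close>
  define L where "L = (\<Prod>d\<in>D. m d)"
  have L0: "L \<noteq> 0" using mn fin by (simp add: L_def)
  define l where "l d = L div m d" for d
  have l: "l d * m d = L" if "d \<in> D" for d
    using that fin dvd_prodI[of D d m] by (simp add: l_def L_def)
  define C where "C = 1 + M * (\<Sum>d\<in>D. \<bar>l d\<bar>)"
  have C1: "1 \<le> C" using M by (auto simp: C_def intro!: mult_nonneg_nonneg sum_nonneg)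
  have lC: "M * \<bar>l d\<bar> \<le> C" if "d \<in> D" for d
  proof -
    have "\<bar>l d\<bar> \<le> (\<Sum>d\<in>D. \<bar>l d\<bar>)" using that fin by (intro member_le_sum) auto
    then have "M * \<bar>l d\<bar> \<le> M * (\<Sum>d\<in>D. \<bar>l d\<bar>)" using M by (intro mult_left_mono) auto
    then show ?thesis by (simp add: C_def)
  qed
  \<comment> \<open>Chosen so that the errors at N and N + 1 add up to less than c/(3 C N), the
    lower bound for denominators up to C (2 N + 1) \<le> 3 C N. The minimum with 1 makes the two
    integers p coincide as well.\<close>
  define \<delta> where "\<delta> = min c 1 / (6 * C * C)"
  have \<delta>: "0 < \<delta>" using c_pos C1 by (auto simp: \<delta>_def)
  have C\<delta>: "2 * C * \<delta> = min c 1 / (3 * C)" using C1 by (simp add: \<delta>_def field_simps)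
  have "\<exists>N\<ge>N0. \<forall>d\<in>D. separated \<alpha> \<delta> N d" for N0
  proof (rule ccontr)
    assume contra: "\<not> (\<exists>N\<ge>N0. \<forall>d\<in>D. separated \<alpha> \<delta> N d)"
    have "\<exists>(k::int) (p::int). \<bar>k\<bar> \<le> C * int N \<and> \<bar>L * \<beta> - k * \<alpha> - p\<bar> < C * \<delta> / N" if N: "N \<ge> max 1 N0" for N
    proof -
      obtain d k p where d: "d \<in> D" and k: "\<bar>k\<bar> \<le> int N" and less: "\<bar>d - real_of_int k * \<alpha> - real_of_int p\<bar> < \<delta> / N"
      proof -
        have "\<not> (\<forall>d\<in>D. separated \<alpha> \<delta> N d)"
          using contra N by (metis max.bounded_iff)
        then show thesis
          using that by (auto simp: separated_def not_le)
      qed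
      have "(l d * M) * (d - k * \<alpha> - p) = L * \<beta> - (l d * M * k) * \<alpha> - (l d * M * p - l d * n d)"
      proof -
        have "M * d = m d * \<beta> + n d" using mn[OF d] M by (simp add: field_simps)
        moreover have "real_of_int L = l d * m d" using l[OF d] by (simp flip: of_int_mult)
        moreover have "(l d * M) * (d - k * \<alpha> - p) = l d * (M * d) - l d * M * k * \<alpha> - l d * M * p"
          by (simp add: algebra_simps)
        ultimately show ?thesis by (simp add: algebra_simps)
      qed
      then have "\<bar>L * \<beta> - (l d * M * k) * \<alpha> - (l d * M * p - l d * n d)\<bar>
          = \<bar>real_of_int (l d * M)\<bar> * \<bar>d - k * \<alpha> - p\<bar>"
        by (simp flip: abs_mult)
      also have "\<dots> \<le> C * \<bar>d - k * \<alpha> - p\<bar>"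
      proof (rule mult_right_mono)
        have "\<bar>l d * M\<bar> \<le> C" using lC[OF d] M by (simp add: abs_mult mult.commute)
        then show "\<bar>real_of_int (l d * M)\<bar> \<le> C" by linarith
      qed simp
      also have "\<dots> < C * (\<delta> / N)" using less C1 by (intro mult_strict_left_mono) auto
      finally have 1: "\<bar>L * \<beta> - (l d * M * k) * \<alpha> - (l d * M * p - l d * n d)\<bar> < C * \<delta> / N" by simp
      have "\<bar>l d * M * k\<bar> = (M * \<bar>l d\<bar>) * \<bar>k\<bar>" using M by (simp add: abs_mult)
      also have "\<dots> \<le> C * int N" using lC[OF d] k C1 by (intro mult_mono) auto
      finally show ?thesis
        using 1 by (intro exI[of _ "l d * M * k"] exI[of _ "l d * M * p - l d * n d"]) simp
    qed
    then obtain k p :: "nat \<Rightarrow> int" where kp: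
      "\<And>N. N \<ge> max 1 N0 \<Longrightarrow> \<bar>k N\<bar> \<le> C * int N \<and> \<bar>L * \<beta> - k N * \<alpha> - p N\<bar> < C * \<delta> / N"
      by metis
    have step: "k (Suc N) = k N \<and> p (Suc N) = p N" if N: "N \<ge> max 1 N0" for N
    proof -
      have N1: "1 \<le> real N" using N by simp
      have "C * \<delta> / Suc N \<le> C * \<delta> / N" using N1 C1 \<delta> by (intro divide_left_mono) auto
      moreover have "\<bar>L * \<beta> - k (Suc N) * \<alpha> - p (Suc N)\<bar> < C * \<delta> / Suc N" "\<bar>L * \<beta> - k N * \<alpha> - p N\<bar> < C * \<delta> / N"
        using kp[of N] kp[of "Suc N"] N by auto
      ultimately have "\<bar>(k (Suc N) - k N) * \<alpha> - (p N - p (Suc N))\<bar> < 2 * C * \<delta> / N"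
        by (simp add: left_diff_distrib)
      then have close: "\<bar>(k (Suc N) - k N) * \<alpha> - (p N - p (Suc N))\<bar> < min c 1 / (3 * C) / N"
        by (simp only: C\<delta>)
      have k_eq: "k (Suc N) - k N = 0"
      proof (rule ccontr)
        assume ne: "k (Suc N) - k N \<noteq> 0"
        have "\<bar>k (Suc N) - k N\<bar> \<le> C * int (Suc N) + C * int N"
          using kp[of N] kp[of "Suc N"] N abs_triangle_ineq4[of "k (Suc N)" "k N"] by linarith
        also have "\<dots> = C * (2 * int N + 1)" by (simp add: algebra_simps)
        also have "\<dots> \<le> C * (3 * int N)" using N C1 by (intro mult_left_mono) auto
        finally have "real_of_int \<bar>k (Suc N) - k N\<bar> \<le> real_of_int (C * (3 * int N))"
          by (simp only: of_int_le_iff)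
        then have "c / real_of_int (C * (3 * int N)) \<le> \<bar>(k (Suc N) - k N) * \<alpha> - (p N - p (Suc N))\<bar>"
          using approx_le[OF ne, of _ "p N - p (Suc N)"] by (simp only: of_int_diff)
        moreover have "min c 1 / (3 * C) / N \<le> c / (3 * C) / N"
          using C1 by (intro divide_right_mono) auto
        ultimately show False using close by (simp add: mult_ac)
      qed
      have "min c 1 / (3 * C) / N \<le> 1 / 1 / 1"
        using C1 N1 c_pos by (intro frac_le) auto
      then have "\<bar>real_of_int (p N - p (Suc N))\<bar> < 1" using close k_eq by simp
      then have "p N = p (Suc N)" by linarith
      then show ?thesis using k_eq by simp
    qed
    define N1 where "N1 = max 1 N0"
    have const: "k N = k N1 \<and> p N = p N1" if "N \<ge> N1" for N
      using that by (induction N rule: dec_induct) (use step in \<open>auto simp: N1_def\<close>)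
    \<comment> \<open>The approximating pair no longer depends on N, while the permitted error C
      \<delta>/N tends to 0.\<close>
    have "\<bar>L * \<beta> - k N1 * \<alpha> - p N1\<bar> = 0"
    proof (rule ccontr)
      assume ne: "\<bar>L * \<beta> - k N1 * \<alpha> - p N1\<bar> \<noteq> 0"
      define e where "e = \<bar>L * \<beta> - k N1 * \<alpha> - p N1\<bar>"
      have e: "0 < e" using ne by (simp add: e_def)
      obtain N where N: "C * \<delta> / e < real N" using reals_Archimedean2 by blast
      define N' where "N' = max N N1"
      have "0 < real N'" by (simp add: N'_def N1_def)
      have "e < C * \<delta> / N'" using kp[of N'] const[of N'] by (auto simp: e_def N'_def N1_def)
      then have "N' < C * \<delta> / e" using e \<open>0 < real N'\<close> by (simp add: field_simps)
      then show False using N by (simp add: N'_def)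
    qed
    then have "real_of_int L * \<beta> = k N1 * \<alpha> + p N1" by simp
    then show False using indep[of L "k N1" "p N1"] L0 by simp
  qed
  then show ?thesis using \<delta> by blast
qed

text \<open>If \<beta> depends rationally on \<alpha> and 1, every difference falls under
  \<open>separated_rational\<close> and all scales are good. Otherwise this still holds for the
  differences without \<beta>, and only those that involve \<beta> dictate the choice of N.\<close>

lemma separated_differences:
  fixes \<beta> :: real and M :: int
  assumes M: "M > 0" and fin: "finite D"
    and D: "\<And>d. d \<in> D \<Longrightarrow> \<exists>(m::int) (n::int). d = (m * \<beta> + n) / M"
    and nin: "D \<inter> orbit_group \<alpha> = {}"
  shows "\<exists>\<delta>>0. \<forall>N0. \<exists>N\<ge>N0. \<forall>d\<in>D. separated \<alpha> \<delta> N d"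
proof (cases "\<exists>(e::int) (a::int) (b::int). e \<noteq> 0 \<and> of_int e * \<beta> = of_int a * \<alpha> + of_int b")
  case True
  then obtain e a b :: int where e0: "e \<noteq> 0" "of_int e * \<beta> = of_int a * \<alpha> + of_int b" by metis
  define e' a' b' where "e' = \<bar>e\<bar>" and "a' = sgn e * a" and "b' = sgn e * b"
  have e: "e' > 0" "e' * \<beta> = a' * \<alpha> + b'"
    using e0 by (auto simp: e'_def a'_def b'_def sgn_if)
  have "\<exists>\<delta>>0. \<forall>N\<ge>1. separated \<alpha> \<delta> N d" if d: "d \<in> D" for d
  proof -
    obtain m n :: int where mn: "d = (m * \<beta> + n) / M" using D d by blast
    have "d = (m * (e' * \<beta>) + n * e') / (M * e')" using e(1) M by (simp add: mn field_simps)
    then have "d = (real_of_int (m * a') * \<alpha> + real_of_int (m * b' + n * e')) / real_of_int (M * e')"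
      unfolding e(2) by (simp add: algebra_simps)
    then show ?thesis using separated_rational[of "M * e'" d "m * a'" "m * b' + n * e'"] M e d nin by auto
  qed
  then obtain \<delta> where "\<delta> > 0" "\<forall>d\<in>D. \<forall>N\<ge>1. separated \<alpha> \<delta> N d"
    using uniform_positive_constant[OF fin, of "\<lambda>d \<delta>. \<forall>N\<ge>1. separated \<alpha> \<delta> N d"] separated_mono by blast
  then show ?thesis by (metis le_add1 le_add2)
next
  case False
  define D0 where "D0 = {d\<in>D. \<exists>n :: int. d = n / M}"
  define D1 where "D1 = {d\<in>D. \<exists>(m::int) (n::int). m \<noteq> 0 \<and> d = (m * \<beta> + n) / M}"
  have D01: "D \<subseteq> D0 \<union> D1"
  proof
    fix d assume d: "d \<in> D"
    then obtain m n :: int where mn: "d = (m * \<beta> + n) / M" using D by blast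
    show "d \<in> D0 \<union> D1"
      using d mn by (cases "m = 0") (auto simp: D0_def D1_def)
  qed
  have "\<exists>\<delta>>0. \<forall>N\<ge>1. separated \<alpha> \<delta> N d" if d: "d \<in> D0" for d
  proof -
    obtain n :: int where "d = n / M" using d by (auto simp: D0_def)
    then show ?thesis using separated_rational[of M d 0 n] M d nin by (auto simp: D0_def)
  qed
  moreover have "finite D0"
    using fin by (simp add: D0_def)
  ultimately obtain \<delta>0 where \<delta>0: "\<delta>0 > 0" "\<forall>d\<in>D0. \<forall>N\<ge>1. separated \<alpha> \<delta>0 N d"
    using uniform_positive_constant[of D0 "\<lambda>d \<delta>. \<forall>N\<ge>1. separated \<alpha> \<delta> N d"] separated_mono by blast
  have "\<exists>\<delta>>0. \<forall>N0. \<exists>N\<ge>N0. \<forall>d\<in>D1. separated \<alpha> \<delta> N d"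
    using False fin by (intro separated_irrational[OF M]) (auto simp: D1_def)
  then obtain \<delta>1 where \<delta>1: "\<delta>1 > 0" "\<And>N0. \<exists>N\<ge>N0. \<forall>d\<in>D1. separated \<alpha> \<delta>1 N d"
    by blast
  show ?thesis
  proof (intro exI[of _ "min \<delta>0 \<delta>1"] conjI allI)
    fix N0
    obtain N where N: "N \<ge> max 1 N0" "\<forall>d\<in>D1. separated \<alpha> \<delta>1 N d"
      using \<delta>1 by blast
    then have "\<forall>d\<in>D. separated \<alpha> (min \<delta>0 \<delta>1) N d"
      using D01 \<delta>0 separated_mono[OF _ min.cobounded1, of \<alpha> \<delta>0 N _ \<delta>1]
        separated_mono[OF _ min.cobounded2, of \<alpha> \<delta>1 N _ \<delta>0] by auto
    then show "\<exists>N\<ge>N0. \<forall>d\<in>D. separated \<alpha> (min \<delta>0 \<delta>1) N d"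
      using N by auto
  qed (use \<delta>0 \<delta>1 in auto)
qed

end

section \<open>Jumps of Birkhoff sums\<close>

lemma measurable_frac [measurable]: "(frac :: real \<Rightarrow> real) \<in> borel_measurable borel"
  unfolding frac_def by measurable

lemma saw_measurable [measurable]: "saw \<in> borel_measurable borel"
  unfolding saw_def by measurable

lemma emeasure_lborel_rotation:
  fixes S :: "real set"
  assumes S[measurable]: "S \<in> sets borel"
  shows "emeasure lborel {x\<in>{0..<1}. frac (x + s) \<in> S} = emeasure lborel ({0..<1} \<inter> S)"
proof -
  define f where "f = frac s"
  have f: "0 \<le> f" "f < 1" by (auto simp: f_def frac_lt_1)
  have frac1: "frac (x + s) = x + f" if "0 \<le> x" "x < 1 - f" for x
    using that f by (subst frac_unique_iff) (auto simp: f_def frac_def)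
  have frac2: "frac (x + s) = x + (f - 1)" if "x < 1" "1 - f \<le> x" for x
    using that f by (subst frac_unique_iff) (auto simp: f_def frac_def)
  have eq: "{x\<in>{0..<1}. frac (x + s) \<in> S}
      = (\<lambda>x. x + f) -` ({f..<1} \<inter> S) \<union> (\<lambda>x. x + (f - 1)) -` ({0..<f} \<inter> S)"
    using frac1 frac2 f by (auto simp: not_less) (metis linorder_not_less)+
  have "emeasure lborel {x\<in>{0..<1}. frac (x + s) \<in> S}
      = emeasure lborel ((\<lambda>x. x + f) -` ({f..<1} \<inter> S)) + emeasure lborel ((\<lambda>x. x + (f - 1)) -` ({0..<f} \<inter> S))"
    unfolding eq
  proof (rule plus_emeasure[symmetric])
    show "(\<lambda>x. x + f) -` ({f..<1} \<inter> S) \<in> sets lborel"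
      using measurable_sets[of "\<lambda>x. x + f" borel borel "{f..<1} \<inter> S"] by simp
    show "(\<lambda>x. x + (f - 1)) -` ({0..<f} \<inter> S) \<in> sets lborel"
      using measurable_sets[of "\<lambda>x. x + (f - 1)" borel borel "{0..<f} \<inter> S"] by simp
  qed auto
  also have "\<dots> = emeasure lborel ({f..<1} \<inter> S) + emeasure lborel ({0..<f} \<inter> S)"
    by (simp add: emeasure_lborel_vimage_plus del: vimage_Int)
  also have "\<dots> = emeasure lborel (({f..<1} \<inter> S) \<union> ({0..<f} \<inter> S))"
    by (rule plus_emeasure) auto
  also have "({f..<1} \<inter> S) \<union> ({0..<f} \<inter> S) = {0..<1} \<inter> S"
    using f by auto
  finally show ?thesis .
qed

text \<open>The sawtooth has slope 1 and drops by 1 at each integer; between y - \<tau> and y there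
  is an integer to be crossed precisely when \<open>frac y < \<tau>\<close>.\<close>

lemma saw_jump:
  assumes "0 < \<tau>" "\<tau> < 1"
  shows "saw y - saw (y - \<tau>) = \<tau> - of_bool (frac y < \<tau>)"
proof (cases "frac y < \<tau>")
  case True
  then have "frac (y - \<tau>) = frac y - \<tau> + 1"
    unfolding frac_unique_iff using assms frac_ge_0[of y]
    by (intro conjI) (simp_all only: frac_def, auto)
  then show ?thesis using True by (simp add: saw_def)
next
  case False
  then have "frac (y - \<tau>) = frac y - \<tau>"
    unfolding frac_unique_iff using assms frac_lt_1[of y]
    by (intro conjI) (simp_all only: frac_def, auto)
  then show ?thesis using False by (simp add: saw_def)
qed

text \<open>For weights with sum zero the slopes cancel and a step function is left that drops by
  \<open>W u\<close> at u; hence the minus signs in front of the jumps below.\<close>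

definition step_cocycle :: "real set \<Rightarrow> (real \<Rightarrow> 'a::real_vector) \<Rightarrow> real \<Rightarrow> 'a" where
  "step_cocycle X W x = (\<Sum>u\<in>X. saw (x - u) *\<^sub>R W u)"

lemma birkhoff_step_cocycle:
  "birkhoff_sum \<alpha> (step_cocycle X W) q x = (\<Sum>u\<in>X. (\<Sum>k<q. saw (x - u + real k * \<alpha>)) *\<^sub>R W u)"
  unfolding birkhoff_sum_def step_cocycle_def
  by (subst sum.swap) (simp add: scaleR_sum_left algebra_simps)

text \<open>Each of the infinitely many scales N has to be good for all pairs simultaneously; good
  scales of different pairs might otherwise never coincide.\<close>

definition well_separated :: "real \<Rightarrow> real set \<Rightarrow> bool" where
  "well_separated \<alpha> X \<longleftrightarrow>
     (\<exists>\<delta>>0. \<forall>N0. \<exists>N\<ge>N0. \<forall>u\<in>X. \<forall>v\<in>X. u \<noteq> v \<longrightarrow> separated \<alpha> \<delta> N (u - v))"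

context badly_approximable begin

lemma c_less_1: "c < 1"
  using approx[of 1 "\<lfloor>\<alpha>\<rfloor>"] by (simp add: floor_less_cancel) linarith

text \<open>At a good scale N the points u - k \<alpha>, for u in X and k < q, are \<delta>/N apart
  modulo 1, so a window of length \<tau> = \<delta>/N contains at most one of them. R collects the x
  whose window from x - \<tau> to x contains a discontinuity stemming from u0. There the sum drops
  by exactly \<open>W u0\<close>, since \<open>sumW\<close> kills the common slope contribution q
  \<tau>. It is essential that \<eta> and C do not depend on e.\<close>

lemma birkhoff_jump:
  fixes W :: "real \<Rightarrow> 'a::euclidean_space"
  assumes fin: "finite X" and sumW: "(\<Sum>u\<in>X. W u) = 0" and sep: "well_separated \<alpha> X" and u0: "u0 \<in> X"
  defines "S \<equiv> birkhoff_sum \<alpha> (step_cocycle X W)"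
  shows "\<exists>\<eta>>0. \<exists>C. \<forall>e>0. \<exists>(q::nat) (p::int) \<tau> R. \<bar>q * \<alpha> - p\<bar> < e \<and> \<bar>\<tau>\<bar> < e \<and> R \<in> sets borel \<and>
    R \<subseteq> {0..<1} \<and> ennreal \<eta> \<le> emeasure lborel R \<and>
    (\<forall>x\<in>R. S q x = S q (x - \<tau>) - W u0 \<and> norm (S q (x - \<tau>)) \<le> C)"
proof -
  obtain \<delta>0 where \<delta>0: "\<delta>0 > 0"
    "\<And>N0. \<exists>N\<ge>N0. \<forall>u\<in>X. \<forall>v\<in>X. u \<noteq> v \<longrightarrow> separated \<alpha> \<delta>0 N (u - v)"
    using sep by (auto simp: well_separated_def)
  \<comment> \<open>\<open>\<delta>0\<close> separates the orbits of different points of X; the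
    minimum with c also separates different times on the orbit of one point.\<close>
  define \<delta> where "\<delta> = min \<delta>0 c"
  have \<delta>: "0 < \<delta>" "\<delta> < 1" "\<delta> \<le> c" using \<delta>0 c_pos c_less_1 by (auto simp: \<delta>_def)
  define C where "C = (\<Sum>u\<in>X. 4 * norm (W u))"
  have "\<exists>(q::nat) (p::int) \<tau> R. \<bar>q * \<alpha> - p\<bar> < e \<and> \<bar>\<tau>\<bar> < e \<and> R \<in> sets borel \<and>
    R \<subseteq> {0..<1} \<and> ennreal (c * \<delta>) \<le> emeasure lborel R \<and>
    (\<forall>x\<in>R. S q x = S q (x - \<tau>) - W u0 \<and> norm (S q (x - \<tau>)) \<le> C)" if e: "e > 0" for e :: real
  proof -
    obtain N0 :: nat where N0: "1 / e < real N0" using reals_Archimedean2 by blast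
    obtain N where N: "N \<ge> max 1 N0" "\<forall>u\<in>X. \<forall>v\<in>X. u \<noteq> v \<longrightarrow> separated \<alpha> \<delta>0 N (u - v)"
      using \<delta>0(2) by blast
    have N1: "1 \<le> real N" and Ne: "1 / e < real N" using N N0 by auto
    have invN: "1 / real N < e" using Ne N1 e by (simp add: field_simps)
    have sepX: "\<delta> / N \<le> \<bar>u - v - real_of_int k * \<alpha> - real_of_int p\<bar>"
      if "u \<in> X" "v \<in> X" "u \<noteq> v" "\<bar>k\<bar> \<le> int N" for u v and k p :: int
      using N(2) that separated_mono[of \<alpha> \<delta>0 N "u - v" \<delta>] by (auto simp: separated_def \<delta>_def)
    \<comment> \<open>Dirichlet supplies q \<le> N with error below 1/N, and bad approximability
      forces q > c N. The q intervals of length \<delta>/N that make up R therefore have total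
      length at least c \<delta>, which becomes \<eta>.\<close>
    obtain p q' where q': "coprime p q'" "0 < q'" "q' \<le> int N" "\<bar>real_of_int q' * \<alpha> - real_of_int p\<bar> < 1 / N"
      using Dirichlet_approx_coprime[of N \<alpha>] N by auto
    define q where "q = nat q'"
    have q: "0 < q" "q \<le> N" "coprime p (int q)" "\<bar>q * \<alpha> - p\<bar> < 1 / N"
      using q' by (auto simp: q_def)
    have qN: "c * N < q"
    proof -
      have "c / q < 1 / N" using approx[of "int q" p] q by simp
      then show ?thesis using q N1 by (simp add: field_simps)
    qed
    define \<tau> where "\<tau> = \<delta> / N"
    have \<tau>: "0 < \<tau>" "\<tau> < 1" "\<tau> \<le> 1 / N"
      using \<delta> N1 by (auto simp: \<tau>_def field_simps intro: less_le_trans)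
    have uniq: "u = v \<and> k = l"
      if uv: "u \<in> X" "v \<in> X" "k < q" "l < q" and fr: "frac (x + k * \<alpha> - u) < \<tau>" "frac (x + l * \<alpha> - v) < \<tau>"
      for u v x and k l :: nat
    proof -
      define P where "P = \<lfloor>x + l * \<alpha> - v\<rfloor> - \<lfloor>x + k * \<alpha> - u\<rfloor>"
      have "\<bar>frac (x + k * \<alpha> - u) - frac (x + l * \<alpha> - v)\<bar> < \<tau>"
        using fr frac_ge_0[of "x + k * \<alpha> - u"] frac_ge_0[of "x + l * \<alpha> - v"] by linarith
      moreover have "frac (x + k * \<alpha> - u) - frac (x + l * \<alpha> - v)
          = - (u - v - real_of_int (int k - int l) * \<alpha> - real_of_int P)"
        by (simp add: frac_def P_def algebra_simps)
      ultimately have less: "\<bar>u - v - real_of_int (int k - int l) * \<alpha> - real_of_int P\<bar> < \<delta> / N"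
        by (simp add: \<tau>_def)
      have kl: "\<bar>int k - int l\<bar> \<le> int N" using uv q by auto
      have "u = v" using sepX[OF uv(1,2) _ kl, of P] less by force
      moreover have "k = l"
      proof (rule ccontr)
        assume "k \<noteq> l"
        then have "c / N \<le> \<bar>real_of_int (int k - int l) * \<alpha> - real_of_int (- P)\<bar>"
          using kl by (intro approx_le) linarith+
        moreover have "\<delta> / N \<le> c / N" using \<delta> by (intro divide_right_mono) auto
        ultimately show False using less \<open>u = v\<close> by (simp add: abs_minus_commute algebra_simps)
      qed
      ultimately show ?thesis by simp
    qed
    define E where "E k = {x\<in>{0..<1::real}. frac (x + (k * \<alpha> - u0)) \<in> {0..<\<tau>}}" for k :: nat
    define R where "R = (\<Union>k<q. E k)"
    have E_sets[measurable]: "E k \<in> sets borel" for k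
    proof -
      have "{x\<in>space borel. x \<in> {0..<1::real} \<and> frac (x + (k * \<alpha> - u0)) \<in> {0..<\<tau>}} \<in> sets borel"
        by measurable
      then show ?thesis by (simp add: E_def)
    qed
    have "emeasure lborel (E k) = ennreal \<tau>" for k
    proof -
      have "{0..<1} \<inter> {0..<\<tau>} = {0..<\<tau>}" using \<tau> by auto
      then show ?thesis
        unfolding E_def using \<tau> by (subst emeasure_lborel_rotation) auto
    qed
    moreover have "disjoint_family_on E {..<q}"
      using uniq[OF u0 u0] by (force simp: disjoint_family_on_def E_def algebra_simps)
    ultimately have "emeasure lborel R = (\<Sum>k<q. ennreal \<tau>)"
      unfolding R_def by (subst sum_emeasure[symmetric]) (auto)
    also have "\<dots> = ennreal (q * \<tau>)"
      using \<tau> by (simp add: ennreal_mult ennreal_of_nat_eq_real_of_nat)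
    finally have emR: "emeasure lborel R = ennreal (q * \<tau>)" .
    have mR: "ennreal (c * \<delta>) \<le> emeasure lborel R"
    proof -
      have "c * \<delta> = c * N * (\<delta> / N)" using N1 by simp
      also have "\<dots> \<le> q * \<tau>" unfolding \<tau>_def using qN \<delta> by (intro mult_right_mono) auto
      finally show ?thesis
        using emR by (simp add: ennreal_leI)
    qed
    have bound: "norm (S q y) \<le> C" for y
    proof -
      have "norm (S q y) \<le> (\<Sum>u\<in>X. norm ((\<Sum>k<q. saw (y - u + k * \<alpha>)) *\<^sub>R W u))"
        unfolding S_def birkhoff_step_cocycle by (rule norm_sum)
      also have "\<dots> \<le> C"
        unfolding C_def
      proof (rule sum_mono)
        fix u
        have "1 / real N \<le> 1 / q" using q by (intro divide_left_mono) auto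
        then have "\<bar>\<Sum>k<q. saw (y - u + k * \<alpha>)\<bar> \<le> 4"
          unfolding saw_def using q by (intro sum_frac_bounded[of q p]) auto
        then show "norm ((\<Sum>k<q. saw (y - u + k * \<alpha>)) *\<^sub>R W u) \<le> 4 * norm (W u)"
          by (simp add: mult_right_mono)
      qed
      finally show ?thesis .
    qed
    have jump: "S q x = S q (x - \<tau>) - W u0" if x: "x \<in> R" for x
    proof -
      obtain k0 where k0: "k0 < q" "frac (x + k0 * \<alpha> - u0) < \<tau>"
        using x by (auto simp: R_def E_def algebra_simps)
      have iff: "frac (x - u + k * \<alpha>) < \<tau> \<longleftrightarrow> u = u0 \<and> k = k0" if "u \<in> X" "k < q" for u k
      proof
        assume "frac (x - u + k * \<alpha>) < \<tau>"
        then have "frac (x + k * \<alpha> - u) < \<tau>" by (simp add: algebra_simps)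
        then show "u = u0 \<and> k = k0" using uniq[OF that(1) u0 that(2) k0(1) _ k0(2)] by simp
      next
        assume "u = u0 \<and> k = k0"
        then show "frac (x - u + k * \<alpha>) < \<tau>" using k0 by (simp add: algebra_simps)
      qed
      have inner: "(\<Sum>k<q. saw (x - u + k * \<alpha>)) - (\<Sum>k<q. saw (x - \<tau> - u + k * \<alpha>)) = q * \<tau> - of_bool (u = u0)"
        if u: "u \<in> X" for u
      proof -
        have "(\<Sum>k<q. saw (x - u + k * \<alpha>)) - (\<Sum>k<q. saw (x - \<tau> - u + k * \<alpha>))
            = (\<Sum>k<q. \<tau> - of_bool (frac (x - u + k * \<alpha>) < \<tau>))"
          unfolding sum_subtractf[symmetric]
        proof (rule sum.cong)
          fix k :: nat
          have "x - \<tau> - u + k * \<alpha> = x - u + k * \<alpha> - \<tau>" by simp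
          then show "saw (x - u + k * \<alpha>) - saw (x - \<tau> - u + k * \<alpha>) = \<tau> - of_bool (frac (x - u + k * \<alpha>) < \<tau>)"
            using saw_jump[OF \<tau>(1,2), of "x - u + k * \<alpha>"] by (simp only:)
        qed simp
        also have "\<dots> = (\<Sum>k<q. \<tau> - (if k = k0 then of_bool (u = u0) else 0))"
          using iff[OF u] by (intro sum.cong) auto
        also have "\<dots> = q * \<tau> - of_bool (u = u0)"
          using k0 by (simp add: sum_subtractf sum.delta)
        finally show ?thesis .
      qed
      have "S q x - S q (x - \<tau>)
          = (\<Sum>u\<in>X. ((\<Sum>k<q. saw (x - u + k * \<alpha>)) - (\<Sum>k<q. saw (x - \<tau> - u + k * \<alpha>))) *\<^sub>R W u)"
        unfolding S_def birkhoff_step_cocycle by (simp add: scaleR_diff_left sum_subtractf)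
      also have "\<dots> = (\<Sum>u\<in>X. (q * \<tau>) *\<^sub>R W u - (if u = u0 then W u else 0))"
        using inner by (intro sum.cong) (auto simp: scaleR_diff_left)
      also have "\<dots> = (q * \<tau>) *\<^sub>R (\<Sum>u\<in>X. W u) - W u0"
        using fin u0 by (simp add: sum_subtractf scaleR_sum_right sum.delta)
      finally show ?thesis by (simp add: sumW algebra_simps)
    qed
    have "\<bar>\<tau>\<bar> < e" "\<bar>q * \<alpha> - p\<bar> < e" using \<tau> q invN by auto
    moreover have "R \<in> sets borel" "R \<subseteq> {0..<1}" by (auto simp: R_def E_def[abs_def] intro!: E_sets[unfolded E_def])
    ultimately show ?thesis using mR bound jump by blast
  qed
  then show ?thesis using c_pos \<delta> by (intro exI[of _ "c * \<delta>"] conjI exI[of _ C]) auto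
qed

end

section \<open>Jumps are almost periods of invariant sets\<close>

text \<open>Invariance is pointwise, as in the definition of ergodicity, but the set lives over the
  line instead of the circle: the base map is the plain translation by \<alpha>, and vectors of the
  product space can act as periods.\<close>

definition invariant_set :: "real \<Rightarrow> (real \<Rightarrow> 'a::euclidean_space) \<Rightarrow> (real \<times> 'a) set \<Rightarrow> bool" where
  "invariant_set \<alpha> \<Phi> A \<longleftrightarrow> A \<in> sets borel \<and> (\<forall>x y. (x + 1, y) \<in> A \<longleftrightarrow> (x, y) \<in> A) \<and>
     (\<forall>x y. (x + \<alpha>, y + \<Phi> x) \<in> A \<longleftrightarrow> (x, y) \<in> A)"

lemma invariant_set_iterate:
  assumes "invariant_set \<alpha> \<Phi> A"
  shows "(x + (q * \<alpha> - of_int p), y + birkhoff_sum \<alpha> \<Phi> q x) \<in> A \<longleftrightarrow> (x, y) \<in> A"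
proof -
  have nat: "(x + real n, y) \<in> A \<longleftrightarrow> (x, y) \<in> A" for n :: nat and x y
  proof (induction n)
    case (Suc n)
    have "(x + real n + 1, y) \<in> A \<longleftrightarrow> (x + real n, y) \<in> A"
      using assms by (simp only: invariant_set_def)
    then show ?case using Suc by (simp add: ac_simps)
  qed simp
  have int: "(x - of_int p, y) \<in> A \<longleftrightarrow> (x, y) \<in> A" for p x y
  proof (cases "p \<ge> 0")
    case True
    then show ?thesis using nat[of "x - of_int p" "nat p" y] by simp
  next
    case False
    then show ?thesis using nat[of x "nat (- p)" y] by simp
  qed
  have "(x + q * \<alpha>, y + birkhoff_sum \<alpha> \<Phi> q x) \<in> A \<longleftrightarrow> (x, y) \<in> A"
  proof (induction q)
    case (Suc q)
    have "(x + q * \<alpha> + \<alpha>, y + birkhoff_sum \<alpha> \<Phi> q x + \<Phi> (x + q * \<alpha>)) \<in> A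
        \<longleftrightarrow> (x + q * \<alpha>, y + birkhoff_sum \<alpha> \<Phi> q x) \<in> A"
      using assms by (simp only: invariant_set_def)
    then show ?case using Suc by (simp add: birkhoff_sum_def algebra_simps)
  qed (simp add: birkhoff_sum_def)
  then show ?thesis
    using int[of "x + q * \<alpha>" p] by (simp add: algebra_simps)
qed

section \<open>Shears of the product space and the comparison across a jump\<close>

lemma sets_lborel_pair:
  "sets (lborel \<Otimes>\<^sub>M lborel) = sets (borel :: ('a::euclidean_space \<times> 'b::euclidean_space) measure)"
  by (simp only: lborel_prod sets_lborel)

lemma birkhoff_sum_measurable [measurable]:
  fixes \<Phi> :: "real \<Rightarrow> 'a::euclidean_space"
  assumes [measurable]: "\<Phi> \<in> borel_measurable borel"
  shows "birkhoff_sum \<alpha> \<Phi> q \<in> borel_measurable borel"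
  unfolding birkhoff_sum_def by measurable

lemma shear_measurable:
  fixes u :: "real \<Rightarrow> 'a::euclidean_space"
  assumes [measurable]: "u \<in> borel_measurable borel" and M: "M \<in> sets borel"
  shows "(\<lambda>z. (fst z + s, snd z + u (fst z))) -` M \<in> sets borel"
proof -
  have "(\<lambda>z :: real \<times> 'a. (fst z + s, snd z + u (fst z))) \<in> measurable (borel \<Otimes>\<^sub>M borel) (borel \<Otimes>\<^sub>M borel)"
    by measurable
  then have "(\<lambda>z :: real \<times> 'a. (fst z + s, snd z + u (fst z))) \<in> borel_measurable borel"
    by (simp add: borel_prod)
  from measurable_sets[OF this M] show ?thesis by simp
qed

lemma emeasure_lborel_shear:
  fixes u :: "real \<Rightarrow> 'a::euclidean_space"
  assumes u: "u \<in> borel_measurable borel" and M: "M \<in> sets borel"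
  shows "emeasure lborel ((\<lambda>z. (fst z + s, snd z + u (fst z))) -` M) = emeasure lborel M"
    (is "emeasure _ ?P = _")
proof -
  have sets: "M \<in> sets (lborel \<Otimes>\<^sub>M lborel)" "?P \<in> sets (lborel \<Otimes>\<^sub>M lborel)"
    using M shear_measurable[OF u M] by (simp_all only: sets_lborel_pair)
  have Mx: "Pair x -` M \<in> sets borel" for x
    using sets_Pair1[OF sets(1), of x] by simp
  have slice: "emeasure lborel (Pair x -` ?P) = emeasure lborel (Pair (s + x) -` M)" for x
  proof -
    have "Pair x -` ?P = (\<lambda>y. y + u x) -` (Pair (s + x) -` M)"
      by (auto simp: add.commute)
    then show ?thesis using emeasure_lborel_vimage_plus[OF Mx] by simp
  qed
  have meas: "(\<lambda>x. emeasure lborel (Pair x -` M)) \<in> borel_measurable borel"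
    using lborel.measurable_emeasure_Pair[OF sets(1)] by simp
  have "emeasure (lborel \<Otimes>\<^sub>M lborel) ?P = (\<integral>\<^sup>+x. emeasure lborel (Pair (s + x) -` M) \<partial>lborel)"
    by (subst lborel.emeasure_pair_measure_alt[OF sets(2)]) (simp only: slice)
  also have "\<dots> = (\<integral>\<^sup>+x. emeasure lborel (Pair x -` M) \<partial>distr lborel borel ((+) s))"
    using meas by (subst nn_integral_distr) auto
  also have "\<dots> = emeasure (lborel \<Otimes>\<^sub>M lborel) M"
    by (subst lborel_distr_plus) (rule lborel.emeasure_pair_measure_alt[OF sets(1), symmetric])
  finally show ?thesis by (simp add: lborel_prod)
qed

(* For x in R, the points (x, y) and (x - \<tau>, y - w) are carried to the same height y + v - w by the q-th iterate,
   with horizontal displacement h; the small translations by h and \<tau> cost little measure. *)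
lemma jump_difference_small:
  fixes A :: "(real \<times> 'a::euclidean_space) set" and w :: 'a and \<alpha> e :: real
  assumes inv: "invariant_set \<alpha> \<Phi> A" and \<Phi>: "\<Phi> \<in> borel_measurable borel" and "0 < e"
  defines "S \<equiv> birkhoff_sum \<alpha> \<Phi>" and "B \<equiv> {z. (z \<in> A) \<noteq> (z - (0, w) \<in> A)}"
  assumes jumps: "\<And>e. e > 0 \<Longrightarrow> \<exists>(q::nat) (p::int) \<tau> R. \<bar>q * \<alpha> - p\<bar> < e \<and> \<bar>\<tau>\<bar> < e \<and> R \<in> sets borel \<and>
    R \<subseteq> {0..<1} \<and> ennreal \<eta> \<le> emeasure lborel R \<and>
    (\<forall>x\<in>R. S q x = S q (x - \<tau>) - w \<and> norm (S q (x - \<tau>)) \<le> C)"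
  shows "\<exists>R\<in>sets borel. R \<subseteq> {0..<1} \<and> ennreal \<eta> \<le> emeasure lborel R \<and>
           emeasure lborel (B \<inter> R \<times> ball 0 r) \<le> ennreal (4 * e)"
proof -
  have A[measurable]: "A \<in> sets borel" using inv by (simp add: invariant_set_def)
  \<comment> \<open>Large enough for all points to which a small translation is applied: their first
    coordinates are x and x - \<tau> with |\<tau>| < 1, and their heights are at most r + C +
    \<open>norm w\<close>.\<close>
  define Q where "Q = {-1..2::real} \<times> cball (0::'a) (r + C + norm w)"
  have "bounded Q" unfolding Q_def by (intro bounded_Times) auto
  from translation_continuous_in_measure[OF A this \<open>0 < e\<close>] obtain d where d: "d > 0"
    "\<And>v. norm v < d \<Longrightarrow> \<exists>X\<in>sets borel. {z\<in>Q. (z + v \<in> A) \<noteq> (z \<in> A)} \<subseteq> X \<and> emeasure lborel X < ennreal e"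
    by blast
  obtain q :: nat and p :: int and \<tau> R where *: "\<bar>q * \<alpha> - p\<bar> < min d 1" "\<bar>\<tau>\<bar> < min d 1" "R \<in> sets borel"
    "R \<subseteq> {0..<1}" "ennreal \<eta> \<le> emeasure lborel R"
    and R: "\<And>x. x \<in> R \<Longrightarrow> S q x = S q (x - \<tau>) - w" "\<And>x. x \<in> R \<Longrightarrow> norm (S q (x - \<tau>)) \<le> C"
    using jumps[of "min d 1"] d(1) by auto
  define h where "h = q * \<alpha> - p"
  have "norm (h, 0::'a) < d" "norm (- \<tau>, 0::'a) < d" "norm (\<tau>, 0::'a) < d"
    using * by (simp_all add: h_def norm_Pair)
  then obtain X1 X2 X3 where
    X1: "X1 \<in> sets borel" "{z\<in>Q. (z + (h, 0) \<in> A) \<noteq> (z \<in> A)} \<subseteq> X1" "emeasure lborel X1 < ennreal e" and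
    X2: "X2 \<in> sets borel" "{z\<in>Q. (z + (- \<tau>, 0) \<in> A) \<noteq> (z \<in> A)} \<subseteq> X2" "emeasure lborel X2 < ennreal e" and
    X3: "X3 \<in> sets borel" "{z\<in>Q. (z + (\<tau>, 0) \<in> A) \<noteq> (z \<in> A)} \<subseteq> X3" "emeasure lborel X3 < ennreal e"
    using d(2) by meson
  define T where "T s u = (\<lambda>z :: real \<times> 'a. (fst z + s, snd z + u (fst z)))" for s and u :: "real \<Rightarrow> 'a"
  define v where "v x = S q (x - \<tau>)" for x
  have v[measurable]: "v \<in> borel_measurable borel"
    unfolding v_def S_def using birkhoff_sum_measurable[OF \<Phi>, of \<alpha> q] by measurable
  \<comment> \<open>One exceptional set for each of the four small moves: by h from x, by - \<tau>,
    by h from x - \<tau>, and back by \<tau>. Each is pulled back to (x, y) by a measure-preserving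
    shear, which explains the bound 4 e.\<close>
  define Y where "Y = T 0 (\<lambda>x. v x - w) -` X1 \<union> T 0 (\<lambda>x. v x - w) -` X2 \<union> T (- \<tau>) (\<lambda>x. v x - w) -` X1
      \<union> T (- \<tau>) (\<lambda>x. - w) -` X3"
  have sets: "T s u -` X \<in> sets borel" and em: "emeasure lborel (T s u -` X) = emeasure lborel X"
    if "u \<in> borel_measurable borel" "X \<in> sets borel" for s u X
    using that unfolding T_def by (auto intro: shear_measurable emeasure_lborel_shear)
  have "B \<inter> R \<times> ball 0 r \<subseteq> Y"
  proof (rule subsetI, rule ccontr)
    fix z assume z: "z \<in> B \<inter> R \<times> ball 0 r" "z \<notin> Y"
    obtain x y where xy: "z = (x, y)" by (cases z)
    have x: "x \<in> R" and y: "norm y < r" using z xy by auto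
    have x01: "0 \<le> x" "x < 1" using x * by auto
    have \<tau>1: "\<bar>\<tau>\<bar> < 1" using * by auto
    have nv: "norm (y + v x - w) \<le> r + C + norm w"
      using R(2)[OF x] y norm_triangle_ineq[of y "v x"] norm_triangle_ineq4[of "y + v x" w]
      unfolding v_def by linarith
    have nw: "norm (y - w) \<le> r + C + norm w"
      using R(2)[OF x] y norm_triangle_ineq4[of y w] norm_ge_zero[of "S q (x - \<tau>)"] by linarith
    have Q: "(x, y + v x - w) \<in> Q" "(x - \<tau>, y + v x - w) \<in> Q" "(x - \<tau>, y - w) \<in> Q"
      using x01 \<tau>1 nv nw by (auto simp: Q_def)
    have nX: "(x, y + v x - w) \<notin> X1" "(x, y + v x - w) \<notin> X2" "(x - \<tau>, y + v x - w) \<notin> X1" "(x - \<tau>, y - w) \<notin> X3"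
      using z(2) xy by (auto simp: Y_def T_def algebra_simps)
    have "(x, y) \<in> A \<longleftrightarrow> (x + h, y + v x - w) \<in> A"
      using invariant_set_iterate[OF inv, of x q p y] R(1)[OF x]
      by (simp add: h_def v_def S_def[symmetric] algebra_simps)
    also have "\<dots> \<longleftrightarrow> (x, y + v x - w) \<in> A"
      using Q(1) nX(1) X1(2) by auto
    also have "\<dots> \<longleftrightarrow> (x - \<tau>, y + v x - w) \<in> A"
      using Q(1) nX(2) X2(2) by auto
    also have "\<dots> \<longleftrightarrow> (x - \<tau> + h, y + v x - w) \<in> A"
      using Q(2) nX(3) X1(2) by auto
    also have "\<dots> \<longleftrightarrow> (x - \<tau>, y - w) \<in> A"
      using invariant_set_iterate[OF inv, of "x - \<tau>" q p "y - w"]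
      by (simp add: h_def v_def S_def[symmetric] algebra_simps)
    also have "\<dots> \<longleftrightarrow> (x, y - w) \<in> A"
      using Q(3) nX(4) X3(2) by auto
    finally show False using z(1) xy by (simp add: B_def)
  qed
  moreover have Y: "Y \<in> sets borel"
    unfolding Y_def by (intro sets.Un sets X1 X2 X3) auto
  ultimately have "emeasure lborel (B \<inter> R \<times> ball 0 r) \<le> emeasure lborel Y"
    by (intro emeasure_mono) auto
  also have "\<dots> \<le> emeasure lborel (T 0 (\<lambda>x. v x - w) -` X1) + emeasure lborel (T 0 (\<lambda>x. v x - w) -` X2)
      + emeasure lborel (T (- \<tau>) (\<lambda>x. v x - w) -` X1) + emeasure lborel (T (- \<tau>) (\<lambda>x. - w) -` X3)"
    unfolding Y_def using X1(1) X2(1) X3(1)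
    by (intro order_trans[OF emeasure_subadditive] add_mono order_refl) (simp_all add: sets sets.Un)
  also have "\<dots> = emeasure lborel X1 + emeasure lborel X2 + emeasure lborel X1 + emeasure lborel X3"
    using X1 X2 X3 by (simp add: em)
  also have "\<dots> \<le> ennreal e + ennreal e + ennreal e + ennreal e"
    using X1 X2 X3 by (intro add_mono) auto
  also have "\<dots> = ennreal (4 * e)"
    using \<open>0 < e\<close> by (simp flip: ennreal_plus)
  finally show ?thesis using * by blast
qed

section \<open>From jumps on a set of positive measure to periods\<close>

context badly_approximable begin

lemma small_combination:
  assumes "0 < e"
  shows "\<exists>(k::int) (p::int). 0 < \<bar>k * \<alpha> - p\<bar> \<and> \<bar>k * \<alpha> - p\<bar> < e"
proof -
  obtain N :: nat where N: "1 / e < real N" using reals_Archimedean2 by blast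
  moreover from this have N0: "N > 0" using assms by (cases N) (auto simp: field_simps)
  ultimately have "1 / real N < e" using assms by (simp add: field_simps)
  moreover obtain p k :: int where "0 < k" "\<bar>of_int k * \<alpha> - of_int p\<bar> < 1 / N"
    using Dirichlet_approx[OF N0, of \<alpha>] by blast
  moreover from this have "0 < \<bar>of_int k * \<alpha> - of_int p\<bar>"
    using approx[of k p] divide_pos_pos[OF c_pos, of "real_of_int k"] by linarith
  ultimately show ?thesis
    by (intro exI[of _ k] exI[of _ p]) auto
qed

text \<open>Integer combinations of \<alpha> and 1 come arbitrarily close to 0 without vanishing, so
  every real number is a period.\<close>

lemma rotation_ergodic:
  assumes S: "S \<in> sets borel" and 1: "almost_period S 1" and \<alpha>: "almost_period S \<alpha>"
  shows "emeasure lborel S = 0 \<or> emeasure lborel (- S) = 0"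
proof (rule all_almost_periods_imp_trivial[OF S])
  fix v :: real
  have "almost_period S (v *\<^sub>R 1)"
  proof (rule almost_period_scaleR[OF S])
    fix e :: real assume "0 < e"
    from small_combination[OF this] obtain k p :: int
      where kp: "0 < \<bar>k * \<alpha> - p\<bar>" "\<bar>k * \<alpha> - p\<bar> < e"
      by (elim exE conjE)
    have "almost_period S (of_int k *\<^sub>R \<alpha> - of_int p *\<^sub>R 1)"
      by (intro almost_period_diff almost_period_of_int 1 \<alpha>)
    then show "\<exists>s. 0 < \<bar>s\<bar> \<and> \<bar>s\<bar> < e \<and> almost_period S (s *\<^sub>R 1)"
      using kp by (intro exI[of _ "k * \<alpha> - p"]) simp
  qed
  then show "almost_period S v" by simp
qed

text \<open>\<open>jump_difference_small\<close> controls the failures of the period w only over R,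
  which is not the whole circle. Ergodicity of the rotation closes the gap: either almost every
  fibre of B is null and Fubini finishes, or almost none is. In the second case the fibres are
  uniformly large off a set of measure below \<eta>/2, hence over at least \<eta>/2 of every
  admissible R, against the bound with small e.\<close>

lemma jump_almost_period:
  fixes A :: "(real \<times> 'a::euclidean_space) set"
  assumes inv: "invariant_set \<alpha> \<Phi> A" and \<Phi>: "\<Phi> \<in> borel_measurable borel" and "0 < \<eta>"
    and per: "\<And>x. \<Phi> (x + 1) = \<Phi> x"
  defines "S \<equiv> birkhoff_sum \<alpha> \<Phi>"
  assumes jumps: "\<And>e. e > 0 \<Longrightarrow> \<exists>(q::nat) (p::int) \<tau> R. \<bar>q * \<alpha> - p\<bar> < e \<and> \<bar>\<tau>\<bar> < e \<and> R \<in> sets borel \<and>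
    R \<subseteq> {0..<1} \<and> ennreal \<eta> \<le> emeasure lborel R \<and>
    (\<forall>x\<in>R. S q x = S q (x - \<tau>) - w \<and> norm (S q (x - \<tau>)) \<le> C)"
  shows "almost_period A (0, w)"
proof -
  have A[measurable]: "A \<in> sets borel" using inv by (simp add: invariant_set_def)
  define B where "B = {z. (z \<in> A) \<noteq> (z - (0, w) \<in> A)}"
  have B[measurable]: "B \<in> sets borel" unfolding B_def by measurable
  define g where "g x U = emeasure lborel (Pair x -` B \<inter> U)" for x U
  have slice[measurable]: "Pair x -` B \<in> sets borel" for x
    using sets_Pair1[of B lborel lborel x] B by (simp only: sets_lborel_pair sets_lborel)
  have B': "B \<inter> (V \<times> U) \<in> sets (lborel \<Otimes>\<^sub>M lborel)" if "V \<in> sets borel" "U \<in> sets borel" for V U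
    using that B unfolding sets_lborel_pair by (intro sets.Int borel_Times)
  have g_slice: "emeasure lborel (Pair x -` (B \<inter> (V \<times> U))) = g x U * indicator V x" for x U V
    by (auto simp: g_def indicator_def vimage_def Int_def)
  have g_meas: "(\<lambda>x. g x U) \<in> borel_measurable borel" if "U \<in> sets borel" for U
    using lborel.measurable_emeasure_Pair[OF B'[of UNIV U], unfolded g_slice] that by simp
  define Z where "Z = {x. g x UNIV = 0}"
  have Z: "Z \<in> sets borel"
    unfolding Z_def using g_meas[of UNIV] by measurable
  \<comment> \<open>Adding w in the fibre commutes with the skew product, so the failure set B is
    itself invariant, and the measure of its fibres is a rotation-invariant function.\<close>
  have inB: "(x + 1, y) \<in> B \<longleftrightarrow> (x, y) \<in> B" "(x + \<alpha>, y + \<Phi> x) \<in> B \<longleftrightarrow> (x, y) \<in> B" for x y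
  proof -
    have "(x + \<alpha>, y + \<Phi> x - w) \<in> A \<longleftrightarrow> (x, y - w) \<in> A"
      using inv[unfolded invariant_set_def] by (metis add_diff_eq add.commute add_diff_cancel_left diff_add_eq)
    then show "(x + 1, y) \<in> B \<longleftrightarrow> (x, y) \<in> B" "(x + \<alpha>, y + \<Phi> x) \<in> B \<longleftrightarrow> (x, y) \<in> B"
      using inv by (simp_all add: B_def invariant_set_def)
  qed
  have g1: "g (x + 1) UNIV = g x UNIV" for x
    by (simp add: g_def vimage_def inB)
  have g\<alpha>: "g (x + \<alpha>) UNIV = g x UNIV" for x
  proof -
    have "Pair x -` B = (\<lambda>y. y + \<Phi> x) -` (Pair (x + \<alpha>) -` B)"
      by (auto simp: inB)
    then show ?thesis
      using emeasure_lborel_vimage_plus[OF slice, of "\<Phi> x" "x + \<alpha>"] by (simp add: g_def)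
  qed
  have "almost_period Z 1" "almost_period Z \<alpha>"
    by (simp_all add: almost_period_def Z_def g1 g\<alpha>)
  then consider "emeasure lborel Z = 0" | "emeasure lborel (- Z) = 0"
    using rotation_ergodic[OF Z] by blast
  then show ?thesis
  proof cases
    case 2
    then have "AE x in lborel. x \<notin> - Z"
      using Z by (intro AE_not_in) (simp add: null_sets_def)
    then have "AE x in lborel. g x UNIV = 0"
      by eventually_elim (simp add: Z_def)
    from nn_integral_cong_AE[OF this]
    have "(\<integral>\<^sup>+x. g x UNIV \<partial>lborel) = 0"
      by simp
    then have "emeasure (lborel \<Otimes>\<^sub>M lborel) B = 0"
      using lborel.emeasure_pair_measure_alt[OF B'[of UNIV UNIV], unfolded g_slice] by simp
    then have "AE z in lborel. z \<notin> B"
      using B by (intro AE_not_in) (simp add: null_sets_def lborel_prod)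
    then have "almost_period A (0, - w)"
      unfolding almost_period_def by eventually_elim (auto simp: B_def)
    from almost_period_minus[OF this] show ?thesis by simp
  next
    case 1
    \<comment> \<open>Using j both as radius and in the threshold makes the sets increasing; they
      exhaust the complement of Z.\<close>
    define Y where "Y j = {x. ennreal (1 / (real j + 1)) < g x (ball 0 (real j))}" for j :: nat
    have Y[measurable]: "Y j \<in> sets borel" for j
      unfolding Y_def using g_meas[of "ball 0 (real j)"] by measurable
    have Y_mono: "Y i \<subseteq> Y j" if "i \<le> j" for i j
    proof
      fix x assume "x \<in> Y i"
      then have "ennreal (1 / (real i + 1)) < g x (ball 0 (real i))" by (simp add: Y_def)
      moreover have "ennreal (1 / (real j + 1)) \<le> ennreal (1 / (real i + 1))"
        using that by (intro ennreal_leI frac_le) auto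
      moreover have "g x (ball 0 (real i)) \<le> g x (ball 0 (real j))"
        unfolding g_def using that by (intro emeasure_mono) auto
      ultimately show "x \<in> Y j"
        unfolding Y_def mem_Collect_eq by (meson le_less_trans less_le_trans)
    qed
    have Y_cover: "\<exists>j. x \<in> Y j" if "x \<notin> Z" for x
    proof -
      have "incseq (\<lambda>j. Pair x -` B \<inter> ball 0 (real j))"
        by (auto simp: incseq_def)
      then have "(\<lambda>j. g x (ball 0 (real j))) \<longlonglongrightarrow> emeasure lborel (\<Union>j. Pair x -` B \<inter> ball 0 (real j))"
        unfolding g_def by (intro Lim_emeasure_incseq) auto
      moreover have "(\<Union>j. Pair x -` B \<inter> ball 0 (real j)) = Pair x -` B"
        using reals_Archimedean2 by auto
      ultimately have "(\<lambda>j. g x (ball 0 (real j))) \<longlonglongrightarrow> g x UNIV"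
        by (simp add: g_def)
      moreover have "(\<lambda>j. ennreal (1 / (real j + 1))) \<longlonglongrightarrow> 0"
        using tendsto_ennrealI[OF LIMSEQ_inverse_real_of_nat] by (simp add: inverse_eq_divide add.commute)
      moreover have "0 < g x UNIV"
        using that by (simp add: Z_def zero_less_iff_neq_zero)
      then obtain b where "0 < b" "b < g x UNIV"
        using dense by blast
      ultimately have "\<forall>\<^sub>F j in sequentially. b < g x (ball 0 (real j)) \<and> ennreal (1 / (real j + 1)) < b"
        by (intro eventually_conj) (erule (1) order_tendstoD)+
      then have "\<forall>\<^sub>F j in sequentially. ennreal (1 / (real j + 1)) < g x (ball 0 (real j))"
        by eventually_elim (blast intro: order.strict_trans)
      then show ?thesis
        using eventually_happens by (fastforce simp: Y_def)
    qed
    have "(\<lambda>j. emeasure lborel ({0..<1} - Y j)) \<longlonglongrightarrow> emeasure lborel (\<Inter>j. {0..<1} - Y j)"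
    proof (rule Lim_emeasure_decseq)
      show "decseq (\<lambda>j. {0..<1} - Y j)" using Y_mono by (auto simp: decseq_def)
      show "emeasure lborel ({0..<1} - Y i) \<noteq> \<infinity>" for i
        using emeasure_mono[of "{0..<1} - Y i" "{0..<1}" lborel] by (auto simp: top_unique)
    qed auto
    moreover have "emeasure lborel (\<Inter>j. {0..<1} - Y j) = 0"
    proof -
      have "(\<Inter>j. {0..<1} - Y j) \<subseteq> Z" using Y_cover by auto
      then show ?thesis using 1 Z emeasure_mono[of "\<Inter>j. {0..<1} - Y j" Z lborel] by simp
    qed
    ultimately have "\<forall>\<^sub>F j in sequentially. emeasure lborel ({0..<1} - Y j) < ennreal (\<eta> / 2)"
      using \<open>0 < \<eta>\<close> by (intro order_tendstoD(2)) auto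
    then obtain j where j: "emeasure lborel ({0..<1} - Y j) < ennreal (\<eta> / 2)"
      using eventually_happens by fastforce
    \<comment> \<open>At least \<eta>/2 of R lies in \<open>Y j\<close>, where the fibres have
      measure above 1/(j + 1); the product is \<gamma>. With e = \<gamma>/8 the upper bound 4 e is
      only \<gamma>/2.\<close>
    define \<gamma> where "\<gamma> = \<eta> / (2 * (real j + 1))"
    define e where "e = \<gamma> / 8"
    have \<gamma>: "0 < \<gamma>" using \<open>0 < \<eta>\<close> by (simp add: \<gamma>_def)
    then have e: "0 < e" by (simp add: e_def)
    obtain R where R: "R \<in> sets borel" "R \<subseteq> {0..<1}" "ennreal \<eta> \<le> emeasure lborel R"
      "emeasure lborel (B \<inter> R \<times> ball 0 (real j)) \<le> ennreal (4 * e)"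
      using jump_difference_small[OF inv \<Phi> e, of \<eta> w C "real j"] jumps unfolding S_def B_def by blast
    note [measurable] = R(1)
    have half: "ennreal (\<eta> / 2) \<le> emeasure lborel (R \<inter> Y j)"
    proof (rule ccontr)
      assume "\<not> ?thesis"
      then have "emeasure lborel (R \<inter> Y j) + emeasure lborel ({0..<1} - Y j) < ennreal (\<eta> / 2) + ennreal (\<eta> / 2)"
        using j by (intro add_strict_mono) auto
      also have "\<dots> = ennreal \<eta>" using \<open>0 < \<eta>\<close> by (simp flip: ennreal_plus)
      also have "\<dots> \<le> emeasure lborel ((R \<inter> Y j) \<union> ({0..<1} - Y j))"
        using R(2,3) by (elim order_trans, intro emeasure_mono) auto
      also have "\<dots> \<le> emeasure lborel (R \<inter> Y j) + emeasure lborel ({0..<1} - Y j)"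
        by (intro emeasure_subadditive) auto
      finally show False by simp
    qed
    have "ennreal (1 / (real j + 1)) * ennreal (\<eta> / 2) \<le> ennreal (1 / (real j + 1)) * emeasure lborel (R \<inter> Y j)"
      using half by (intro mult_left_mono) auto
    also have "\<dots> = (\<integral>\<^sup>+x. ennreal (1 / (real j + 1)) * indicator (R \<inter> Y j) x \<partial>lborel)"
      by (subst nn_integral_cmult_indicator) auto
    also have "\<dots> \<le> (\<integral>\<^sup>+x. g x (ball 0 (real j)) * indicator R x \<partial>lborel)"
      by (intro nn_integral_mono) (auto simp: Y_def indicator_def)
    also have "\<dots> = emeasure (lborel \<Otimes>\<^sub>M lborel) (B \<inter> R \<times> ball 0 (real j))"
      using lborel.emeasure_pair_measure_alt[OF B'[of R "ball 0 (real j)"], unfolded g_slice] R by simp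
    also have "\<dots> \<le> ennreal (4 * e)"
      using R by (simp add: lborel_prod)
    finally have "ennreal \<gamma> \<le> ennreal (4 * e)"
      using \<open>0 < \<eta>\<close> by (simp add: \<gamma>_def mult_ac flip: ennreal_mult)
    then have "\<gamma> \<le> 4 * e" using e by (subst (asm) ennreal_le_iff) auto
    then show ?thesis using \<gamma> by (simp add: e_def)
  qed
qed

end

section \<open>Merging discontinuities\<close>

definition coboundary :: "real \<Rightarrow> (real \<Rightarrow> 'a::euclidean_space) \<Rightarrow> bool" where
  "coboundary \<alpha> g \<longleftrightarrow> (\<exists>f\<in>borel_measurable borel. (\<forall>x. f (x + 1) = f x) \<and> (\<forall>x. g x = f x - f (x + \<alpha>)))"

lemma coboundary_0: "coboundary \<alpha> (\<lambda>x. 0)"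
  unfolding coboundary_def by (intro bexI[of _ "\<lambda>x. 0"]) auto

lemma coboundary_add:
  assumes "coboundary \<alpha> g" "coboundary \<alpha> g'"
  shows "coboundary \<alpha> (\<lambda>x. g x + g' x)"
proof -
  obtain f f' where "f \<in> borel_measurable borel" "\<And>x. f (x + 1) = f x" "\<And>x. g x = f x - f (x + \<alpha>)"
    "f' \<in> borel_measurable borel" "\<And>x. f' (x + 1) = f' x" "\<And>x. g' x = f' x - f' (x + \<alpha>)"
    using assms by (auto simp: coboundary_def)
  then show ?thesis
    unfolding coboundary_def by (intro bexI[of _ "\<lambda>x. f x + f' x"]) auto
qed

lemma coboundary_minus:
  assumes "coboundary \<alpha> g"
  shows "coboundary \<alpha> (\<lambda>x. - g x)"
proof -
  obtain f where "f \<in> borel_measurable borel" "\<And>x. f (x + 1) = f x" "\<And>x. g x = f x - f (x + \<alpha>)"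
    using assms by (auto simp: coboundary_def)
  then show ?thesis
    unfolding coboundary_def by (intro bexI[of _ "\<lambda>x. - f x"]) auto
qed

lemma coboundary_scaleR:
  assumes "coboundary \<alpha> (g :: real \<Rightarrow> real)"
  shows "coboundary \<alpha> (\<lambda>x. g x *\<^sub>R w)"
proof -
  obtain f where "f \<in> borel_measurable borel" "\<And>x. f (x + 1) = f x" "\<And>x. g x = f x - f (x + \<alpha>)"
    using assms by (auto simp: coboundary_def)
  then show ?thesis
    unfolding coboundary_def by (intro bexI[of _ "\<lambda>x. f x *\<^sub>R w"]) (auto simp: scaleR_diff_left)
qed

lemma coboundary_sum:
  assumes "\<And>i. i \<in> I \<Longrightarrow> coboundary \<alpha> (g i)"
  shows "coboundary \<alpha> (\<lambda>x. \<Sum>i\<in>I. g i x)"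
  using assms
  by (induction I rule: infinite_finite_induct) (auto intro: coboundary_0 coboundary_add)

lemma saw_plus_1 [simp]: "saw (x + 1) = saw x"
  by (simp add: saw_def frac_1_eq)

lemma saw_diff_of_int [simp]: "saw (x - of_int p) = saw x"
  by (simp add: saw_def frac_def)

text \<open>A shift by \<alpha> is the coboundary of a translated sawtooth; n shifts telescope, a
  negative k exchanges the two points, and p disappears by periodicity.\<close>

lemma coboundary_saw_shift:
  fixes \<alpha> u :: real and k p :: int
  shows "coboundary \<alpha> (\<lambda>x. saw (x - u) - saw (x - (u + k * \<alpha> + p)))"
proof -
  have nat: "coboundary \<alpha> (\<lambda>x. saw (x - u) - saw (x - (u + real n * \<alpha>)))" for u n
  proof (induction n)
    case 0
    then show ?case using coboundary_0 by simp
  next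
    case (Suc n)
    have "coboundary \<alpha> (\<lambda>x. saw (x - (u + real n * \<alpha>)) - saw (x - (u + real (Suc n) * \<alpha>)))"
      unfolding coboundary_def
    proof (intro bexI[of _ "\<lambda>x. - saw (x - (u + real (Suc n) * \<alpha>))"] conjI allI)
      fix x
      show "- saw (x + 1 - (u + real (Suc n) * \<alpha>)) = - saw (x - (u + real (Suc n) * \<alpha>))"
        using saw_plus_1[of "x - (u + real (Suc n) * \<alpha>)"] by (simp add: algebra_simps)
      show "saw (x - (u + real n * \<alpha>)) - saw (x - (u + real (Suc n) * \<alpha>))
        = - saw (x - (u + real (Suc n) * \<alpha>)) - - saw (x + \<alpha> - (u + real (Suc n) * \<alpha>))"
        by (simp add: algebra_simps)
    qed measurable
    from coboundary_add[OF Suc this] show ?case by simp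
  qed
  have shift: "saw (x - (u + k * \<alpha> + p)) = saw (x - (u + k * \<alpha>))" for x
    using saw_diff_of_int[of "x - (u + k * \<alpha>)" p] by (simp add: algebra_simps)
  show ?thesis
  proof (cases "k \<ge> 0")
    case True
    then show ?thesis using nat[of u "nat k"] by (simp add: shift)
  next
    case False
    then show ?thesis
      using coboundary_minus[OF nat[of "u + k * \<alpha>" "nat (- k)"]] by (simp add: shift)
  qed
qed

lemma orbit_group_0: "0 \<in> orbit_group \<alpha>"
  by (auto simp: orbit_group_def intro!: exI[of _ 0])

lemma orbit_group_diff:
  assumes "x \<in> orbit_group \<alpha>" "y \<in> orbit_group \<alpha>"
  shows "x - y \<in> orbit_group \<alpha>"
proof -
  obtain k p l q :: int where "x = k * \<alpha> + p" "y = l * \<alpha> + q"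
    using assms by (auto simp: orbit_group_def)
  then have "x - y = of_int (k - l) * \<alpha> + of_int (p - q)" by (simp add: algebra_simps)
  then show ?thesis unfolding orbit_group_def by blast
qed

lemma orbit_group_minus_iff: "x - y \<in> orbit_group \<alpha> \<longleftrightarrow> y - x \<in> orbit_group \<alpha>"
  using orbit_group_diff[OF orbit_group_0, of "x - y" \<alpha>] orbit_group_diff[OF orbit_group_0, of "y - x" \<alpha>] by auto

lemma orbit_group_trans:
  "x - y \<in> orbit_group \<alpha> \<Longrightarrow> y - z \<in> orbit_group \<alpha> \<Longrightarrow> x - z \<in> orbit_group \<alpha>"
  using orbit_group_diff[of "x - y" \<alpha> "z - y"] orbit_group_minus_iff[of y z \<alpha>] by simp

text \<open>Every point is moved to a representative of its class at the cost of a coboundary, and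
  weights within a class add up. The explicit formula for W serves the translated pair, where
  integrality of the merged weights, or the absence of any merging, has to be read off.\<close>

lemma merge_equivalent_points:
  fixes x :: "'i \<Rightarrow> real" and w :: "'i \<Rightarrow> 'a::euclidean_space"
  assumes fin: "finite I" and sum0: "(\<Sum>i\<in>I. w i) = 0"
  obtains X W where "finite X" "X \<subseteq> x ` I" "\<And>u v. u \<in> X \<Longrightarrow> v \<in> X \<Longrightarrow> u - v \<in> orbit_group \<alpha> \<Longrightarrow> u = v"
    "\<And>i. i \<in> I \<Longrightarrow> \<exists>u\<in>X. x i - u \<in> orbit_group \<alpha>"
    "\<And>u. W u = (\<Sum>i | i \<in> I \<and> x i - u \<in> orbit_group \<alpha>. w i)" "(\<Sum>u\<in>X. W u) = 0"
    "coboundary \<alpha> (\<lambda>t. (\<Sum>i\<in>I. saw (t - x i) *\<^sub>R w i) - step_cocycle X W t)"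
proof -
  \<comment> \<open>The predicate under the choice operator depends only on the class of u, so
    equivalent points receive the same representative.\<close>
  define rep where "rep u = (SOME v. v \<in> x ` I \<and> u - v \<in> orbit_group \<alpha>)" for u
  have rep: "rep (x i) \<in> x ` I \<and> x i - rep (x i) \<in> orbit_group \<alpha>" if "i \<in> I" for i
    unfolding rep_def by (rule someI[of _ "x i"]) (use that orbit_group_0 in simp)
  have rep_cong: "rep u = rep v" if uv: "u - v \<in> orbit_group \<alpha>" for u v
  proof -
    have vu: "v - u \<in> orbit_group \<alpha>"
      using uv by (subst orbit_group_minus_iff)
    have "u - z \<in> orbit_group \<alpha> \<longleftrightarrow> v - z \<in> orbit_group \<alpha>" for z
      using orbit_group_trans[OF uv, of z] orbit_group_trans[OF vu, of z] by blast
    then show ?thesis by (simp add: rep_def)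
  qed
  define X where "X = (\<lambda>i. rep (x i)) ` I"
  define W where "W u = (\<Sum>i | i \<in> I \<and> x i - u \<in> orbit_group \<alpha>. w i)" for u
  have finX: "finite X" and X_sub: "X \<subseteq> x ` I"
    using fin rep by (auto simp: X_def)
  have rep_X: "rep u = u" if u: "u \<in> X" for u
  proof -
    obtain i where i: "i \<in> I" "u = rep (x i)" using u by (auto simp: X_def)
    then show ?thesis using rep_cong[of "x i" u] rep[OF i(1)] by simp
  qed
  have class_eq: "{i \<in> I. rep (x i) = u} = {i \<in> I. x i - u \<in> orbit_group \<alpha>}" if "u \<in> X" for u
    using rep rep_cong[of "x _" u] rep_X[OF that] by auto
  have grouped: "(\<Sum>i\<in>I. c (rep (x i)) *\<^sub>R w i) = (\<Sum>u\<in>X. c u *\<^sub>R W u)" for c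
  proof -
    have "(\<Sum>i\<in>I. c (rep (x i)) *\<^sub>R w i) = (\<Sum>u\<in>X. \<Sum>i | i \<in> I \<and> rep (x i) = u. c (rep (x i)) *\<^sub>R w i)"
      unfolding X_def by (rule sum.image_gen[OF fin])
    also have "\<dots> = (\<Sum>u\<in>X. \<Sum>i | i \<in> I \<and> rep (x i) = u. c u *\<^sub>R w i)"
      by (intro sum.cong) auto
    also have "\<dots> = (\<Sum>u\<in>X. c u *\<^sub>R W u)"
      unfolding W_def scaleR_sum_right by (intro sum.cong class_eq) auto
    finally show ?thesis .
  qed
  show thesis
  proof (rule that[of X W])
    show "u = v" if "u \<in> X" "v \<in> X" "u - v \<in> orbit_group \<alpha>" for u v
      using rep_cong[OF that(3)] rep_X that by simp
    show "\<exists>u\<in>X. x i - u \<in> orbit_group \<alpha>" if "i \<in> I" for i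
      using rep[OF that] that by (auto simp: X_def)
    show "(\<Sum>u\<in>X. W u) = 0"
      using grouped[of "\<lambda>_. 1"] sum0 by simp
    have "coboundary \<alpha> (\<lambda>t. \<Sum>i\<in>I. (saw (t - x i) - saw (t - rep (x i))) *\<^sub>R w i)"
    proof (intro coboundary_sum coboundary_scaleR)
      fix i assume "i \<in> I"
      then have "rep (x i) - x i \<in> orbit_group \<alpha>" using rep orbit_group_minus_iff by blast
      then obtain k p :: int where "rep (x i) - x i = k * \<alpha> + p"
        by (auto simp: orbit_group_def)
      then have "rep (x i) = x i + k * \<alpha> + p" by simp
      then show "coboundary \<alpha> (\<lambda>t. saw (t - x i) - saw (t - rep (x i)))"
        using coboundary_saw_shift[of \<alpha> "x i" k p] by simp
    qed
    also have "(\<lambda>t. \<Sum>i\<in>I. (saw (t - x i) - saw (t - rep (x i))) *\<^sub>R w i)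
        = (\<lambda>t. (\<Sum>i\<in>I. saw (t - x i) *\<^sub>R w i) - step_cocycle X W t)"
      by (simp add: fun_eq_iff scaleR_diff_left sum_subtractf grouped[of "\<lambda>u. saw (_ - u)"] step_cocycle_def)
    finally show "coboundary \<alpha> (\<lambda>t. (\<Sum>i\<in>I. saw (t - x i) *\<^sub>R w i) - step_cocycle X W t)" .
  qed (use finX X_sub W_def in auto)
qed

section \<open>The group J generated by the jumps, and the cocycle modulo J\<close>

definition int_span :: "'u set \<Rightarrow> ('u \<Rightarrow> 'a::real_vector) \<Rightarrow> 'a set" where
  "int_span X W = {\<Sum>u\<in>X. of_int (n u) *\<^sub>R W u | n. True}"

lemma int_span_memI: "(\<Sum>u\<in>X. of_int (n u) *\<^sub>R W u) \<in> int_span X W"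
  unfolding int_span_def by blast

lemma int_span_0: "0 \<in> int_span X W"
  using int_span_memI[of "\<lambda>_. 0" W X] by simp

lemma int_span_base:
  assumes "finite X" "u \<in> X"
  shows "W u \<in> int_span X W"
proof -
  have "(\<Sum>v\<in>X. of_int (of_bool (v = u)) *\<^sub>R W v) = (\<Sum>v\<in>X. if v = u then W v else 0)"
    by (rule sum.cong) simp_all
  also have "\<dots> = W u" using assms by simp
  finally show ?thesis using int_span_memI[of "\<lambda>v. of_bool (v = u)" W X] by simp
qed

lemma int_span_diff:
  assumes "a \<in> int_span X W" "b \<in> int_span X W"
  shows "a - b \<in> int_span X W"
proof -
  obtain m n where "a = (\<Sum>u\<in>X. of_int (m u) *\<^sub>R W u)" "b = (\<Sum>u\<in>X. of_int (n u) *\<^sub>R W u)"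
    using assms by (auto simp: int_span_def)
  then have "a - b = (\<Sum>u\<in>X. of_int (m u - n u) *\<^sub>R W u)"
    by (simp add: scaleR_diff_left sum_subtractf)
  then show ?thesis using int_span_memI[of "\<lambda>u. m u - n u" W X] by simp
qed

lemma int_span_scale:
  assumes "a \<in> int_span X W"
  shows "of_int k *\<^sub>R a \<in> int_span X W"
proof -
  obtain m where "a = (\<Sum>u\<in>X. of_int (m u) *\<^sub>R W u)"
    using assms by (auto simp: int_span_def)
  then have "of_int k *\<^sub>R a = (\<Sum>u\<in>X. of_int (k * m u) *\<^sub>R W u)"
    by (simp add: scaleR_sum_right)
  then show ?thesis using int_span_memI[of "\<lambda>u. k * m u" W X] by simp
qed

lemma int_span_add:
  assumes "a \<in> int_span X W" "b \<in> int_span X W"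
  shows "a + b \<in> int_span X W"
  using int_span_diff[OF assms(1) int_span_diff[OF int_span_0 assms(2)]] by simp

lemma countable_int_span:
  assumes "finite X"
  shows "countable (int_span X W)"
proof -
  have "int_span X W \<subseteq> (\<lambda>n. \<Sum>u\<in>X. of_int (n u) *\<^sub>R W u) ` (X \<rightarrow>\<^sub>E (UNIV :: int set))"
  proof
    fix a assume "a \<in> int_span X W"
    then obtain n where "a = (\<Sum>u\<in>X. of_int (n u) *\<^sub>R W u)" by (auto simp: int_span_def)
    then show "a \<in> (\<lambda>n. \<Sum>u\<in>X. of_int (n u) *\<^sub>R W u) ` (X \<rightarrow>\<^sub>E (UNIV :: int set))"
      by (intro image_eqI[where x = "restrict n X"]) auto
  qed
  moreover have "countable (X \<rightarrow>\<^sub>E (UNIV :: int set))"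
    using assms by (intro countable_PiE) auto
  ultimately show ?thesis by (meson countable_image countable_subset)
qed

text \<open>This is the \<kappa> of the overview. Writing \<open>saw (x - u)\<close> as x - u - 1/2
  minus an integer, the terms in x and 1/2 vanish for weights with sum zero, and the integers
  contribute an element of \<open>int_span X W\<close>.\<close>

definition drift :: "real set \<Rightarrow> (real \<Rightarrow> 'a::real_vector) \<Rightarrow> 'a" where
  "drift X W = - (\<Sum>u\<in>X. u *\<^sub>R W u)"

lemma step_cocycle_mod_int_span:
  assumes "(\<Sum>u\<in>X. W u) = 0"
  shows "step_cocycle X W x - drift X W \<in> int_span X W"
proof -
  have "step_cocycle X W x = (\<Sum>u\<in>X. (x - 1 / 2) *\<^sub>R W u - u *\<^sub>R W u + of_int (- \<lfloor>x - u\<rfloor>) *\<^sub>R W u)"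
    unfolding step_cocycle_def saw_def frac_def by (simp add: algebra_simps)
  also have "\<dots> = (x - 1 / 2) *\<^sub>R (\<Sum>u\<in>X. W u) + drift X W + (\<Sum>u\<in>X. of_int (- \<lfloor>x - u\<rfloor>) *\<^sub>R W u)"
    by (simp add: drift_def sum.distrib sum_subtractf scaleR_sum_right sum_negf)
  finally have "step_cocycle X W x - drift X W = (\<Sum>u\<in>X. of_int (- \<lfloor>x - u\<rfloor>) *\<^sub>R W u)"
    using assms by simp
  then show ?thesis using int_span_memI by metis
qed

lemma step_cocycle_measurable [measurable]:
  fixes W :: "real \<Rightarrow> 'a::euclidean_space"
  shows "step_cocycle X W \<in> borel_measurable borel"
  unfolding step_cocycle_def by measurable

lemma step_cocycle_periodic: "step_cocycle X W (x + 1) = step_cocycle X W x"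
proof -
  have "saw (x + 1 - u) = saw (x - u)" for u
    using saw_plus_1[of "x - u"] by (simp add: algebra_simps)
  then show ?thesis by (simp add: step_cocycle_def)
qed

text \<open>The last period replaces the x-dependent height by a constant. The two differ by an
  element of the span that varies with x, which can be absorbed because the span is countable:
  almost every z respects all its vertical periods simultaneously.\<close>

lemma (in badly_approximable) invariant_set_periods:
  fixes W :: "real \<Rightarrow> 'a::euclidean_space"
  assumes fin: "finite X" and sumW: "(\<Sum>u\<in>X. W u) = 0" and sep: "well_separated \<alpha> X"
    and inv: "invariant_set \<alpha> (step_cocycle X W) A"
  shows "almost_period A (1, 0)" "\<And>j. j \<in> int_span X W \<Longrightarrow> almost_period A (0, j)"
    "almost_period A (\<alpha>, drift X W)"
proof -
  have A: "A \<in> sets borel" using inv by (simp add: invariant_set_def)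
  have "z + (1, 0) \<in> A \<longleftrightarrow> z \<in> A" for z
    using inv by (cases z) (simp add: invariant_set_def)
  then show "almost_period A (1, 0)" by (simp add: almost_period_def)
  have base: "almost_period A (0, W u)" if u: "u \<in> X" for u
  proof -
    from birkhoff_jump[OF fin sumW sep u] obtain \<eta> C where \<eta>: "\<eta> > 0"
      and jumps: "\<And>e. e > 0 \<Longrightarrow> \<exists>(q::nat) (p::int) \<tau> R. \<bar>q * \<alpha> - p\<bar> < e \<and> \<bar>\<tau>\<bar> < e \<and> R \<in> sets borel \<and>
        R \<subseteq> {0..<1} \<and> ennreal \<eta> \<le> emeasure lborel R \<and>
        (\<forall>x\<in>R. birkhoff_sum \<alpha> (step_cocycle X W) q x = birkhoff_sum \<alpha> (step_cocycle X W) q (x - \<tau>) - W u \<and>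
          norm (birkhoff_sum \<alpha> (step_cocycle X W) q (x - \<tau>)) \<le> C)"
      by metis
    show ?thesis
      by (rule jump_almost_period[OF inv step_cocycle_measurable \<eta> step_cocycle_periodic jumps])
  qed
  have span: "almost_period A (0, \<Sum>u\<in>Y. of_int (n u) *\<^sub>R W u)" if "Y \<subseteq> X" for Y n
    using finite_subset[OF that fin] that
  proof (induction Y)
    case empty
    then show ?case using almost_period_0[of A] by (simp add: zero_prod_def)
  next
    case (insert u Y)
    have "almost_period A (of_int (n u) *\<^sub>R (0, W u) + (0, \<Sum>u\<in>Y. of_int (n u) *\<^sub>R W u))"
      using insert by (intro almost_period_add almost_period_of_int base) auto
    then show ?case using insert by simp
  qed
  then show per_span: "almost_period A (0, j)" if "j \<in> int_span X W" for j
    using that by (auto simp: int_span_def)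
  have "AE z in lborel. \<forall>j\<in>int_span X W. z + (0, j) \<in> A \<longleftrightarrow> z \<in> A"
    using per_span by (simp add: AE_ball_countable[OF countable_int_span[OF fin]] almost_period_def)
  from AE_lborel_translate[OF this, of "(\<alpha>, drift X W)"]
  show "almost_period A (\<alpha>, drift X W)"
    unfolding almost_period_def
  proof eventually_elim
    case (elim z)
    obtain x y where z: "z = (x, y)" by (cases z)
    have "z + (\<alpha>, drift X W) + (0, step_cocycle X W x - drift X W) \<in> A \<longleftrightarrow> z + (\<alpha>, drift X W) \<in> A"
      using elim step_cocycle_mod_int_span[OF sumW] by blast
    moreover have "z + (\<alpha>, drift X W) + (0, step_cocycle X W x - drift X W) = (x + \<alpha>, y + step_cocycle X W x)"
      by (simp add: z)
    ultimately show ?case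
      using inv by (simp add: z invariant_set_def)
  qed
qed

section \<open>Skew products over the circle\<close>

lemma space_circle [simp]: "space circle = {0..<1}"
  by (simp add: circle_def space_restrict_space)

lemma sets_circle_iff: "S \<in> sets circle \<longleftrightarrow> S \<subseteq> {0..<1} \<and> S \<in> sets borel"
  by (simp add: circle_def sets_restrict_space_iff)

lemma measurable_circleI: "f \<in> measurable borel N \<Longrightarrow> f \<in> measurable circle N"
  unfolding circle_def by (rule measurable_restrict_space1) simp

lemma emeasure_circle: "S \<in> sets circle \<Longrightarrow> emeasure circle S = emeasure lborel S"
  unfolding sets_circle_iff by (simp add: circle_def emeasure_restrict_space)

lemma AE_circle_iff: "(AE x in circle. P x) \<longleftrightarrow> (AE x in lborel. x \<in> {0..<1} \<longrightarrow> P x)"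
  unfolding circle_def by (simp add: AE_restrict_space_iff)

lemma frac_in_circle: "frac x \<in> {0..<1::real}"
  by (simp add: frac_lt_1)

lemma rotation_measurable: "rotation \<alpha> \<in> measurable circle circle"
proof -
  have "rotation \<alpha> \<in> borel_measurable borel" unfolding rotation_def by measurable
  then have "rotation \<alpha> \<in> measurable circle lborel"
    by (auto intro: measurable_circleI)
  then show ?thesis
    by (subst (2) circle_def) (auto intro!: measurable_restrict_space2 simp: rotation_def frac_lt_1)
qed

lemma distr_rotation: "distr circle circle (rotation \<alpha>) = circle"
proof (rule measure_eqI)
  fix S assume "S \<in> sets (distr circle circle (rotation \<alpha>))"
  then have S: "S \<in> sets circle" by simp
  then have S': "S \<in> sets borel" "S \<subseteq> {0..<1}" by (auto simp: sets_circle_iff)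
  have eq: "rotation \<alpha> -` S \<inter> space circle = {x\<in>{0..<1}. frac (x + \<alpha>) \<in> S}"
    by (auto simp: rotation_def)
  have "rotation \<alpha> -` S \<inter> space circle \<in> sets circle"
    using measurable_sets[OF rotation_measurable S] .
  then have "emeasure (distr circle circle (rotation \<alpha>)) S = emeasure lborel (rotation \<alpha> -` S \<inter> space circle)"
    using S rotation_measurable by (simp only: emeasure_distr emeasure_circle)
  also have "\<dots> = emeasure lborel {x\<in>{0..<1}. frac (x + \<alpha>) \<in> S}" by (simp only: eq)
  also have "\<dots> = emeasure lborel ({0..<1} \<inter> S)" by (rule emeasure_lborel_rotation[OF S'(1)])
  also have "{0..<1} \<inter> S = S" using S' by auto
  finally show "emeasure (distr circle circle (rotation \<alpha>)) S = emeasure circle S"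
    using S by (simp add: emeasure_circle)
qed simp

lemma skew_product_measurable:
  fixes \<Psi> :: "real \<Rightarrow> 'a::euclidean_space"
  assumes H: "closed_subgroup H" and \<Psi>: "\<Psi> \<in> borel_measurable circle" "\<And>x. x \<in> {0..<1} \<Longrightarrow> \<Psi> x \<in> H"
    and \<nu>: "sets \<nu> = sets (restrict_space borel H)"
  shows "skew_product (rotation \<alpha>) \<Psi> \<in> measurable (circle \<Otimes>\<^sub>M \<nu>) (circle \<Otimes>\<^sub>M \<nu>)"
proof -
  have space\<nu>: "space \<nu> = H"
    using sets_eq_imp_space_eq[OF \<nu>] by (simp add: space_restrict_space)
  have id: "(\<lambda>h. h) \<in> borel_measurable \<nu>"
    unfolding measurable_cong_sets[OF \<nu> refl] by (rule measurable_restrict_space1) simp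
  have "(\<lambda>z. snd z + \<Psi> (fst z)) \<in> borel_measurable (circle \<Otimes>\<^sub>M \<nu>)"
    using measurable_compose[OF measurable_snd id] measurable_compose[OF measurable_fst \<Psi>(1)]
    by (rule borel_measurable_add)
  moreover have "(\<lambda>z. snd z + \<Psi> (fst z)) \<in> space (circle \<Otimes>\<^sub>M \<nu>) \<rightarrow> H"
  proof
    fix z assume z: "z \<in> space (circle \<Otimes>\<^sub>M \<nu>)"
    then have "snd z \<in> H" "\<Psi> (fst z) \<in> H"
      using \<Psi>(2) by (auto simp: space_pair_measure space\<nu>)
    then have "snd z - (0 - \<Psi> (fst z)) \<in> H"
      using H unfolding closed_subgroup_def by blast
    then show "snd z + \<Psi> (fst z) \<in> H" by simp
  qed
  ultimately have "(\<lambda>z. snd z + \<Psi> (fst z)) \<in> measurable (circle \<Otimes>\<^sub>M \<nu>) \<nu>"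
    unfolding measurable_cong_sets[OF refl \<nu>] by (intro measurable_restrict_space2)
  moreover have "(\<lambda>z. rotation \<alpha> (fst z)) \<in> measurable (circle \<Otimes>\<^sub>M \<nu>) circle"
    by (rule measurable_compose[OF measurable_fst rotation_measurable])
  ultimately show ?thesis
    unfolding skew_product_def case_prod_unfold by (rule measurable_Pair[rotated])
qed

text \<open>On each fibre the map is a translation by an element of H, which Haar measure does not
  see; integration over the base then leaves only the rotation.\<close>

lemma skew_product_measure_preserving:
  fixes \<Psi> :: "real \<Rightarrow> 'a::euclidean_space"
  assumes H: "closed_subgroup H" and \<Psi>: "\<Psi> \<in> borel_measurable circle" "\<And>x. x \<in> {0..<1} \<Longrightarrow> \<Psi> x \<in> H"
    and haar: "haar_measure_on H \<nu>" and sf: "sigma_finite_measure \<nu>"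
  shows "measure_preserving (circle \<Otimes>\<^sub>M \<nu>) (skew_product (rotation \<alpha>) \<Psi>)"
proof -
  interpret \<nu>: sigma_finite_measure \<nu> by fact
  let ?T = "skew_product (rotation \<alpha>) \<Psi>" and ?M = "circle \<Otimes>\<^sub>M \<nu>"
  have sets\<nu>: "sets \<nu> = sets (restrict_space borel H)"
    using haar by (simp add: haar_measure_on_def)
  have space\<nu>: "space \<nu> = H"
    using sets_eq_imp_space_eq[OF sets\<nu>] by (simp add: space_restrict_space)
  have T: "?T \<in> measurable ?M ?M"
    by (rule skew_product_measurable[OF H \<Psi> sets\<nu>])
  have "distr ?M ?M ?T = ?M"
  proof (rule measure_eqI)
    fix A assume "A \<in> sets (distr ?M ?M ?T)"
    then have A: "A \<in> sets ?M" by simp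
    have pre: "?T -` A \<inter> space ?M \<in> sets ?M" by (rule measurable_sets[OF T A])
    have slice: "emeasure \<nu> (Pair x -` (?T -` A \<inter> space ?M)) = emeasure \<nu> (Pair (rotation \<alpha> x) -` A)"
      if x: "x \<in> space circle" for x
    proof -
      have \<Psi>x: "\<Psi> x \<in> H" using \<Psi>(2) x by simp
      have Ax: "Pair (rotation \<alpha> x) -` A \<in> sets \<nu>" by (rule sets_Pair1[OF A])
      have "(\<lambda>h. \<Psi> x + h) \<in> measurable \<nu> \<nu>"
      proof -
        have "(\<lambda>h. \<Psi> x + h) \<in> borel_measurable (restrict_space borel H)"
          by (rule measurable_restrict_space1) simp
        moreover have "\<Psi> x + h \<in> H" if "h \<in> H" for h
        proof -
          have "h - (0 - \<Psi> x) \<in> H" using H that \<Psi>x unfolding closed_subgroup_def by blast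
          then show ?thesis by (simp add: add.commute)
        qed
        ultimately show ?thesis
          unfolding measurable_cong_sets[OF sets\<nu> sets\<nu>]
          by (intro measurable_restrict_space2) (auto simp: space_restrict_space)
      qed
      then have "emeasure (distr \<nu> \<nu> (\<lambda>h. \<Psi> x + h)) (Pair (rotation \<alpha> x) -` A)
          = emeasure \<nu> ((\<lambda>h. \<Psi> x + h) -` (Pair (rotation \<alpha> x) -` A) \<inter> space \<nu>)"
        using Ax by (rule emeasure_distr)
      also have "distr \<nu> \<nu> (\<lambda>h. \<Psi> x + h) = \<nu>"
        using haar \<Psi>x by (simp add: haar_measure_on_def)
      also have "(\<lambda>h. \<Psi> x + h) -` (Pair (rotation \<alpha> x) -` A) \<inter> space \<nu> = Pair x -` (?T -` A \<inter> space ?M)"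
        using x by (auto simp: skew_product_def space_pair_measure add.commute)
      finally show ?thesis ..
    qed
    have meas: "(\<lambda>x. emeasure \<nu> (Pair x -` A)) \<in> borel_measurable circle"
      by (rule \<nu>.measurable_emeasure_Pair[OF A])
    have "emeasure (distr ?M ?M ?T) A = emeasure ?M (?T -` A \<inter> space ?M)"
      by (rule emeasure_distr[OF T A])
    also have "\<dots> = (\<integral>\<^sup>+x. emeasure \<nu> (Pair (rotation \<alpha> x) -` A) \<partial>circle)"
      unfolding \<nu>.emeasure_pair_measure_alt[OF pre] by (rule nn_integral_cong) (rule slice)
    also have "\<dots> = (\<integral>\<^sup>+x. emeasure \<nu> (Pair x -` A) \<partial>distr circle circle (rotation \<alpha>))"
      by (rule nn_integral_distr[OF rotation_measurable, symmetric]) (use meas in simp)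
    also have "\<dots> = emeasure ?M A"
      by (simp add: distr_rotation \<nu>.emeasure_pair_measure_alt[OF A])
    finally show "emeasure (distr ?M ?M ?T) A = emeasure ?M A" .
  qed simp
  with T show ?thesis by (simp add: measure_preserving_def)
qed

lemma emeasure_circle_pair_eq_0:
  assumes "sigma_finite_measure \<nu>" and A: "A \<in> sets (circle \<Otimes>\<^sub>M \<nu>)"
    and "AE x in lborel. x \<in> {0..<1} \<longrightarrow> emeasure \<nu> (Pair x -` A) = 0"
  shows "emeasure (circle \<Otimes>\<^sub>M \<nu>) A = 0"
proof -
  interpret \<nu>: sigma_finite_measure \<nu> by fact
  have "AE x in circle. emeasure \<nu> (Pair x -` A) = 0"
    using assms(3) by (simp add: AE_circle_iff)
  then show ?thesis
    using \<nu>.measurable_emeasure_Pair[OF A] unfolding \<nu>.emeasure_pair_measure_alt[OF A]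
    by (subst nn_integral_0_iff_AE) auto
qed

lemma AE_slices_null:
  fixes A :: "(real \<times> 'a::euclidean_space) set"
  assumes A: "A \<in> sets borel" and "emeasure lborel A = 0"
  shows "AE x in lborel. emeasure lborel (Pair x -` A) = 0"
proof -
  have A': "A \<in> sets (lborel \<Otimes>\<^sub>M lborel)"
    using A by (simp only: sets_lborel_pair)
  have "(\<integral>\<^sup>+x. emeasure lborel (Pair x -` A) \<partial>lborel) = 0"
    using assms(2) by (simp add: lborel_prod flip: lborel.emeasure_pair_measure_alt[OF A'])
  then show ?thesis
    using lborel.measurable_emeasure_Pair[OF A'] by (subst (asm) nn_integral_0_iff_AE) auto
qed

lemma rotation_frac:
  "frac (frac x + \<alpha>) = frac (x + \<alpha>)"
proof -
  have "x + \<alpha> = frac x + \<alpha> + of_int \<lfloor>x\<rfloor>" by (simp add: frac_def)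
  then show ?thesis by (metis frac_def floor_add_int of_int_add add_diff_cancel_right)
qed

lemma skew_invariant_iff:
  assumes inv: "skew_product (rotation \<alpha>) \<Psi> -` A \<inter> space (circle \<Otimes>\<^sub>M \<nu>) = A"
    and "h \<in> space \<nu>"
  shows "(frac (x + \<alpha>), h + \<Psi> (frac x)) \<in> A \<longleftrightarrow> (frac x, h) \<in> A"
proof -
  have "(frac x, h) \<in> A \<longleftrightarrow> (frac x, h) \<in> skew_product (rotation \<alpha>) \<Psi> -` A \<inter> space (circle \<Otimes>\<^sub>M \<nu>)"
    by (simp only: inv)
  also have "\<dots> \<longleftrightarrow> (frac (x + \<alpha>), h + \<Psi> (frac x)) \<in> A"
    using assms(2) frac_in_circle[of x]
    by (simp add: skew_product_def space_pair_measure rotation_def rotation_frac)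
  finally show ?thesis ..
qed

lemma periodic_frac:
  assumes "\<And>x. f (x + 1) = f (x :: real)"
  shows "f (frac x) = f x"
proof -
  have nat: "f (x + real n) = f x" for n x
  proof (induction n)
    case (Suc n)
    then show ?case using assms[of "x + real n"] by (simp add: ac_simps)
  qed simp
  have "f (x - of_int k) = f x" for k x
  proof (cases "k \<ge> 0")
    case True
    then show ?thesis using nat[of "x - of_int k" "nat k"] by simp
  next
    case False
    then show ?thesis using nat[of x "nat (- k)"] by simp
  qed
  then show ?thesis by (simp add: frac_def)
qed

text \<open>Periodicity of f allows \<open>f (x + \<alpha>)\<close> in place of
  \<open>f (rotation \<alpha> x)\<close>. Measurability of \<Phi> on the circle comes out of the
  identity.\<close>

lemma cohomologous_rotationI:
  fixes \<Phi> \<Psi> f :: "real \<Rightarrow> 'a::euclidean_space"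
  assumes f: "f \<in> borel_measurable borel" "\<And>x. f (x + 1) = f x" and \<Psi>: "\<Psi> \<in> borel_measurable borel"
    and \<Phi>: "\<And>x. x \<in> {0..<1} \<Longrightarrow> \<Phi> x - \<Psi> x = f x - f (x + \<alpha>)"
  shows "cohomologous (rotation \<alpha>) \<Phi> \<Psi>"
proof -
  have "(\<lambda>x. \<Psi> x + (f x - f (x + \<alpha>))) \<in> borel_measurable borel"
    using f(1) \<Psi> by measurable
  then have "(\<lambda>x. \<Psi> x + (f x - f (x + \<alpha>))) \<in> borel_measurable circle"
    by (rule measurable_circleI)
  moreover have "\<Phi> x = \<Psi> x + (f x - f (x + \<alpha>))" if "x \<in> space circle" for x
    using \<Phi>[of x] that by (simp add: algebra_simps)
  ultimately have "\<Phi> \<in> borel_measurable circle"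
    by (subst measurable_cong) auto
  moreover have "AE x in circle. \<Phi> x - \<Psi> x = f x - f (rotation \<alpha> x)"
    using \<Phi> periodic_frac[of f, OF f(2)] by (simp add: AE_circle_iff rotation_def)
  ultimately show ?thesis
    using f(1) \<Psi> unfolding cohomologous_def cocycle_def by (auto intro: measurable_circleI)
qed

text \<open>The case H = \<open>UNIV\<close> with Lebesgue measure as Haar measure. An invariant
  subset of the skew product, extended periodically in the first coordinate, is an
  \<open>invariant_set\<close>; having all periods, it is null or conull.\<close>

lemma regular_cocycle_full:
  fixes \<Phi> \<Psi> :: "real \<Rightarrow> 'a::euclidean_space"
  assumes coh: "cohomologous (rotation \<alpha>) \<Phi> \<Psi>" and \<Psi>: "\<Psi> \<in> borel_measurable borel" "\<And>x. \<Psi> (x + 1) = \<Psi> x"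
    and per: "\<And>A v. invariant_set \<alpha> \<Psi> A \<Longrightarrow> almost_period A v"
  shows "regular_cocycle (rotation \<alpha>) \<Phi>"
proof -
  let ?M = "circle \<Otimes>\<^sub>M (lborel :: 'a measure)" and ?T = "skew_product (rotation \<alpha>) \<Psi>"
  have sub: "closed_subgroup (UNIV :: 'a set)" by (simp add: closed_subgroup_def)
  have haar: "haar_measure_on UNIV (lborel :: 'a measure)"
    unfolding haar_measure_on_def
  proof (intro conjI ballI allI impI)
    show "distr lborel lborel ((+) h) = (lborel :: 'a measure)" for h :: 'a
      using lborel_distr_plus[of h] by (simp cong: distr_cong)
    show "emeasure lborel K < \<infinity>" if "compact K" for K :: "'a set"
      using that emeasure_compact_finite by blast
  qed (simp_all add: sets_restrict_space emeasure_lborel_UNIV)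
  have "emeasure ?M A = 0 \<or> emeasure ?M (space ?M - A) = 0"
    if A: "A \<in> sets ?M" and inv: "?T -` A \<inter> space ?M = A" for A
  proof -
    define A' where "A' = (\<lambda>z :: real \<times> 'a. (frac (fst z), snd z)) -` A"
    have A'b: "A' \<in> sets borel"
    proof -
      have "(\<lambda>z :: real \<times> 'a. frac (fst z)) \<in> measurable (borel \<Otimes>\<^sub>M borel) circle"
        unfolding circle_def by (intro measurable_restrict_space2) (auto simp: frac_lt_1)
      then have "(\<lambda>z :: real \<times> 'a. (frac (fst z), snd z)) \<in> measurable (borel \<Otimes>\<^sub>M borel) ?M"
        by (intro measurable_Pair) auto
      from measurable_sets[OF this A] show ?thesis 
        by (subst borel_prod[symmetric]) (simp add: A'_def space_pair_measure)
    qed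
    have "(x + \<alpha>, y + \<Psi> x) \<in> A' \<longleftrightarrow> (x, y) \<in> A'" for x y
      using skew_invariant_iff[OF inv, of y x] periodic_frac[of \<Psi>, OF \<Psi>(2)] by (simp add: A'_def)
    then have "invariant_set \<alpha> \<Psi> A'"
      using A'b by (simp add: invariant_set_def A'_def frac_1_eq)
    then have "emeasure lborel A' = 0 \<or> emeasure lborel (- A') = 0"
      using per A'b by (intro all_almost_periods_imp_trivial) auto
    then show ?thesis
    proof
      assume "emeasure lborel A' = 0"
      from AE_slices_null[OF A'b this]
      have "AE x in lborel. x \<in> {0..<1} \<longrightarrow> emeasure lborel (Pair x -` A) = 0"
        by eventually_elim (auto simp: A'_def vimage_def frac_eq)
      then show ?thesis using emeasure_circle_pair_eq_0[OF lborel.sigma_finite_measure_axioms A] by blast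
    next
      assume 0: "emeasure lborel (- A') = 0"
      have "- A' \<in> sets borel" using A'b by auto
      from AE_slices_null[OF this 0]
      have "AE x in lborel. x \<in> {0..<1} \<longrightarrow> emeasure lborel (Pair x -` (space ?M - A)) = 0"
        by eventually_elim (auto simp: A'_def vimage_def frac_eq space_pair_measure)
      moreover have "space ?M - A \<in> sets ?M" by (rule sets.compl_sets[OF A])
      ultimately show ?thesis using emeasure_circle_pair_eq_0[OF lborel.sigma_finite_measure_axioms] by blast
    qed
  qed
  then have "ergodic ?M ?T"
    using skew_product_measure_preserving[OF sub _ _ haar lborel.sigma_finite_measure_axioms] \<Psi>(1)
    unfolding ergodic_def by (auto intro: measurable_circleI)
  then show ?thesis
    unfolding regular_cocycle_def using coh sub haar by blast
qed

lemma AE_meets_open: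
  fixes U :: "'b::euclidean_space set"
  assumes "AE z in lborel. P z" and "open U" "U \<noteq> {}"
  obtains z where "z \<in> U" "P z"
proof -
  have False if "\<forall>z\<in>U. \<not> P z"
  proof -
    have "AE z in lborel. z \<notin> U" using assms(1) by eventually_elim (use that in auto)
    then have "U \<in> null_sets lborel"
      using AE_iff_null_sets[of U lborel] \<open>open U\<close> by simp
    then have "U \<in> null_sets lebesgue" by (rule null_sets_completionI)
    then show False using open_not_negligible[OF assms(2,3)] by (simp add: negligible_iff_null_sets)
  qed
  then show thesis using that by blast
qed

text \<open>Subtracting the coboundary of \<open>frac x *\<^sub>R \<theta>\<close> makes the cocycle
  H-valued; H is uniformly discrete, so counting measure is a Haar measure. The lift of circle times
  H is null in the full product, which is why periods act only after thickening. Radius \<epsilon>/2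
  keeps the balls around different elements of H disjoint, so that nothing is lost.\<close>

lemma regular_cocycle_discrete:
  fixes \<Phi> \<Phi>1 f :: "real \<Rightarrow> 'a::euclidean_space"
  assumes f: "f \<in> borel_measurable borel" "\<And>x. f (x + 1) = f x"
    and \<Phi>: "\<And>x. x \<in> {0..<1} \<Longrightarrow> \<Phi> x - \<Phi>1 x = f x - f (x + \<alpha>)"
    and \<Phi>1: "\<Phi>1 \<in> borel_measurable borel" "\<And>x. \<Phi>1 (x + 1) = \<Phi>1 x"
    and H: "countable H" "0 \<in> H" "\<And>x y. x \<in> H \<Longrightarrow> y \<in> H \<Longrightarrow> x - y \<in> H"
    and \<epsilon>: "0 < \<epsilon>" "\<And>h. h \<in> H \<Longrightarrow> h \<noteq> 0 \<Longrightarrow> \<epsilon> \<le> norm h"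
    and valued: "\<And>x. \<Phi>1 x - (frac (x + \<alpha>) - frac x) *\<^sub>R \<theta> \<in> H"
    and per: "\<And>A t h. invariant_set \<alpha> \<Phi>1 A \<Longrightarrow> h \<in> H \<Longrightarrow> almost_period A (t, t *\<^sub>R \<theta> + h)"
  shows "regular_cocycle (rotation \<alpha>) \<Phi>"
proof -
  define \<Psi> where "\<Psi> x = \<Phi>1 x - (frac (x + \<alpha>) - frac x) *\<^sub>R \<theta>" for x
  have \<Psi>_meas: "\<Psi> \<in> borel_measurable borel"
    unfolding \<Psi>_def using \<Phi>1(1) by measurable
  have \<Psi>_per: "\<Psi> (x + 1) = \<Psi> x" for x
    using frac_1_eq[of x] frac_1_eq[of "x + \<alpha>"] \<Phi>1(2)[of x] by (simp add: \<Psi>_def add_ac)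
  have \<Psi>_H: "\<Psi> x \<in> H" for x using valued by (simp add: \<Psi>_def)
  have coh: "cohomologous (rotation \<alpha>) \<Phi> \<Psi>"
  proof (rule cohomologous_rotationI[where f = "\<lambda>x. f x - frac x *\<^sub>R \<theta>"])
    show "(\<lambda>x. f x - frac x *\<^sub>R \<theta>) \<in> borel_measurable borel" using f(1) by measurable
    show "\<Phi> x - \<Psi> x = f x - frac x *\<^sub>R \<theta> - (f (x + \<alpha>) - frac (x + \<alpha>) *\<^sub>R \<theta>)" if "x \<in> {0..<1}" for x
      using \<Phi>[OF that] by (simp add: \<Psi>_def algebra_simps)
  qed (simp_all add: f \<Psi>_meas frac_1_eq)
  have H_add: "x + y \<in> H" if "x \<in> H" "y \<in> H" for x y
    using H(3)[OF that(1) H(3)[OF H(2) that(2)]] by simp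
  have ud: "uniform_discrete H"
    unfolding uniform_discrete_def
  proof (intro exI[of _ \<epsilon>] conjI ballI impI \<epsilon>(1))
    fix x y assume "x \<in> H" "y \<in> H" "dist x y < \<epsilon>"
    then show "x = y" using \<epsilon>(2)[OF H(3), of x y] by (auto simp: dist_norm)
  qed
  have sub: "closed_subgroup H"
    using H uniform_discrete_imp_closed[OF ud] by (auto simp: closed_subgroup_def)
  let ?\<nu> = "count_space H"
  let ?M = "circle \<Otimes>\<^sub>M ?\<nu>" and ?T = "skew_product (rotation \<alpha>) \<Psi>"
  have sf: "sigma_finite_measure ?\<nu>" by (rule sigma_finite_measure_count_space_countable[OF H(1)])
  have haar: "haar_measure_on H ?\<nu>"
    unfolding haar_measure_on_def
  proof (intro conjI ballI allI impI)
    have "X \<in> sets (restrict_space borel H) \<longleftrightarrow> X \<subseteq> H" for X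
    proof -
      have "X \<in> sets borel" if "X \<subseteq> H" for X
        using countable_subset[OF that H(1)] by (rule sets.countable[rotated]) simp
      then show ?thesis using sub by (auto simp: sets_restrict_space_iff closed_subgroup_def)
    qed
    then show "sets ?\<nu> = sets (restrict_space borel H)" by auto
    show "distr ?\<nu> ?\<nu> ((+) h) = ?\<nu>" if "h \<in> H" for h
    proof (rule distr_bij_count_space)
      have "x \<in> (+) h ` H" if "x \<in> H" for x
        using H(3)[OF that \<open>h \<in> H\<close>] by (intro image_eqI[of _ _ "x - h"]) auto
      then show "bij_betw ((+) h) H H" using H_add that by (auto simp: bij_betw_def)
    qed
    show "emeasure ?\<nu> K < \<infinity>" if "K \<subseteq> H" "compact K" for K
    proof -
      have "uniform_discrete K" "bounded K"
        using that ud compact_imp_bounded by (auto intro: uniform_discrete_subset)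
      then have "finite K" using uniform_discrete_finite_iff by blast
      then show ?thesis using that by (simp add: emeasure_count_space of_nat_less_top)
    qed
    show "emeasure ?\<nu> H \<noteq> 0" using H(2) by (auto simp: emeasure_count_space)
  qed
  have "emeasure ?M A = 0 \<or> emeasure ?M (space ?M - A) = 0"
    if A: "A \<in> sets ?M" and inv: "?T -` A \<inter> space ?M = A" for A
  proof -
    (* A is thickened in the fibre direction and sheared along \<theta>, which makes it a \<Phi>1-invariant set. *)
    define F where "F = {z. \<exists>h\<in>H. norm (snd z - frac (fst z) *\<^sub>R \<theta> - h) < \<epsilon> / 2 \<and> (frac (fst z), h) \<in> A}"
    have F: "F \<in> sets borel"
    proof -
      have "{z \<in> space (borel \<Otimes>\<^sub>M borel). norm (snd z - frac (fst z) *\<^sub>R \<theta> - h) < \<epsilon> / 2 \<and> (frac (fst z), h) \<in> A}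
          \<in> sets (borel \<Otimes>\<^sub>M borel)" for h
      proof -
        have S[measurable]: "{x. (x, h) \<in> A} \<in> sets borel"
          using sets_Pair2[OF A, of h] by (simp add: sets_circle_iff vimage_def)
        have "{z \<in> space (borel \<Otimes>\<^sub>M borel). norm (snd z - frac (fst z) *\<^sub>R \<theta> - h) < \<epsilon> / 2
            \<and> frac (fst z) \<in> {x. (x, h) \<in> A}} \<in> sets (borel \<Otimes>\<^sub>M borel)"
          by measurable
        then show ?thesis by simp
      qed
      then have "(\<Union>h\<in>H. {z \<in> space (borel \<Otimes>\<^sub>M borel). norm (snd z - frac (fst z) *\<^sub>R \<theta> - h) < \<epsilon> / 2
          \<and> (frac (fst z), h) \<in> A}) \<in> sets (borel \<Otimes>\<^sub>M borel)"
        by (intro sets.countable_UN' H(1)) auto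
      also have "(\<Union>h\<in>H. {z \<in> space (borel \<Otimes>\<^sub>M borel). norm (snd z - frac (fst z) *\<^sub>R \<theta> - h) < \<epsilon> / 2
          \<and> (frac (fst z), h) \<in> A}) = F"
        by (auto simp: F_def space_pair_measure)
      finally show ?thesis by (subst borel_prod[symmetric])
    qed
    have shift: "(frac (x + \<alpha>), h + \<Psi> x) \<in> A \<longleftrightarrow> (frac x, h) \<in> A" if "h \<in> H" for x h
      using skew_invariant_iff[OF inv, of h x] that periodic_frac[of \<Psi>, OF \<Psi>_per] by simp
    have "(x + \<alpha>, y + \<Phi>1 x) \<in> F \<longleftrightarrow> (x, y) \<in> F" for x y
    proof -
      have eq: "y + \<Phi>1 x - frac (x + \<alpha>) *\<^sub>R \<theta> - (h + \<Psi> x) = y - frac x *\<^sub>R \<theta> - h" for h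
        by (simp add: \<Psi>_def algebra_simps)
      show ?thesis
      proof
        assume "(x + \<alpha>, y + \<Phi>1 x) \<in> F"
        then obtain h where h: "h \<in> H" "norm (y + \<Phi>1 x - frac (x + \<alpha>) *\<^sub>R \<theta> - h) < \<epsilon> / 2" "(frac (x + \<alpha>), h) \<in> A"
          by (auto simp: F_def)
        have "h - \<Psi> x \<in> H" using H(3) h(1) \<Psi>_H by blast
        moreover from this have "(frac x, h - \<Psi> x) \<in> A" using shift[of "h - \<Psi> x" x] h(3) by simp
        moreover have "norm (y - frac x *\<^sub>R \<theta> - (h - \<Psi> x)) < \<epsilon> / 2"
          using eq[of "h - \<Psi> x"] h(2) by (simp only: diff_add_cancel)
        ultimately show "(x, y) \<in> F" by (auto simp: F_def)
      next
        assume "(x, y) \<in> F"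
        then obtain h where h: "h \<in> H" "norm (y - frac x *\<^sub>R \<theta> - h) < \<epsilon> / 2" "(frac x, h) \<in> A"
          by (auto simp: F_def)
        have "h + \<Psi> x \<in> H" using H_add h(1) \<Psi>_H by blast
        moreover have "(frac (x + \<alpha>), h + \<Psi> x) \<in> A" using shift[of h x] h by simp
        moreover have "norm (y + \<Phi>1 x - frac (x + \<alpha>) *\<^sub>R \<theta> - (h + \<Psi> x)) < \<epsilon> / 2"
          using h(2) by (simp only: eq)
        ultimately show "(x + \<alpha>, y + \<Phi>1 x) \<in> F" unfolding F_def by force
      qed
    qed
    then have invF: "invariant_set \<alpha> \<Phi>1 F"
      using F by (simp add: invariant_set_def F_def frac_1_eq)
    \<comment> \<open>The exceptional set of a period depends on t. Fubini exchanges the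
      quantifiers, so that almost every z serves for almost all t, and by countability for all
      h.\<close>
    have "AE z in lborel. \<forall>h\<in>H. AE t in lborel. z + (t, t *\<^sub>R \<theta> + h) \<in> F \<longleftrightarrow> z \<in> F"
    proof (subst AE_ball_countable[OF H(1)], rule ballI)
      fix h assume h: "h \<in> H"
      define Q where "Q = {p. (snd p + (fst p, fst p *\<^sub>R \<theta> + h) \<in> F) = (snd p \<in> F)}"
      have Q: "Q \<in> sets (borel \<Otimes>\<^sub>M borel)"
      proof -
        note [measurable] = F
        have [measurable]: "(\<lambda>p :: real \<times> real \<times> 'a. snd p + (fst p, fst p *\<^sub>R \<theta> + h)) \<in> borel_measurable (borel \<Otimes>\<^sub>M borel)"
        proof -
          have "(\<lambda>p :: real \<times> real \<times> 'a. (fst p, fst p *\<^sub>R \<theta> + h)) \<in> measurable (borel \<Otimes>\<^sub>M borel) (borel \<Otimes>\<^sub>M borel)"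
            by measurable
          then have "(\<lambda>p :: real \<times> real \<times> 'a. (fst p, fst p *\<^sub>R \<theta> + h)) \<in> borel_measurable (borel \<Otimes>\<^sub>M borel)"
            by (simp add: borel_prod)
          then show ?thesis by (intro borel_measurable_add measurable_snd)
        qed
        have "{p \<in> space (borel \<Otimes>\<^sub>M borel). (snd p + (fst p, fst p *\<^sub>R \<theta> + h) \<in> F) = (snd p \<in> F)} \<in> sets (borel \<Otimes>\<^sub>M borel)"
          by measurable
        then show ?thesis by (simp add: Q_def space_pair_measure)
      qed
      have "AE t in lborel. AE z in lborel. (t, z) \<in> Q"
        using per[OF invF h] unfolding almost_period_def Q_def by simp
      moreover have "{p \<in> space (lborel \<Otimes>\<^sub>M lborel). (case p of (t, z) \<Rightarrow> (t, z) \<in> Q)} \<in> sets (lborel \<Otimes>\<^sub>M lborel)"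
        using Q by (simp add: space_pair_measure cong: sets_pair_measure_cong)
      ultimately have "AE z in lborel. AE t in lborel. (t, z) \<in> Q"
        using lborel_pair.AE_commute[of "\<lambda>t z. (t, z) \<in> Q"] by (simp add: case_prod_unfold)
      then show "AE z in lborel. AE t in lborel. z + (t, t *\<^sub>R \<theta> + h) \<in> F \<longleftrightarrow> z \<in> F"
        by (simp add: Q_def)
    qed
    \<comment> \<open>U is a neighbourhood of the line y = x \<theta>. Moving a point z of U by (t,
      t \<theta> + h) reaches the thickened copy of h over the new base point, so membership in F
      there tells whether A contains that base point paired with h. Openness guarantees that U
      contains one of the good z.\<close>
    moreover define U where "U = {z :: real \<times> 'a. norm (snd z - fst z *\<^sub>R \<theta>) < \<epsilon> / 2}"
    have "open U" unfolding U_def by (intro open_Collect_less continuous_intros)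
    moreover have "(0, 0) \<in> U" using \<epsilon>(1) by (simp add: U_def)
    ultimately obtain z where z: "z \<in> U" "\<forall>h\<in>H. AE t in lborel. z + (t, t *\<^sub>R \<theta> + h) \<in> F \<longleftrightarrow> z \<in> F"
      using AE_meets_open by blast
    obtain x0 y0 where z_eq: "z = (x0, y0)" by (cases z)
    define b where "b \<longleftrightarrow> z \<in> F"
    have "AE t in lborel. \<forall>h\<in>H. z + (t, t *\<^sub>R \<theta> + h) \<in> F \<longleftrightarrow> b"
      using z(2) by (simp add: AE_ball_countable[OF H(1)] b_def)
    from AE_lborel_translate[OF this, of "- x0"]
    have all: "AE x in lborel. x \<in> {0..<1} \<longrightarrow> (\<forall>h\<in>H. (x, h) \<in> A \<longleftrightarrow> b)"
    proof eventually_elim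
      case (elim x)
      show ?case
      proof (intro impI ballI)
        fix h assume x: "x \<in> {0..<1}" and h: "h \<in> H"
        define y1 where "y1 = y0 - x0 *\<^sub>R \<theta>"
        have y1: "norm y1 < \<epsilon> / 2" using z(1) by (simp add: U_def z_eq y1_def)
        have "z + (x + - x0, (x + - x0) *\<^sub>R \<theta> + h) = (x, y1 + x *\<^sub>R \<theta> + h)"
          by (simp add: z_eq y1_def algebra_simps)
        then have "(x, y1 + x *\<^sub>R \<theta> + h) \<in> F \<longleftrightarrow> b"
          using elim h by metis
        moreover have "(x, y1 + x *\<^sub>R \<theta> + h) \<in> F \<longleftrightarrow> (x, h) \<in> A"
        proof
          assume "(x, y1 + x *\<^sub>R \<theta> + h) \<in> F"
          then obtain h' where h': "h' \<in> H" "norm (y1 + h - h') < \<epsilon> / 2" "(x, h') \<in> A"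
            using x by (auto simp: F_def frac_eq algebra_simps)
          have "norm (h - h') = norm ((y1 + h - h') - y1)" by simp
          also have "\<dots> < \<epsilon>" using norm_triangle_ineq4[of "y1 + h - h'" y1] h'(2) y1 by linarith
          finally have "h = h'" using \<epsilon>(2)[OF H(3)[OF h h'(1)]] by force
          then show "(x, h) \<in> A" using h' by simp
        next
          assume "(x, h) \<in> A"
          then show "(x, y1 + x *\<^sub>R \<theta> + h) \<in> F"
            using x h y1 unfolding F_def by (auto simp: frac_eq algebra_simps intro!: bexI[of _ h])
        qed
        ultimately show "(x, h) \<in> A \<longleftrightarrow> b" by simp
      qed
    qed
    have A_sub: "A \<subseteq> space ?M" using sets.sets_into_space[OF A] .
    show ?thesis
    proof (cases b)
      case False
      from all have "AE x in lborel. x \<in> {0..<1} \<longrightarrow> emeasure ?\<nu> (Pair x -` A) = 0"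
      proof eventually_elim
        case (elim x)
        have "Pair x -` A = {}" if "x \<in> {0..<1}"
          using elim that False A_sub by (auto simp: space_pair_measure)
        then show ?case by simp
      qed
      then show ?thesis using emeasure_circle_pair_eq_0[OF sf A] by blast
    next
      case True
      from all have "AE x in lborel. x \<in> {0..<1} \<longrightarrow> emeasure ?\<nu> (Pair x -` (space ?M - A)) = 0"
      proof eventually_elim
        case (elim x)
        have "Pair x -` (space ?M - A) = {}" if "x \<in> {0..<1}"
          using elim that True by (auto simp: space_pair_measure)
        then show ?case by simp
      qed
      moreover have "space ?M - A \<in> sets ?M" by (rule sets.compl_sets[OF A])
      ultimately show ?thesis using emeasure_circle_pair_eq_0[OF sf] by blast
    qed
  qed
  then have "ergodic ?M ?T"
    using skew_product_measure_preserving[OF sub measurable_circleI[OF \<Psi>_meas] \<Psi>_H haar sf]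
    unfolding ergodic_def by auto
  then show ?thesis
    unfolding regular_cocycle_def using coh sub haar \<Psi>_H by blast
qed

section \<open>Regularity\<close>

context badly_approximable begin

lemma well_separated_points:
  fixes \<beta> :: real and M :: int
  assumes M: "M > 0" and fin: "finite X"
    and X: "\<And>u. u \<in> X \<Longrightarrow> \<exists>(m::int) (n::int). u = (of_int m * \<beta> + of_int n) / of_int M"
    and ineq: "\<And>u v. u \<in> X \<Longrightarrow> v \<in> X \<Longrightarrow> u - v \<in> orbit_group \<alpha> \<Longrightarrow> u = v"
  shows "well_separated \<alpha> X"
proof -
  define D where "D = (\<lambda>(u, v). u - v) ` {p \<in> X \<times> X. fst p \<noteq> snd p}"
  have "finite D" using fin by (simp add: D_def)
  moreover have "\<exists>(m::int) (n::int). d = (of_int m * \<beta> + of_int n) / of_int M" if d: "d \<in> D" for d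
  proof -
    obtain u v where uv: "u \<in> X" "v \<in> X" "d = u - v" using d by (auto simp: D_def)
    obtain m n :: int where u: "u = (of_int m * \<beta> + of_int n) / of_int M" using X[OF uv(1)] by (elim exE)
    obtain m' n' :: int where v: "v = (of_int m' * \<beta> + of_int n') / of_int M" using X[OF uv(2)] by (elim exE)
    have "d = (of_int (m - m') * \<beta> + of_int (n - n')) / of_int M"
      by (simp add: uv(3) u v algebra_simps flip: diff_divide_distrib)
    then show ?thesis by (intro exI)
  qed
  moreover have "D \<inter> orbit_group \<alpha> = {}" using ineq by (auto simp: D_def)
  ultimately obtain \<delta> where \<delta>: "\<delta> > 0" "\<And>N0. \<exists>N\<ge>N0. \<forall>d\<in>D. separated \<alpha> \<delta> N d"
    using separated_differences[OF M] by blast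
  have "\<exists>N\<ge>N0. \<forall>u\<in>X. \<forall>v\<in>X. u \<noteq> v \<longrightarrow> separated \<alpha> \<delta> N (u - v)" for N0
  proof -
    obtain N where N: "N \<ge> N0" "\<forall>d\<in>D. separated \<alpha> \<delta> N d" using \<delta>(2) by blast
    have "u - v \<in> D" if "u \<in> X" "v \<in> X" "u \<noteq> v" for u v
      unfolding D_def using that by (intro image_eqI[of _ _ "(u, v)"]) auto
    then show ?thesis using N by blast
  qed
  then show ?thesis using \<delta>(1) unfolding well_separated_def by blast
qed

text \<open>The slope is \<theta> = a/l, and the local \<kappa> is what the drift leaves beyond
  \<alpha> \<theta>, so that l \<kappa> = b. The group H spanned by J, \<theta> and \<kappa>
  satisfies l H \<subseteq> J, which gives the gap \<epsilon>/l. Both l (1, \<theta>) and l \<alpha>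
  (1, \<theta>) are periods; their integer combinations become arbitrarily short, so the whole line
  through (1, \<theta>) consists of periods.\<close>

lemma regular_rational_drift:
  fixes W :: "real \<Rightarrow> 'a::euclidean_space" and \<Phi> f :: "real \<Rightarrow> 'a"
  assumes fin: "finite X" and sumW: "(\<Sum>u\<in>X. W u) = 0" and sep: "well_separated \<alpha> X"
    and f: "f \<in> borel_measurable borel" "\<And>x. f (x + 1) = f x"
    and \<Phi>: "\<And>x. x \<in> {0..<1} \<Longrightarrow> \<Phi> x - step_cocycle X W x = f x - f (x + \<alpha>)"
    and \<epsilon>: "0 < \<epsilon>" "\<And>j. j \<in> int_span X W \<Longrightarrow> j \<noteq> 0 \<Longrightarrow> \<epsilon> \<le> norm j"
    and l: "0 < (l::int)" and a: "a \<in> int_span X W" and b: "b \<in> int_span X W"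
    and rel: "of_int l *\<^sub>R drift X W = \<alpha> *\<^sub>R a + b"
  shows "regular_cocycle (rotation \<alpha>) \<Phi>"
proof -
  define \<theta> where "\<theta> = a /\<^sub>R of_int l"
  define \<kappa> where "\<kappa> = drift X W - \<alpha> *\<^sub>R \<theta>"
  have l\<theta>: "of_int l *\<^sub>R \<theta> = a" using l by (simp add: \<theta>_def)
  have l\<kappa>: "of_int l *\<^sub>R \<kappa> = b"
  proof -
    have "of_int l *\<^sub>R \<kappa> = of_int l *\<^sub>R drift X W - \<alpha> *\<^sub>R (of_int l *\<^sub>R \<theta>)"
      by (simp add: \<kappa>_def scaleR_diff_right mult.commute)
    then show ?thesis by (simp add: l\<theta> rel)
  qed
  define H where "H = (\<lambda>(j, m, n). j + of_int m *\<^sub>R \<theta> + of_int n *\<^sub>R \<kappa>) ` (int_span X W \<times> (UNIV :: int set) \<times> (UNIV :: int set))"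
  have HI: "j + of_int m *\<^sub>R \<theta> + of_int n *\<^sub>R \<kappa> \<in> H" if "j \<in> int_span X W" for j and m n :: int
    unfolding H_def using that by (intro image_eqI[of _ _ "(j, m, n)"]) auto
  have HE: "\<exists>j\<in>int_span X W. \<exists>m n. h = j + of_int m *\<^sub>R \<theta> + of_int n *\<^sub>R \<kappa>" if "h \<in> H" for h
    using that unfolding H_def by force
  show ?thesis
  proof (rule regular_cocycle_discrete[where f = f and \<theta> = \<theta> and H = H and \<epsilon> = "\<epsilon> / of_int l"])
    show "countable H"
      unfolding H_def using countable_int_span[OF fin] by (intro countable_image countable_SIGMA) auto
    show "0 \<in> H" using HI[OF int_span_0, of 0 0] by simp
    show "x - y \<in> H" if xH: "x \<in> H" and yH: "y \<in> H" for x y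
    proof -
      obtain j m n where x: "j \<in> int_span X W" "x = j + of_int m *\<^sub>R \<theta> + of_int n *\<^sub>R \<kappa>"
        using HE[OF xH] by blast
      obtain j' m' n' where y: "j' \<in> int_span X W" "y = j' + of_int m' *\<^sub>R \<theta> + of_int n' *\<^sub>R \<kappa>"
        using HE[OF yH] by blast
      have "x - y = (j - j') + of_int (m - m') *\<^sub>R \<theta> + of_int (n - n') *\<^sub>R \<kappa>"
        by (simp add: x y scaleR_diff_left)
      then show ?thesis using HI[OF int_span_diff[OF x(1) y(1)]] by metis
    qed
    show "0 < \<epsilon> / of_int l" using \<epsilon>(1) l by simp
    show "\<epsilon> / of_int l \<le> norm h" if h: "h \<in> H" "h \<noteq> 0" for h
    proof -
      obtain j m n where x: "j \<in> int_span X W" "h = j + of_int m *\<^sub>R \<theta> + of_int n *\<^sub>R \<kappa>"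
        using HE[OF h(1)] by blast
      have "of_int l *\<^sub>R h = of_int l *\<^sub>R j + of_int m *\<^sub>R (of_int l *\<^sub>R \<theta>) + of_int n *\<^sub>R (of_int l *\<^sub>R \<kappa>)"
        by (simp add: x scaleR_add_right mult.commute)
      also have "\<dots> = of_int l *\<^sub>R j + of_int m *\<^sub>R a + of_int n *\<^sub>R b" by (simp only: l\<theta> l\<kappa>)
      also have "\<dots> \<in> int_span X W" by (intro int_span_add int_span_scale x a b)
      finally have "of_int l *\<^sub>R h \<in> int_span X W" .
      then have "\<epsilon> \<le> norm (of_int l *\<^sub>R h)" by (rule \<epsilon>(2)) (use h l in simp)
      then show ?thesis using l by (simp add: field_simps)
    qed
    show "step_cocycle X W x - (frac (x + \<alpha>) - frac x) *\<^sub>R \<theta> \<in> H" for x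
    proof -
      have "frac (x + \<alpha>) - frac x = \<alpha> - of_int (\<lfloor>x + \<alpha>\<rfloor> - \<lfloor>x\<rfloor>)" by (simp add: frac_def)
      then have "step_cocycle X W x - (frac (x + \<alpha>) - frac x) *\<^sub>R \<theta>
          = (step_cocycle X W x - drift X W) + of_int (\<lfloor>x + \<alpha>\<rfloor> - \<lfloor>x\<rfloor>) *\<^sub>R \<theta> + of_int 1 *\<^sub>R \<kappa>"
        by (simp add: \<kappa>_def scaleR_diff_left)
      then show ?thesis using HI[OF step_cocycle_mod_int_span[OF sumW]] by metis
    qed
    show "almost_period A (t, t *\<^sub>R \<theta> + h)" if A: "invariant_set \<alpha> (step_cocycle X W) A" and h: "h \<in> H" for A t h
    proof -
      note per = invariant_set_periods[OF fin sumW sep A]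
      have Ab: "A \<in> sets borel" using A by (simp add: invariant_set_def)
      have p1: "almost_period A (of_int l *\<^sub>R (1, \<theta>))"
        using almost_period_add[OF almost_period_of_int[OF per(1), of l] per(2)[OF a]] by (simp add: l\<theta>)
      have p2: "almost_period A ((of_int l * \<alpha>) *\<^sub>R (1, \<theta>))"
      proof -
        have "almost_period A (of_int l *\<^sub>R (\<alpha>, drift X W) - (0, b))"
          by (intro almost_period_diff almost_period_of_int per(3) per(2) b)
        moreover have "(of_int l * \<alpha>) *\<^sub>R \<theta> = \<alpha> *\<^sub>R a"
          using arg_cong[OF l\<theta>, of "scaleR \<alpha>"] by (simp add: mult.commute)
        ultimately show ?thesis by (simp add: rel)
      qed
      have line: "almost_period A (s *\<^sub>R (1, \<theta>))" for s
      proof (rule almost_period_scaleR[OF Ab])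
        fix e :: real assume "0 < e"
        then have "0 < e / of_int l" using l by simp
        from small_combination[OF this] obtain k p :: int
          where kp: "0 < \<bar>k * \<alpha> - p\<bar>" "\<bar>k * \<alpha> - p\<bar> < e / of_int l"
          by (elim exE conjE)
        have "almost_period A (of_int k *\<^sub>R ((of_int l * \<alpha>) *\<^sub>R (1, \<theta>)) - of_int p *\<^sub>R (of_int l *\<^sub>R (1, \<theta>)))"
          by (intro almost_period_diff almost_period_of_int p1 p2)
        then have "almost_period A ((of_int l * (k * \<alpha> - p)) *\<^sub>R (1, \<theta>))"
          by (simp add: algebra_simps)
        moreover have "\<bar>of_int l * (k * \<alpha> - p)\<bar> = of_int l * \<bar>k * \<alpha> - p\<bar>"
          using l by (simp add: abs_mult)
        ultimately show "\<exists>s. 0 < \<bar>s\<bar> \<and> \<bar>s\<bar> < e \<and> almost_period A (s *\<^sub>R (1, \<theta>))"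
          using kp l by (intro exI[of _ "of_int l * (k * \<alpha> - p)"]) (simp add: field_simps)
      qed
      have p\<theta>: "almost_period A (0, \<theta>)"
        using almost_period_diff[OF line[of 1] per(1)] by simp
      have p\<kappa>: "almost_period A (0, \<kappa>)"
        using almost_period_diff[OF per(3) line[of \<alpha>]] by (simp add: \<kappa>_def)
      obtain j m n where x: "j \<in> int_span X W" "h = j + of_int m *\<^sub>R \<theta> + of_int n *\<^sub>R \<kappa>"
        using HE[OF h] by blast
      have "almost_period A (t *\<^sub>R (1, \<theta>) + ((0, j) + of_int m *\<^sub>R (0, \<theta>) + of_int n *\<^sub>R (0, \<kappa>)))"
        by (intro almost_period_add almost_period_of_int line per(2) x p\<theta> p\<kappa>)
      then show ?thesis by (simp add: x(2))
    qed
  qed (use f \<Phi> step_cocycle_periodic in auto)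
qed

lemma almost_period_line_1:
  assumes "A \<in> sets borel" "almost_period A (1, 0)" "almost_period A (\<alpha>, 0)"
  shows "almost_period A (t, 0)"
proof -
  have "almost_period A (t *\<^sub>R (1, 0))"
  proof (rule almost_period_scaleR[OF assms(1)])
    fix e :: real assume "0 < e"
    from small_combination[OF this] obtain k p :: int
      where kp: "0 < \<bar>k * \<alpha> - p\<bar>" "\<bar>k * \<alpha> - p\<bar> < e"
      by (elim exE conjE)
    have "almost_period A (of_int k *\<^sub>R (\<alpha>, 0) - of_int p *\<^sub>R (1, 0))"
      by (intro almost_period_diff almost_period_of_int assms)
    then show "\<exists>s. 0 < \<bar>s\<bar> \<and> \<bar>s\<bar> < e \<and> almost_period A (s *\<^sub>R (1, 0))"
      using kp by (intro exI[of _ "k * \<alpha> - p"]) simp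
  qed
  then show ?thesis by simp
qed

text \<open>Kronecker's theorem for \<alpha>, \<kappa> and 1, whose linear independence over \<int>
  follows from the hypothesis and the irrationality of \<alpha>.\<close>

lemma kronecker_plane:
  assumes \<kappa>: "\<And>(l::int) (m::int) (n::int). of_int l * \<kappa> = of_int m * \<alpha> + of_int n \<Longrightarrow> l = 0" and "0 < e"
  shows "\<exists>(k::int) (m::int) (n::int). \<bar>of_int k * \<alpha> - of_int m - s\<bar> < e \<and> \<bar>of_int k * \<kappa> - of_int n - t\<bar> < e"
proof -
  define \<theta> where "\<theta> i = (if i = 0 then \<alpha> else if i = 1 then \<kappa> else 1)" for i :: nat
  define a where "a i = (if i = 0 then s else t)" for i :: nat
  \<comment> \<open>Makes \<open>dependent\<close> refer to \<real> as a module over \<int>.\<close>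
  interpret Modules.module "\<lambda>r x. real_of_int r * x"
    by (simp add: Modules.module.intro distrib_left mult.commute)
  have irr: "of_int m * \<alpha> + of_int n = 0 \<Longrightarrow> m = 0" for m n :: int
  proof (rule ccontr)
    assume "of_int m * \<alpha> + of_int n = 0" "m \<noteq> 0"
    then show False using approx_nonzero[of m "- n"] c_pos by (simp add: field_simps)
  qed
  have ne: "\<alpha> \<noteq> \<kappa>" "\<kappa> \<noteq> 1" "\<alpha> \<noteq> 1"
    using \<kappa>[of 1 1 0] \<kappa>[of 1 0 1] irr[of 1 "-1"] by auto
  have img: "\<theta> ` {..2} = {\<alpha>, \<kappa>, 1}"
    by (auto simp: \<theta>_def numeral_2_eq_2 atMost_Suc)
  have "\<not> dependent (\<theta> ` {..2})"
  proof
    assume "dependent (\<theta> ` {..2})"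
    then obtain u :: "real \<Rightarrow> int" where u: "\<exists>v\<in>{\<alpha>, \<kappa>, 1}. u v \<noteq> 0" "(\<Sum>v\<in>{\<alpha>, \<kappa>, 1}. u v * v) = 0"
      unfolding img by (subst (asm) dependent_finite) auto
    have sum: "u \<alpha> * \<alpha> + u \<kappa> * \<kappa> + u 1 = 0" using u(2) ne by simp
    then have "u \<kappa> * \<kappa> = of_int (- u \<alpha>) * \<alpha> + of_int (- u 1)" by simp
    from \<kappa>[OF this] have k0: "u \<kappa> = 0" .
    then have "u \<alpha> = 0" using sum irr[of "u \<alpha>" "u 1"] by simp
    then show False using u(1) sum k0 by simp
  qed
  moreover have "inj_on \<theta> {..2}"
    using ne by (auto simp: inj_on_def \<theta>_def numeral_2_eq_2 le_Suc_eq)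
  moreover have "\<theta> 2 = 1" by (simp add: \<theta>_def)
  ultimately obtain k m where "\<And>i. i < 2 \<Longrightarrow> \<bar>of_int k * \<theta> i - of_int (m i) - a i\<bar> < e"
    using Kronecker_thm_2[of \<theta> 2 e a] \<open>0 < e\<close> by auto
  from this[of 0] this[of 1] show ?thesis
    by (auto simp: \<theta>_def a_def)
qed

text \<open>If J has arbitrarily small nonzero elements, all vertical vectors are periods and the
  drift can be removed. If J is discrete and no relation l \<kappa> \<in> J\<alpha> + J holds, one
  nonzero w in J spans the fibre, and Kronecker's theorem for \<alpha> and \<kappa>/w makes the
  periods dense. This use of a single w is where the fibre must be one-dimensional.\<close>

lemma regular_real:
  fixes W :: "real \<Rightarrow> real" and \<Phi> f :: "real \<Rightarrow> real"
  assumes fin: "finite X" and sumW: "(\<Sum>u\<in>X. W u) = 0" and sep: "well_separated \<alpha> X"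
    and f: "f \<in> borel_measurable borel" "\<And>x. f (x + 1) = f x"
    and \<Phi>: "\<And>x. x \<in> {0..<1} \<Longrightarrow> \<Phi> x - step_cocycle X W x = f x - f (x + \<alpha>)"
  shows "regular_cocycle (rotation \<alpha>) \<Phi>"
proof -
  have full: ?thesis if "\<And>A s t. invariant_set \<alpha> (step_cocycle X W) A \<Longrightarrow> almost_period A (s, t)"
    using that step_cocycle_periodic
    by (intro regular_cocycle_full[OF cohomologous_rotationI[OF f step_cocycle_measurable \<Phi>] step_cocycle_measurable])
      auto
  show ?thesis
  proof (cases "\<exists>\<epsilon>>0. \<forall>j\<in>int_span X W. j \<noteq> 0 \<longrightarrow> \<epsilon> \<le> norm j")
    case False
    show ?thesis
    proof (rule full)
      fix A s t assume A: "invariant_set \<alpha> (step_cocycle X W) A"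
      note per = invariant_set_periods[OF fin sumW sep A]
      have Ab: "A \<in> sets borel" using A by (simp add: invariant_set_def)
      have fibre: "almost_period A (0, v)" for v
      proof -
        have "almost_period A (v *\<^sub>R (0, 1))"
        proof (rule almost_period_scaleR[OF Ab])
          fix e :: real assume "0 < e"
          then obtain j where "j \<in> int_span X W" "j \<noteq> 0" "norm j < e"
            using False by (auto simp: not_le)
          then show "\<exists>s. 0 < \<bar>s\<bar> \<and> \<bar>s\<bar> < e \<and> almost_period A (s *\<^sub>R (0, 1))"
            using per(2) by (intro exI[of _ j]) auto
        qed
        then show ?thesis by simp
      qed
      have "almost_period A (\<alpha>, 0)"
        using almost_period_diff[OF per(3) fibre[of "drift X W"]] by simp
      from almost_period_add[OF almost_period_line_1[OF Ab per(1) this, of s] fibre[of t]]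
      show "almost_period A (s, t)" by simp
    qed
  next
    case True
    then obtain \<epsilon> where \<epsilon>: "0 < \<epsilon>" "\<And>j. j \<in> int_span X W \<Longrightarrow> j \<noteq> 0 \<Longrightarrow> \<epsilon> \<le> norm j" by blast
    show ?thesis
    proof (cases "\<exists>l::int. 0 < l \<and> (\<exists>a\<in>int_span X W. \<exists>b\<in>int_span X W. of_int l *\<^sub>R drift X W = \<alpha> *\<^sub>R a + b)")
      case True
      then obtain l :: int and a b where "0 < l" "a \<in> int_span X W" "b \<in> int_span X W"
        "of_int l *\<^sub>R drift X W = \<alpha> *\<^sub>R a + b" by blast
      then show ?thesis using regular_rational_drift[OF fin sumW sep f \<Phi> \<epsilon>] by blast
    next
      case False
      \<comment> \<open>If all weights vanished, so would the drift, and l = 1 with a = b = 0 would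
        be an excluded relation.\<close>
      have "\<exists>u\<in>X. W u \<noteq> 0"
      proof (rule ccontr)
        assume "\<not> (\<exists>u\<in>X. W u \<noteq> 0)"
        then have "drift X W = 0" by (simp add: drift_def)
        then have "of_int 1 *\<^sub>R drift X W = \<alpha> *\<^sub>R 0 + 0" by simp
        then show False using False int_span_0 zero_less_one by blast
      qed
      then obtain w where w: "w \<in> int_span X W" "w \<noteq> 0"
        using int_span_base[OF fin] by blast
      have indep: "l = 0" if rel: "of_int l * (drift X W / w) = of_int m * \<alpha> + of_int n" for l m n :: int
      proof (rule ccontr)
        assume "l \<noteq> 0"
        have "of_int l * drift X W = \<alpha> * (of_int m * w) + of_int n * w"
          using rel w(2) by (simp add: field_simps)
        from arg_cong[OF this, of "\<lambda>z. of_int (sgn l) * z"]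
        have "of_int (sgn l * l) * drift X W = \<alpha> * (of_int (sgn l * m) * w) + of_int (sgn l * n) * w"
          by (simp only: of_int_mult distrib_left mult_ac)
        moreover have "0 < sgn l * l" using \<open>l \<noteq> 0\<close> by (simp add: sgn_if)
        moreover have "of_int (sgn l * m) * w \<in> int_span X W" "of_int (sgn l * n) * w \<in> int_span X W"
          using int_span_scale[OF w(1), of "sgn l * m"] int_span_scale[OF w(1), of "sgn l * n"] by simp_all
        ultimately show False using False by (metis real_scaleR_def)
      qed
      show ?thesis
      proof (rule full)
        fix A s t assume A: "invariant_set \<alpha> (step_cocycle X W) A"
        note per = invariant_set_periods[OF fin sumW sep A]
        show "almost_period A (s, t)"
        proof (rule almost_period_limit)
          show "A \<in> sets borel" using A by (simp add: invariant_set_def)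
          fix e :: real assume "0 < e"
          \<comment> \<open>The vertical error is multiplied by |w| when heights are measured in
            units of w.\<close>
          define e' where "e' = e / (1 + \<bar>w\<bar>)"
          have e': "0 < e'" using \<open>0 < e\<close> by (simp add: e'_def)
          have "\<exists>(k::int) (m::int) (n::int). \<bar>of_int k * \<alpha> - of_int m - s\<bar> < e' \<and>
              \<bar>of_int k * (drift X W / w) - of_int n - t / w\<bar> < e'"
            by (rule kronecker_plane[OF indep e'])
          then obtain k m n :: int where
            kmn: "\<bar>of_int k * \<alpha> - of_int m - s\<bar> < e'" "\<bar>of_int k * (drift X W / w) - of_int n - t / w\<bar> < e'"
            by (elim exE conjE)
          have "almost_period A (of_int k *\<^sub>R (\<alpha>, drift X W) - of_int m *\<^sub>R (1, 0) - of_int n *\<^sub>R (0, w))"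
            by (intro almost_period_diff almost_period_of_int per(1,3) per(2) w(1))
          then have "almost_period A (of_int k * \<alpha> - of_int m, of_int k * drift X W - of_int n * w)"
            by simp
          moreover have "norm ((of_int k * \<alpha> - of_int m, of_int k * drift X W - of_int n * w) - (s, t)) < e"
          proof -
            have "of_int k * drift X W - of_int n * w - t = w * (of_int k * (drift X W / w) - of_int n - t / w)"
              using w(2) by (simp add: field_simps)
            then have "\<bar>of_int k * drift X W - of_int n * w - t\<bar> \<le> \<bar>w\<bar> * e'"
              using kmn(2) by (simp add: abs_mult mult_left_mono)
            moreover have "norm (x, y) \<le> \<bar>x\<bar> + \<bar>y\<bar>" for x y :: real
              using norm_Pair_le[of x y] by simp
            ultimately have "norm (of_int k * \<alpha> - of_int m - s, of_int k * drift X W - of_int n * w - t) < e' + \<bar>w\<bar> * e'"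
              using kmn(1) by (smt (verit))
            also have "\<dots> = (1 + \<bar>w\<bar>) * e'" by (simp add: algebra_simps)
            also have "\<dots> = e" by (simp add: e'_def add_nonneg_eq_0_iff)
            finally show ?thesis by simp
          qed
          ultimately show "\<exists>v. norm (v - (s, t)) < e \<and> almost_period A v" by blast
        qed
      qed
    qed
  qed
qed

end

section \<open>The two families of cocycles as sums of sawteeth\<close>

lemma indicator_eq_saw:
  assumes "0 < a" "a < 1" "x \<in> {0..<1}"
  shows "indicator {0..<a} x - a = saw (x - a) - saw x"
proof -
  have fx: "frac x = x" using assms by (simp add: frac_eq)
  show ?thesis
  proof (cases "x < a")
    case True
    then have "frac (x - a) = x - a + 1"
      unfolding frac_unique_iff using assms by auto
    then show ?thesis using True assms fx by (simp add: saw_def)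
  next
    case False
    then have "frac (x - a) = x - a"
      using assms by (simp add: frac_eq)
    then show ?thesis using False assms fx by (simp add: saw_def)
  qed
qed

context badly_approximable begin

text \<open>By irrationality a rational element of the orbit group has no \<alpha> component and is
  therefore an integer.\<close>

lemma orbit_group_rational:
  assumes "of_int r / of_int s \<in> orbit_group \<alpha>" and s: "(0::int) < s"
  shows "s dvd r"
proof -
  obtain k p :: int where kp: "of_int r / of_int s = of_int k * \<alpha> + of_int p"
    using assms(1) by (auto simp: orbit_group_def)
  then have "of_int (s * k) * \<alpha> - of_int (r - s * p) = 0"
    using s by (simp add: field_simps)
  then have "s * k = 0"
    using approx_nonzero[of "s * k" "r - s * p"] c_pos by (cases "s * k = 0") (auto simp: field_simps)
  then have "of_int r / of_int s = (of_int p :: real)" using kp s by simp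
  then have "(of_int r :: real) = of_int (p * s)" using s by (simp add: field_simps)
  then show ?thesis by (metis dvd_triv_right of_int_eq_iff)
qed

lemma regular_real_sum:
  fixes t x :: "'i \<Rightarrow> real" and M :: int
  assumes fin: "finite I" and sum0: "(\<Sum>i\<in>I. t i) = 0" and M: "0 < M"
    and x: "\<And>i. i \<in> I \<Longrightarrow> \<exists>(m::int) (n::int). x i = (of_int m * \<beta> + of_int n) / of_int M"
    and \<Phi>: "\<And>y. y \<in> {0..<1} \<Longrightarrow> \<Phi> y = (\<Sum>i\<in>I. saw (y - x i) * t i)"
  shows "regular_cocycle (rotation \<alpha>) \<Phi>"
proof -
  show ?thesis
  proof (rule merge_equivalent_points[OF fin sum0, of x \<alpha>])
    fix X W
    assume X: "finite X" "X \<subseteq> x ` I"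
      and ineq: "\<And>u v. u \<in> X \<Longrightarrow> v \<in> X \<Longrightarrow> u - v \<in> orbit_group \<alpha> \<Longrightarrow> u = v"
      and "\<And>i. i \<in> I \<Longrightarrow> \<exists>u\<in>X. x i - u \<in> orbit_group \<alpha>"
      and "\<And>u. W u = (\<Sum>i | i \<in> I \<and> x i - u \<in> orbit_group \<alpha>. t i)"
      and sumW: "(\<Sum>u\<in>X. W u) = 0"
      and cob: "coboundary \<alpha> (\<lambda>y. (\<Sum>i\<in>I. saw (y - x i) *\<^sub>R t i) - step_cocycle X W y)"
    have sep: "well_separated \<alpha> X"
      using x X(2) by (intro well_separated_points[where \<beta> = \<beta>, OF M X(1) _ ineq]) auto
    obtain f where f: "f \<in> borel_measurable borel" "\<And>y. f (y + 1) = f y"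
      "\<And>y. (\<Sum>i\<in>I. saw (y - x i) *\<^sub>R t i) - step_cocycle X W y = f y - f (y + \<alpha>)"
      using cob unfolding coboundary_def by blast
    have "\<Phi> y - step_cocycle X W y = f y - f (y + \<alpha>)" if "y \<in> {0..<1}" for y
      using f(3)[of y] \<Phi>[OF that] by simp
    then show ?thesis by (rule regular_real[OF X(1) sumW sep f(1,2)])
  qed
qed

text \<open>The weights are integer vectors, so J lies in \<int>^2 and has gap 1 whatever is merged.
  It remains to find a relation for the drift, and l = s always works.\<close>

lemma regular_translated_pair:
  fixes q \<beta> :: real
  assumes q: "q \<in> \<rat>" "0 < q" "q < 1"
    and \<Phi>: "\<And>y. y \<in> {0..<1} \<Longrightarrow> \<Phi> y = (saw (y - q) - saw y, saw (y + \<beta> - q) - saw (y + \<beta>))"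
  shows "regular_cocycle (rotation \<alpha>) (\<Phi> :: real \<Rightarrow> real \<times> real)"
proof -
  obtain r s :: int where rs: "0 < s" "q = of_int r / of_int s"
    using Rats_cases'[OF q(1)] by metis
  \<comment> \<open>Left and right endpoints of the interval in the first coordinate, then the same
    for its translate in the second; left endpoints carry weight -1 and right endpoints +1.\<close>
  define x where "x i = [0, q, - \<beta>, q - \<beta>] ! i" for i :: nat
  define w :: "nat \<Rightarrow> real \<times> real" where "w i = [(-1, 0), (1, 0), (0, -1), (0, 1)] ! i" for i :: nat
  define I where "I = {0, 1, 2, 3 :: nat}"
  have fin: "finite I" by (simp add: I_def)
  have sum0: "(\<Sum>i\<in>I. w i) = 0"
    by (simp add: I_def w_def zero_prod_def)
  have \<Phi>': "\<Phi> y = (\<Sum>i\<in>I. saw (y - x i) *\<^sub>R w i)" if "y \<in> {0..<1}" for y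
    unfolding \<Phi>[OF that] by (simp add: I_def w_def x_def algebra_simps)
  show ?thesis
  proof (rule merge_equivalent_points[OF fin sum0, of x \<alpha>])
    fix X W
    assume X: "finite X" "X \<subseteq> x ` I"
      and ineq: "\<And>u v. u \<in> X \<Longrightarrow> v \<in> X \<Longrightarrow> u - v \<in> orbit_group \<alpha> \<Longrightarrow> u = v"
      and reps: "\<And>i. i \<in> I \<Longrightarrow> \<exists>u\<in>X. x i - u \<in> orbit_group \<alpha>"
      and W: "\<And>u. W u = (\<Sum>i | i \<in> I \<and> x i - u \<in> orbit_group \<alpha>. w i)"
      and sumW: "(\<Sum>u\<in>X. W u) = 0"
      and cob: "coboundary \<alpha> (\<lambda>y. (\<Sum>i\<in>I. saw (y - x i) *\<^sub>R w i) - step_cocycle X W y)"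
    have x_form: "\<exists>(m::int) (n::int). x i = (of_int m * \<beta> + of_int n / of_int s)" if "i \<in> I" for i
    proof -
      have "x 0 = of_int 0 * \<beta> + of_int 0 / of_int s" "x 1 = of_int 0 * \<beta> + of_int r / of_int s"
        "x 2 = of_int (-1) * \<beta> + of_int 0 / of_int s" "x 3 = of_int (-1) * \<beta> + of_int r / of_int s"
        by (simp_all add: x_def rs(2))
      then show ?thesis using that unfolding I_def by blast
    qed
    have sep: "well_separated \<alpha> X"
    proof (rule well_separated_points[OF rs(1) X(1) _ ineq])
      fix u assume "u \<in> X"
      then obtain i where "i \<in> I" "u = x i" using X by blast
      then obtain m n :: int where "u = of_int m * \<beta> + of_int n / of_int s" using x_form by metis
      then have "u = (of_int (m * s) * \<beta> + of_int n) / of_int s" using rs(1) by (simp add: field_simps)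
      then show "\<exists>(m::int) (n::int). u = (of_int m * \<beta> + of_int n) / of_int s" by blast
    qed
    obtain f where f: "f \<in> borel_measurable borel" "\<And>y. f (y + 1) = f y"
      "\<And>y. (\<Sum>i\<in>I. saw (y - x i) *\<^sub>R w i) - step_cocycle X W y = f y - f (y + \<alpha>)"
      using cob unfolding coboundary_def by blast
    have coh: "\<Phi> y - step_cocycle X W y = f y - f (y + \<alpha>)" if "y \<in> {0..<1}" for y
      using f(3)[of y] \<Phi>'[OF that] by simp
    have w_int: "\<exists>(m::int) (n::int). w i = (of_int m, of_int n)" if "i \<in> I" for i
    proof -
      have "w 0 = (of_int (-1), of_int 0)" "w 1 = (of_int 1, of_int 0)"
        "w 2 = (of_int 0, of_int (-1))" "w 3 = (of_int 0, of_int 1)"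
        by (simp_all add: w_def)
      then show ?thesis using that unfolding I_def by blast
    qed
    have sum_int: "\<exists>(m::int) (n::int). (\<Sum>i\<in>K. c i *\<^sub>R v i) = (of_int m, of_int n)"
      if "\<And>i. i \<in> K \<Longrightarrow> c i \<in> \<int>" "\<And>i. i \<in> K \<Longrightarrow> \<exists>(m::int) (n::int). v i = (of_int m, of_int n)"
      for K :: "'k set" and c :: "'k \<Rightarrow> real" and v :: "'k \<Rightarrow> real \<times> real"
    proof -
      have "fst (v i) \<in> \<int> \<and> snd (v i) \<in> \<int>" if "i \<in> K" for i
        using \<open>\<And>i. i \<in> K \<Longrightarrow> \<exists>(m::int) (n::int). v i = (of_int m, of_int n)\<close>[OF that] by auto
      then have "fst (\<Sum>i\<in>K. c i *\<^sub>R v i) \<in> \<int>" "snd (\<Sum>i\<in>K. c i *\<^sub>R v i) \<in> \<int>"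
        unfolding fst_sum snd_sum using that(1) by (auto intro!: Ints_sum Ints_mult)
      then show ?thesis by (metis Ints_cases prod.collapse)
    qed
    have W_int: "\<exists>(m::int) (n::int). W u = (of_int m, of_int n)" for u
      using sum_int[of "{i \<in> I. x i - u \<in> orbit_group \<alpha>}" "\<lambda>_. 1" w] w_int by (simp add: W)
    have discrete: "1 \<le> norm j" if j: "j \<in> int_span X W" "j \<noteq> 0" for j
    proof -
      obtain n where n: "j = (\<Sum>u\<in>X. of_int (n u) *\<^sub>R W u)" using j(1) by (auto simp: int_span_def)
      obtain a b :: int where ab: "j = (of_int a, of_int b)"
        unfolding n using sum_int[of X "\<lambda>u. of_int (n u)" W] W_int by auto
      have "a \<noteq> 0 \<or> b \<noteq> 0" using j(2) ab by (auto simp: zero_prod_def)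
      then have "1 \<le> \<bar>a\<bar> \<or> 1 \<le> \<bar>b\<bar>" by auto
      then have "1 \<le> \<bar>real_of_int a\<bar> \<or> 1 \<le> \<bar>real_of_int b\<bar>" by linarith
      moreover have "\<bar>real_of_int a\<bar> \<le> norm j" "\<bar>real_of_int b\<bar> \<le> norm j"
        unfolding ab using norm_fst_le[of "real_of_int a" "real_of_int b"] norm_snd_le[of "real_of_int b" "real_of_int a"]
        by simp_all
      ultimately show ?thesis by linarith
    qed
    have "\<exists>a\<in>int_span X W. \<exists>b\<in>int_span X W. of_int s *\<^sub>R drift X W = \<alpha> *\<^sub>R a + b"
    \<comment> \<open>In the first case s times every discontinuity lies in \<int>\<alpha> + \<int>,
      so the relation can be read off term by term. Outside it, neither \<beta> nor \<beta> plus or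
      minus q can be in the orbit group.\<close>
    proof (cases "\<exists>(k::int) (n::int). \<beta> = of_int k * \<alpha> + of_int n / of_int s")
      case True
      then obtain k n :: int where \<beta>: "\<beta> = of_int k * \<alpha> + of_int n / of_int s" by (elim exE)
      have "\<exists>z :: int \<times> int. of_int s * u = of_int (fst z) * \<alpha> + of_int (snd z)" if uX: "u \<in> X" for u
      proof -
        obtain i where "i \<in> I" "u = x i" using X uX by blast
        then obtain m' n' :: int where "u = of_int m' * \<beta> + of_int n' / of_int s" using x_form by metis
        then have "of_int s * u = of_int (s * m' * k) * \<alpha> + of_int (m' * n + n')"
          using rs(1) by (simp add: \<beta> field_simps)
        then show ?thesis by (intro exI[of _ "(s * m' * k, m' * n + n')"]) simp
      qed
      then obtain z :: "real \<Rightarrow> int \<times> int" where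
        z: "\<And>u. u \<in> X \<Longrightarrow> of_int s * u = of_int (fst (z u)) * \<alpha> + of_int (snd (z u))"
        by metis
      have "of_int s *\<^sub>R drift X W = - (\<Sum>u\<in>X. (of_int s * u) *\<^sub>R W u)"
        by (simp add: drift_def scaleR_sum_right)
      also have "(\<Sum>u\<in>X. (of_int s * u) *\<^sub>R W u)
          = (\<Sum>u\<in>X. \<alpha> *\<^sub>R (of_int (fst (z u)) *\<^sub>R W u) + of_int (snd (z u)) *\<^sub>R W u)"
        by (intro sum.cong refl) (simp add: z scaleR_add_left mult.commute[of \<alpha>])
      also have "- \<dots> = \<alpha> *\<^sub>R (0 - (\<Sum>u\<in>X. of_int (fst (z u)) *\<^sub>R W u)) + (0 - (\<Sum>u\<in>X. of_int (snd (z u)) *\<^sub>R W u))"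
        by (simp add: sum.distrib scaleR_sum_right)
      finally have "of_int s *\<^sub>R drift X W = \<alpha> *\<^sub>R (0 - (\<Sum>u\<in>X. of_int (fst (z u)) *\<^sub>R W u))
          + (0 - (\<Sum>u\<in>X. of_int (snd (z u)) *\<^sub>R W u))" .
      then show ?thesis
        using int_span_diff[OF int_span_0 int_span_memI[of "\<lambda>u. fst (z u)" W X]]
          int_span_diff[OF int_span_0 int_span_memI[of "\<lambda>u. snd (z u)" W X]] by blast
    next
      case False
      (* No two of the four discontinuities are equivalent, so nothing was merged. *)
      have sr: "\<not> s dvd r"
      proof
        assume "s dvd r"
        then obtain m where "r = s * m" by (elim dvdE)
        then have "q = of_int m" using rs by simp
        then show False using q by simp
      qed
      have no\<beta>: "\<beta> + of_int n / of_int s \<notin> orbit_group \<alpha>" for n :: int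
      proof
        assume "\<beta> + of_int n / of_int s \<in> orbit_group \<alpha>"
        then obtain k p :: int where "\<beta> + of_int n / of_int s = of_int k * \<alpha> + of_int p"
          by (auto simp: orbit_group_def)
        then have "\<beta> = of_int k * \<alpha> + of_int (p * s - n) / of_int s"
          using rs(1) by (simp add: field_simps)
        then show False using False by blast
      qed
      have not: "q \<notin> orbit_group \<alpha>" "\<beta> \<notin> orbit_group \<alpha>" "\<beta> + q \<notin> orbit_group \<alpha>" "\<beta> - q \<notin> orbit_group \<alpha>"
        using orbit_group_rational[of r s] rs sr no\<beta>[of 0] no\<beta>[of r] no\<beta>[of "- r"] by auto
      have neg: "y \<in> orbit_group \<alpha> \<longleftrightarrow> - y \<in> orbit_group \<alpha>" for y
        using orbit_group_minus_iff[of y 0 \<alpha>] by simp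
      have not': "- q \<notin> orbit_group \<alpha>" "- \<beta> \<notin> orbit_group \<alpha>" "- \<beta> - q \<notin> orbit_group \<alpha>" "q - \<beta> \<notin> orbit_group \<alpha>"
        using not neg[of q] neg[of \<beta>] neg[of "\<beta> + q"] neg[of "\<beta> - q"] by simp_all
      have inj: "i = j" if ij: "i \<in> I" "j \<in> I" and eq: "x i - x j \<in> orbit_group \<alpha>" for i j
        using ij eq not not' by (auto simp: I_def x_def add.commute)
      have xX: "x i \<in> X" if iI: "i \<in> I" for i
      proof -
        obtain u where u: "u \<in> X" "x i - u \<in> orbit_group \<alpha>" using reps iI by blast
        then obtain j where "j \<in> I" "u = x j" using X by blast
        then show ?thesis using inj iI u by blast
      qed
      have Wx: "W (x i) = w i" if "i \<in> I" for i
      proof -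
        have "{j. j \<in> I \<and> x j - x i \<in> orbit_group \<alpha>} = {i}"
          using inj that orbit_group_0 by auto
        then show ?thesis by (simp add: W)
      qed
      have X_eq: "X = x ` I" using X xX by blast
      have injx: "inj_on x I" using inj orbit_group_0 by (auto simp: inj_on_def)
      \<comment> \<open>With all four points present, \<beta> occurs once with each sign in the
        second coordinate and cancels; the drift is - q (1, 1), whose multiple by s = denominator of
        q is integral in J.\<close>
      have "drift X W = - (\<Sum>i\<in>I. x i *\<^sub>R w i)"
        unfolding drift_def X_eq using Wx by (simp add: sum.reindex[OF injx])
      also have "\<dots> = - q *\<^sub>R (w 1 + w 3)"
        by (simp add: I_def x_def w_def algebra_simps)
      finally have "of_int s *\<^sub>R drift X W = \<alpha> *\<^sub>R 0 + of_int (- r) *\<^sub>R (w 1 + w 3)"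
        using rs by simp
      moreover have "w 1 + w 3 \<in> int_span X W"
        using int_span_add[OF int_span_base[OF X(1) xX[of 1]] int_span_base[OF X(1) xX[of 3]], of W] Wx[of 1] Wx[of 3]
        by (simp add: I_def)
      ultimately show ?thesis
        using int_span_0 int_span_scale by blast
    qed
    then show ?thesis
      using regular_rational_drift[OF X(1) sumW sep f(1,2) coh zero_less_one discrete rs(1)] by blast
  qed
qed

end

lemma common_denominator:
  fixes q :: "'i \<Rightarrow> real"
  assumes "finite I" "\<And>i. i \<in> I \<Longrightarrow> q i \<in> \<rat>"
  shows "\<exists>M>0. \<forall>i\<in>I. \<exists>m::int. q i = of_int m / of_int M"
  using assms
proof (induction I)
  case empty
  show ?case by (intro exI[of _ 1]) simp
next
  case (insert i I)
  then obtain M where M: "M > 0" "\<And>j. j \<in> I \<Longrightarrow> \<exists>m::int. q j = of_int m / of_int M" by auto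
  obtain r s :: int where rs: "s > 0" "q i = of_int r / of_int s"
    using Rats_cases'[of "q i"] insert.prems by (metis insertI1)
  have "\<exists>m::int. q j = of_int m / of_int (M * s)" if j: "j \<in> insert i I" for j
  proof (cases "j = i")
    case True
    then show ?thesis using rs M(1) by (intro exI[of _ "r * M"]) simp
  next
    case False
    then obtain m :: int where "q j = of_int m / of_int M" using M(2) j by blast
    then show ?thesis using rs(1) by (intro exI[of _ "m * s"]) simp
  qed
  then show ?case using M(1) rs(1) by (intro exI[of _ "M * s"]) simp
qed

theorem corollary3p9:
  fixes \<alpha> \<beta> :: real
  assumes "0 < \<alpha>" and "\<alpha> < 1" and "bounded_type \<alpha>"
  shows
    "(\<forall>q::real. q \<in> \<rat> \<and> 0 < q \<and> q < 1 \<longrightarrow>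
        regular_cocycle (rotation \<alpha>)
          (\<lambda>x. (indicator {0..<q} x - q, indicator {0..<q} (frac (x + \<beta>)) - q) :: real \<times> real)) \<and>
     (\<forall>(d::nat) (q::nat \<Rightarrow> real).
        1 \<le> d \<and> (\<forall>i\<in>{1..d}. q i \<in> \<rat> \<and> 0 < q i * \<beta> \<and> q i * \<beta> < 1) \<longrightarrow>
        (\<forall>t::nat \<Rightarrow> real.
           regular_cocycle (rotation \<alpha>)
             (\<lambda>x. (\<Sum>i=1..d. t i * indicator {0..<q i * \<beta>} x) - \<beta> * (\<Sum>i=1..d. t i * q i))))"
proof -
  obtain c where c: "0 < c" "\<And>q p :: int. q > 0 \<Longrightarrow> c / of_int q \<le> \<bar>of_int q * \<alpha> - of_int p\<bar>"
    by (rule bounded_type_imp_badly_approximable[OF assms]) blast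
  interpret badly_approximable \<alpha> c
    by unfold_locales (use c in auto)
  show ?thesis
  proof (intro conjI allI impI)
    fix q :: real assume q: "q \<in> \<rat> \<and> 0 < q \<and> q < 1"
    \<comment> \<open>Lets the indicator identity, valid on the fundamental domain, be applied at
      \<open>frac (y + \<beta>)\<close> and rewritten without \<open>frac\<close>.\<close>
    have saw_frac: "saw (frac y - a) = saw (y - a)" for y a
      using saw_diff_of_int[of "y - a" "\<lfloor>y\<rfloor>"] by (simp add: frac_def algebra_simps)
    show "regular_cocycle (rotation \<alpha>)
      (\<lambda>x. (indicator {0..<q} x - q, indicator {0..<q} (frac (x + \<beta>)) - q) :: real \<times> real)"
    proof (rule regular_translated_pair[of q _ \<beta>])
      fix y :: real assume y: "y \<in> {0..<1}"
      show "(indicator {0..<q} y - q, indicator {0..<q} (frac (y + \<beta>)) - q)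
          = (saw (y - q) - saw y, saw (y + \<beta> - q) - saw (y + \<beta>))"
        using indicator_eq_saw[of q y] indicator_eq_saw[of q "frac (y + \<beta>)"] q y
          saw_frac[of "y + \<beta>" q] saw_frac[of "y + \<beta>" 0] by (simp add: frac_lt_1)
    qed (use q in auto)
  next
    fix d :: nat and q t :: "nat \<Rightarrow> real"
    assume dq: "1 \<le> d \<and> (\<forall>i\<in>{1..d}. q i \<in> \<rat> \<and> 0 < q i * \<beta> \<and> q i * \<beta> < 1)"
    then have q: "\<And>i. i \<in> {1..d} \<Longrightarrow> q i \<in> \<rat>" "\<And>i. i \<in> {1..d} \<Longrightarrow> 0 < q i * \<beta>" "\<And>i. i \<in> {1..d} \<Longrightarrow> q i * \<beta> < 1"
      by blast+
    obtain M :: int where M: "0 < M" "\<And>i. i \<in> {1..d} \<Longrightarrow> \<exists>m::int. q i = of_int m / of_int M"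
      using common_denominator[of "{1..d}" q] q(1) by auto
    \<comment> \<open>All intervals share the left endpoint 0. It receives the free index 0 and
      minus the total weight, so that the weights sum to zero.\<close>
    define x where "x i = (if i = 0 then 0 else q i * \<beta>)" for i
    define w where "w i = (if i = 0 then - (\<Sum>i=1..d. t i) else t i)" for i
    have split: "(\<Sum>i\<in>{0..d}. h i) = h 0 + (\<Sum>i=1..d. h i)" for h :: "nat \<Rightarrow> real"
      by (simp add: sum.atLeast_Suc_atMost)
    show "regular_cocycle (rotation \<alpha>)
      (\<lambda>x. (\<Sum>i=1..d. t i * indicator {0..<q i * \<beta>} x) - \<beta> * (\<Sum>i=1..d. t i * q i))"
    proof (rule regular_real_sum[where I = "{0..d}" and t = w and x = x and M = M and \<beta> = \<beta>])
      show "(\<Sum>i\<in>{0..d}. w i) = 0"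
        unfolding split by (simp add: w_def)
      show "\<exists>(m::int) (n::int). x i = (of_int m * \<beta> + of_int n) / of_int M" if i: "i \<in> {0..d}" for i
      proof (cases "i = 0")
        case True
        then show ?thesis by (intro exI[of _ 0]) (simp add: x_def)
      next
        case False
        then obtain m :: int where "q i = of_int m / of_int M" using M(2)[of i] i by auto
        then show ?thesis using False by (intro exI[of _ m] exI[of _ 0]) (simp add: x_def)
      qed
      fix y :: real assume y: "y \<in> {0..<1}"
      have "(\<Sum>i=1..d. t i * indicator {0..<q i * \<beta>} y) - \<beta> * (\<Sum>i=1..d. t i * q i)
          = (\<Sum>i=1..d. t i * (indicator {0..<q i * \<beta>} y - q i * \<beta>))"
        by (simp add: right_diff_distrib sum_subtractf sum_distrib_left mult_ac)
      also have "\<dots> = (\<Sum>i=1..d. t i * (saw (y - q i * \<beta>) - saw y))"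
        by (rule sum.cong) (use indicator_eq_saw[OF q(2,3) y] in auto)
      also have "\<dots> = (\<Sum>i\<in>{0..d}. saw (y - x i) * w i)"
        unfolding split
        by (simp add: x_def w_def right_diff_distrib sum_subtractf sum_distrib_left mult_ac)
      finally show "(\<Sum>i=1..d. t i * indicator {0..<q i * \<beta>} y) - \<beta> * (\<Sum>i=1..d. t i * q i)
          = (\<Sum>i\<in>{0..d}. saw (y - x i) * w i)" .
    qed (use M in auto)
  qed
qed

end
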